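(* The exact propositional modal validities of worlds in the categories of sets (notation in the context) are as follows. (1) **$\mathbf{Sets}$ (functions).** The validities of the empty world are $\mathsf{Lollipop}$. For every $n>0$ and every world of finite size $n$, the sentential validities are $\mathsf{S5}$ and the formulaic validities are $\mathsf{Prepartition}_n$. For every infinite world, the sentential validities are $\mathsf{S5}$ and the formulaic validities are $\mathsf{S4.2}$. (2) **$\mathbf{Sets}[\mathrm{surj}]$ (surjections).** The validities of the empty world are $\mathsf{Triv}$. For every $n>0$ and every world of finite size $n$, the sentential validities are $\mathsf{Grz.3J}_n$ and the formulaic validities are $\mathsf{Partition}_n$. For every infinite world, the sentential validities are $\mathsf{Grz.3}$ and the formulaic validities are $\mathsf{Grz.2}$. (3) **$\mathbf{Sets}[\mathrm{inj}]$ (injections) and $\mathbf{Sets}[\mathrm{incl}]$ (inclusions).** In each of these two categories, for every finite world (empty or not) both the sentential and the formulaic validities are $\mathsf{Grz.3}$, and for every infinite world both the sentential and the formulaic validities are $\mathsf{Triv}$. (4) **$\mathbf{Sets}[\mathrm{bij}]$ (bijections) and $\mathbf{Sets}[\mathrm{id}]$ (identities).** In each of these two categories, for every world (empty, finite or infinite) both the sentential and the formulaic validities are $\mathsf{Triv}$. (5) **Finite sets.** For each of these six classes of morphisms, the (sentential, respectively formulaic) validities at any finite world are the same in the category of all sets as in the corresponding full subcategory of finite sets. (6) **Infinite sets.** In each of the full subcategories of infinite sets $\mathbf{InfSets}$, $\mathbf{InfSets}[\mathrm{surj}]$, $\mathbf{InfSets}[\mathrm{inj}]$, $\mathbf{InfSets}[\mathrm{incl}]$,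 $\mathbf{InfSets}[\mathrm{bij}]$, $\mathbf{InfSets}[\mathrm{id}]$, the sentential validities of every world are $\mathsf{Triv}$. The formulaic validities of every world are $\mathsf{Grz.2}$ in $\mathbf{InfSets}$ and in $\mathbf{InfSets}[\mathrm{surj}]$, and are $\mathsf{Triv}$ in $\mathbf{InfSets}[\mathrm{inj}]$, $\mathbf{InfSets}[\mathrm{incl}]$, $\mathbf{InfSets}[\mathrm{bij}]$ and $\mathbf{InfSets}[\mathrm{id}]$.
   Context: **Categories.** $\mathbf{Sets}$ is the category of all sets (including the empty set) and all functions. $\mathbf{Sets}[\mathrm{surj}]$, $\mathbf{Sets}[\mathrm{inj}]$, $\mathbf{Sets}[\mathrm{incl}]$, $\mathbf{Sets}[\mathrm{bij}]$, $\mathbf{Sets}[\mathrm{id}]$ have the same objects, with morphisms respectively the surjective functions, injective functions, inclusion maps of subsets, bijections, and identity maps. $\mathbf{FinSets}[\cdot]$ and $\mathbf{InfSets}[\cdot]$ are the corresponding full subcategories of finite, respectively infinite, sets. Objects are called worlds and morphisms accessibility mappings. **Language and semantics.** $\mathcal L_{=}$ is the first-order language with equality and no other non-logical symbols; sets are viewed as $\mathcal L_=$-structures. $\mathcal L_{=}^{\Diamond}$ is its first-order modal expansion: formulas are built from atomic formulas $x=y$ by Boolean connectives, quantifiers, and the operators $\Diamond,\Box$. For a world $W$ of a category $\mathcal C$ and an assignment $\nu$ of elements of $W$ to variables, $W\models_{\mathcal C}\varphi[\nu]$ is defined by the usual Tarskian clauses together with: $W\models_{\mathcal C}\Diamond\varphi[\nu]$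 iff there is a morphism $f\colon W\to U$ in $\mathcal C$ with $U\models_{\mathcal C}\varphi[f\circ\nu]$; and $W\models_{\mathcal C}\Box\varphi[\nu]$ iff $U\models_{\mathcal C}\varphi[f\circ\nu]$ for every morphism $f\colon W\to U$ in $\mathcal C$. For a language $\mathscr L$ and world $W$, $\mathscr L_W$ denotes $\mathscr L$ with parameters from $W$ allowed. **Validities.** A propositional modal formula $\varphi(p_0,\dots,p_k)$ is valid at a world $W$ of $\mathcal C$ with respect to a language of substitution instances if every substitution instance $\varphi(\psi_0,\dots,\psi_k)$, with $\psi_0,\dots,\psi_k$ assertions of that language, is true at $W$ in $\mathcal C$. $\mathrm{Val}_{\mathcal C}(W,\mathscr L)$ is the set of all propositional modal formulas valid at $W$ with respect to sentences of $\mathscr L$; $\mathrm{Val}_{\mathcal C}(W,\mathscr L_W)$ is the set of those valid with respect to formulas of $\mathscr L$ with parameters from $W$ (every free variable being instantiated by an element of $W$). "The sentential validities of $W$ are $T$" means $\mathrm{Val}_{\mathcal C}(W,\mathscr L)=T$ for every language $\mathscr L$, modal or not, with $\mathcal L_=\subseteq\mathscr L\subseteq\mathcal L_=^\Diamond$. "The formulaic validities of $W$ are $T$" means $\mathrm{Val}_{\mathcal C}(W,\mathscr L_W)=T$ for every such $\mathscr L$. At the empty world the two notions coincide. **Propositional modal theories.** A normal theory contains all propositional tautologies, $\mathrm K\colon \Box(p\to q)\to(\Box p\to\Box q)$ and $\mathrm{Dual}\colon\neg\Diamond p\leftrightarrow\Box\neg p$, and is closed under modus ponens, substitution and necessitation.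 Axioms: $\mathrm T\colon \Box p\to p$; $4\colon\Box p\to\Box\Box p$; $5\colon\Diamond\Box p\to p$; $.2\colon\Diamond\Box p\to\Box\Diamond p$; $.3\colon\Box(\Box p\to q)\vee\Box(\Box q\to p)$; $\mathrm{Grz}\colon\Box(\Box(p\to\Box p)\to p)\to p$; $\mathrm{Triv}\colon \Box p\leftrightarrow p$; and recursively $\mathrm J_1$ is $\Diamond\Box p_1\to p_1$ and $\mathrm J_{n+1}$ is $\Diamond(\Box p_{n+1}\wedge\neg \mathrm J_n)\to p_{n+1}$. $\mathsf{S4}$ is the least normal theory containing $\mathrm T$ and $4$. The following are the least normal theories extending the displayed ones: $\mathsf{S4.2}=\mathsf{S4}+.2$; $\mathsf{S4.3}=\mathsf{S4}+.3$; $\mathsf{S5}=\mathsf{S4}+5$; $\mathsf{Grz.2}=\mathsf{S4.2}+\mathrm{Grz}$; $\mathsf{Grz.3}=\mathsf{S4.3}+\mathrm{Grz}$; $\mathsf{Grz.3J}_n=\mathsf{Grz.3}+\mathrm J_n$; and $\mathsf{Triv}$ is the normal theory with axiom $\mathrm{Triv}$ (and $4$). $\mathsf{Lollipop}$ is the set of propositional modal formulas true, under every valuation, at the initial node of every lollipop frame; a lollipop frame is a reflexive transitive frame consisting of a single initial node, not accessible from any other node, that accesses a nonempty cluster of mutually accessible nodes, with no further nodes. Partitions of a set are ordered by refinement: $P\le Q$ iff every block of $P$ is contained in a block of $Q$; viewed as a Kripke frame, $P$ accesses $Q$ iff $P\le Q$. $\mathsf{Partition}_n$ is the set of propositional modal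 formulas valid in the partition lattice of an $n$-element set. A partition prelattice over an $n$-element set is a preorder (reflexive transitive relation) whose quotient by the equivalence $p\equiv q\iff p\le q\le p$ is the partition lattice of that $n$-element set (i.e. each partition is replaced by a nonempty cluster). $\mathsf{Prepartition}_n$ is the set of propositional modal formulas valid in all partition prelattices over an $n$-element set. *)

theory Defs
  imports Main "HOL-Library.FuncSet" "HOL-Library.Disjoint_Sets"
begin

section \<open>Propositional modal logic\<close>

text \<open>Negation and conjunction are the primitive Boolean connectives. Both modalities are
  primitive, being linked only by the axiom Dual in normal theories.\<close>

datatype pm = PVar nat | PNeg pm | PAnd pm pm | PBox pm | PDia pm

abbreviation POr :: "pm \<Rightarrow> pm \<Rightarrow> pm" where
  "POr p q \<equiv> PNeg (PAnd (PNeg p) (PNeg q))"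

abbreviation PImp :: "pm \<Rightarrow> pm \<Rightarrow> pm" where
  "PImp p q \<equiv> PNeg (PAnd p (PNeg q))"

abbreviation PIff :: "pm \<Rightarrow> pm \<Rightarrow> pm" where
  "PIff p q \<equiv> PAnd (PImp p q) (PImp q p)"

primrec psubst :: "(nat \<Rightarrow> pm) \<Rightarrow> pm \<Rightarrow> pm" where
  "psubst s (PVar i) = s i"
| "psubst s (PNeg p) = PNeg (psubst s p)"
| "psubst s (PAnd p q) = PAnd (psubst s p) (psubst s q)"
| "psubst s (PBox p) = PBox (psubst s p)"
| "psubst s (PDia p) = PDia (psubst s p)"

text \<open>Boolean evaluation, where formulas starting with a modality count as atoms.\<close>

primrec beval :: "(pm \<Rightarrow> bool) \<Rightarrow> pm \<Rightarrow> bool" where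
  "beval v (PVar i) \<longleftrightarrow> v (PVar i)"
| "beval v (PNeg p) \<longleftrightarrow> \<not> beval v p"
| "beval v (PAnd p q) \<longleftrightarrow> beval v p \<and> beval v q"
| "beval v (PBox p) \<longleftrightarrow> v (PBox p)"
| "beval v (PDia p) \<longleftrightarrow> v (PDia p)"

definition tautology :: "pm \<Rightarrow> bool" where
  "tautology p \<longleftrightarrow> (\<forall>v. beval v p)"

abbreviation (input) "p0 \<equiv> PVar 0"
abbreviation (input) "q0 \<equiv> PVar 1"

definition ax_K :: pm where "ax_K = PImp (PBox (PImp p0 q0)) (PImp (PBox p0) (PBox q0))"
definition ax_Dual :: pm where "ax_Dual = PIff (PNeg (PDia p0)) (PBox (PNeg p0))"
definition ax_T :: pm where "ax_T = PImp (PBox p0) p0"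
definition ax_4 :: pm where "ax_4 = PImp (PBox p0) (PBox (PBox p0))"
definition ax_5 :: pm where "ax_5 = PImp (PDia (PBox p0)) p0"
definition ax_dot2 :: pm where "ax_dot2 = PImp (PDia (PBox p0)) (PBox (PDia p0))"
definition ax_dot3 :: pm where
  "ax_dot3 = POr (PBox (PImp (PBox p0) q0)) (PBox (PImp (PBox q0) p0))"
definition ax_Grz :: pm where
  "ax_Grz = PImp (PBox (PImp (PBox (PImp p0 (PBox p0))) p0)) p0"
definition ax_Triv :: pm where "ax_Triv = PIff (PBox p0) p0"

text \<open>Indexed from 1; the value at 0 is left unspecified.\<close>

fun ax_J :: "nat \<Rightarrow> pm" where
  "ax_J (Suc 0) = PImp (PDia (PBox (PVar 1))) (PVar 1)"
| "ax_J (Suc (Suc n)) =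
     PImp (PDia (PAnd (PBox (PVar (Suc (Suc n)))) (PNeg (ax_J (Suc n))))) (PVar (Suc (Suc n)))"

inductive_set normal_theory :: "pm set \<Rightarrow> pm set" for A :: "pm set" where
  axiom: "p \<in> A \<Longrightarrow> p \<in> normal_theory A"
| taut: "tautology p \<Longrightarrow> p \<in> normal_theory A"
| K: "ax_K \<in> normal_theory A"
| Dual: "ax_Dual \<in> normal_theory A"
| mp: "PImp p q \<in> normal_theory A \<Longrightarrow> p \<in> normal_theory A \<Longrightarrow> q \<in> normal_theory A"
| subst: "p \<in> normal_theory A \<Longrightarrow> psubst s p \<in> normal_theory A"
| nec: "p \<in> normal_theory A \<Longrightarrow> PBox p \<in> normal_theory A"

definition S4_2 :: "pm set" where "S4_2 = normal_theory {ax_T, ax_4, ax_dot2}"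
definition S5 :: "pm set" where "S5 = normal_theory {ax_T, ax_4, ax_5}"
definition Grz_2 :: "pm set" where "Grz_2 = normal_theory {ax_T, ax_4, ax_dot2, ax_Grz}"
definition Grz_3 :: "pm set" where "Grz_3 = normal_theory {ax_T, ax_4, ax_dot3, ax_Grz}"
definition Grz_3J :: "nat \<Rightarrow> pm set" where
  "Grz_3J n = normal_theory {ax_T, ax_4, ax_dot3, ax_Grz, ax_J n}"
definition Triv :: "pm set" where "Triv = normal_theory {ax_Triv, ax_4}"

section \<open>Kripke frames\<close>

text \<open>A frame is a set of nodes \<open>X\<close> with an accessibility relation \<open>r\<close>.\<close>

primrec ksat :: "'w set \<Rightarrow> 'w rel \<Rightarrow> (nat \<Rightarrow> 'w set) \<Rightarrow> 'w \<Rightarrow> pm \<Rightarrow> bool" where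
  "ksat X r V w (PVar i) \<longleftrightarrow> w \<in> V i"
| "ksat X r V w (PNeg p) \<longleftrightarrow> \<not> ksat X r V w p"
| "ksat X r V w (PAnd p q) \<longleftrightarrow> ksat X r V w p \<and> ksat X r V w q"
| "ksat X r V w (PBox p) \<longleftrightarrow> (\<forall>u\<in>X. (w, u) \<in> r \<longrightarrow> ksat X r V u p)"
| "ksat X r V w (PDia p) \<longleftrightarrow> (\<exists>u\<in>X. (w, u) \<in> r \<and> ksat X r V u p)"

definition frame_valid :: "'w set \<Rightarrow> 'w rel \<Rightarrow> pm set" where
  "frame_valid X r = {p. \<forall>V. \<forall>w\<in>X. ksat X r V w p}"

text \<open>A definition cannot range over frames on all types, so \<open>Lollipop\<close> and \<open>Prepartition\<close>
  take the type \<open>'w\<close> of nodes as a parameter, which is meant to stand for any infinite type.\<close>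

definition lollipop_frame :: "'w set \<Rightarrow> 'w rel \<Rightarrow> 'w \<Rightarrow> bool" where
  "lollipop_frame X r a \<longleftrightarrow> preorder_on X r \<and> a \<in> X \<and> X - {a} \<noteq> {} \<and>
     (\<forall>x\<in>X - {a}. (a, x) \<in> r \<and> (x, a) \<notin> r) \<and>
     (\<forall>x\<in>X - {a}. \<forall>y\<in>X - {a}. (x, y) \<in> r)"

definition Lollipop :: "'w itself \<Rightarrow> pm set" where
  "Lollipop _ = {p. \<forall>(X :: 'w set) r a V. lollipop_frame X r a \<longrightarrow> ksat X r V a p}"

definition partitions :: "nat \<Rightarrow> nat set set set" where
  "partitions n = {P. partition_on {..<n} P}"

definition refinement :: "nat \<Rightarrow> nat set set rel" where
  "refinement n = {(P, Q). refines {..<n} P Q}"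

definition Partition :: "nat \<Rightarrow> pm set" where
  "Partition n = frame_valid (partitions n) (refinement n)"

definition mutual :: "'w set \<Rightarrow> 'w rel \<Rightarrow> 'w rel" where
  "mutual X r = {(x, y). x \<in> X \<and> y \<in> X \<and> (x, y) \<in> r \<and> (y, x) \<in> r}"

text \<open>The last two conjuncts say that \<open>h\<close> is an order isomorphism from the quotient order
  onto the partition lattice.\<close>

definition partition_prelattice :: "nat \<Rightarrow> 'w set \<Rightarrow> 'w rel \<Rightarrow> bool" where
  "partition_prelattice n X r \<longleftrightarrow> preorder_on X r \<and>
     (\<exists>h. bij_betw h (X // mutual X r) (partitions n) \<and>
          (\<forall>A\<in>X // mutual X r. \<forall>B\<in>X // mutual X r.
             (\<exists>x\<in>A. \<exists>y\<in>B. (x, y) \<in> r) \<longleftrightarrow> (h A, h B) \<in> refinement n))"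

definition Prepartition :: "'w itself \<Rightarrow> nat \<Rightarrow> pm set" where
  "Prepartition _ n =
     {p. \<forall>(X :: 'w set) r. partition_prelattice n X r \<longrightarrow> p \<in> frame_valid X r}"

section \<open>Categories of sets\<close>

text \<open>HOL has no type of all sets. A class of sets is therefore represented by a family
  \<open>\<U>\<close> of sets over an arbitrary type that satisfies separation, replacement and infinity.
  Over a type of ZFC sets, the family of all small sets is of this kind and gives the
  category of all sets; over an infinite type, so does the family of all sets over the type.
  No further closure condition is imposed, so that results about all such \<open>\<U>\<close>
  cover these cases.\<close>

definition set_universe :: "'a set set \<Rightarrow> bool" where
  "set_universe \<U> \<longleftrightarrow>
     (\<forall>W\<in>\<U>. \<forall>U. U \<subseteq> W \<longrightarrow> U \<in> \<U>) \<and>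
     (\<forall>W\<in>\<U>. \<forall>f. f ` W \<in> \<U>) \<and>
     (\<exists>W\<in>\<U>. infinite W)"

lemma set_universe_UNIV: "infinite (UNIV :: 'a set) \<Longrightarrow> set_universe (UNIV :: 'a set set)"
  unfolding set_universe_def by auto

record 'a setcat =
  Obj :: "'a set set"
  Hom :: "'a set \<Rightarrow> 'a set \<Rightarrow> ('a \<Rightarrow> 'a) set"

datatype mor_class = Func | Surj | Inj | Incl | Bij | Ident

text \<open>Functions are extensional, so that distinct HOL functions are distinct morphisms.\<close>

fun hom_maps :: "mor_class \<Rightarrow> 'a set \<Rightarrow> 'a set \<Rightarrow> ('a \<Rightarrow> 'a) set" where
  "hom_maps Func W U = W \<rightarrow>\<^sub>E U"
| "hom_maps Surj W U = {f \<in> W \<rightarrow>\<^sub>E U. f ` W = U}"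
| "hom_maps Inj W U = {f \<in> W \<rightarrow>\<^sub>E U. inj_on f W}"
| "hom_maps Incl W U = {f. W \<subseteq> U \<and> f = (\<lambda>x\<in>W. x)}"
| "hom_maps Bij W U = {f \<in> W \<rightarrow>\<^sub>E U. bij_betw f W U}"
| "hom_maps Ident W U = {f. W = U \<and> f = (\<lambda>x\<in>W. x)}"

definition Sets :: "'a set set \<Rightarrow> mor_class \<Rightarrow> 'a setcat" where
  "Sets \<U> k = \<lparr>Obj = \<U>, Hom = hom_maps k\<rparr>"

definition FinSets :: "'a set set \<Rightarrow> mor_class \<Rightarrow> 'a setcat" where
  "FinSets \<U> k = \<lparr>Obj = {W \<in> \<U>. finite W}, Hom = hom_maps k\<rparr>"

definition InfSets :: "'a set set \<Rightarrow> mor_class \<Rightarrow> 'a setcat" where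
  "InfSets \<U> k = \<lparr>Obj = {W \<in> \<U>. infinite W}, Hom = hom_maps k\<rparr>"

section \<open>The modal language of equality\<close>

text \<open>The type \<open>fm\<close> is the full modal language; the variables are indexed by \<open>nat\<close>.\<close>

datatype fm = Eq nat nat | Neg fm | And fm fm | Ex nat fm | All nat fm | Dia fm | Box fm

primrec fv :: "fm \<Rightarrow> nat set" where
  "fv (Eq x y) = {x, y}"
| "fv (Neg \<phi>) = fv \<phi>"
| "fv (And \<phi> \<psi>) = fv \<phi> \<union> fv \<psi>"
| "fv (Ex x \<phi>) = fv \<phi> - {x}"
| "fv (All x \<phi>) = fv \<phi> - {x}"
| "fv (Dia \<phi>) = fv \<phi>"
| "fv (Box \<phi>) = fv \<phi>"

primrec modal_free :: "fm \<Rightarrow> bool" where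
  "modal_free (Eq x y) \<longleftrightarrow> True"
| "modal_free (Neg \<phi>) \<longleftrightarrow> modal_free \<phi>"
| "modal_free (And \<phi> \<psi>) \<longleftrightarrow> modal_free \<phi> \<and> modal_free \<psi>"
| "modal_free (Ex x \<phi>) \<longleftrightarrow> modal_free \<phi>"
| "modal_free (All x \<phi>) \<longleftrightarrow> modal_free \<phi>"
| "modal_free (Dia \<phi>) \<longleftrightarrow> False"
| "modal_free (Box \<phi>) \<longleftrightarrow> False"

definition L_eq :: "fm set" where "L_eq = {\<phi>. modal_free \<phi>}"

definition L_eq_dia :: "fm set" where "L_eq_dia = UNIV"

text \<open>Only the values of \<open>\<nu>\<close> on the free variables of the formula matter. Assignments are
  total functions, also at the empty world, so they need not take values in \<open>W\<close> elsewhere.\<close>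

primrec sat :: "'a setcat \<Rightarrow> 'a set \<Rightarrow> (nat \<Rightarrow> 'a) \<Rightarrow> fm \<Rightarrow> bool" where
  "sat C W \<nu> (Eq x y) \<longleftrightarrow> \<nu> x = \<nu> y"
| "sat C W \<nu> (Neg \<phi>) \<longleftrightarrow> \<not> sat C W \<nu> \<phi>"
| "sat C W \<nu> (And \<phi> \<psi>) \<longleftrightarrow> sat C W \<nu> \<phi> \<and> sat C W \<nu> \<psi>"
| "sat C W \<nu> (Ex x \<phi>) \<longleftrightarrow> (\<exists>a\<in>W. sat C W (\<nu>(x := a)) \<phi>)"
| "sat C W \<nu> (All x \<phi>) \<longleftrightarrow> (\<forall>a\<in>W. sat C W (\<nu>(x := a)) \<phi>)"
| "sat C W \<nu> (Dia \<phi>) \<longleftrightarrow> (\<exists>U\<in>Obj C. \<exists>f\<in>Hom C W U. sat C U (f \<circ> \<nu>) \<phi>)"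
| "sat C W \<nu> (Box \<phi>) \<longleftrightarrow> (\<forall>U\<in>Obj C. \<forall>f\<in>Hom C W U. sat C U (f \<circ> \<nu>) \<phi>)"

section \<open>Validities\<close>

primrec inst :: "(nat \<Rightarrow> fm) \<Rightarrow> pm \<Rightarrow> fm" where
  "inst \<sigma> (PVar i) = \<sigma> i"
| "inst \<sigma> (PNeg p) = Neg (inst \<sigma> p)"
| "inst \<sigma> (PAnd p q) = And (inst \<sigma> p) (inst \<sigma> q)"
| "inst \<sigma> (PBox p) = Box (inst \<sigma> p)"
| "inst \<sigma> (PDia p) = Dia (inst \<sigma> p)"

definition Val_sent :: "'a setcat \<Rightarrow> 'a set \<Rightarrow> fm set \<Rightarrow> pm set" where
  "Val_sent C W L =
     {p. \<forall>\<sigma>. (\<forall>i. \<sigma> i \<in> L \<and> fv (\<sigma> i) = {}) \<longrightarrow> (\<forall>\<nu>. sat C W \<nu> (inst \<sigma> p))}"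

text \<open>A formula with parameters from \<open>W\<close> is a formula with an assignment of elements of
  \<open>W\<close> to its free variables. One assignment serves all substituted formulas: in a language
  closed under renaming of variables, these can be chosen with disjoint sets of free variables.
  At the empty world only sentences qualify.\<close>

definition Val_form :: "'a setcat \<Rightarrow> 'a set \<Rightarrow> fm set \<Rightarrow> pm set" where
  "Val_form C W L =
     {p. \<forall>\<sigma> \<nu>. (\<forall>i. \<sigma> i \<in> L \<and> \<nu> ` fv (\<sigma> i) \<subseteq> W) \<longrightarrow> sat C W \<nu> (inst \<sigma> p)}"

definition sentential_validities :: "'a setcat \<Rightarrow> 'a set \<Rightarrow> pm set \<Rightarrow> bool" where
  "sentential_validities C W T \<longleftrightarrow>
     (\<forall>L. L_eq \<subseteq> L \<and> L \<subseteq> L_eq_dia \<longrightarrow> Val_sent C W L = T)"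

definition formulaic_validities :: "'a setcat \<Rightarrow> 'a set \<Rightarrow> pm set \<Rightarrow> bool" where
  "formulaic_validities C W T \<longleftrightarrow>
     (\<forall>L. L_eq \<subseteq> L \<and> L \<subseteq> L_eq_dia \<longrightarrow> Val_form C W L = T)"

end

theory Submission
  imports Defs
begin

text \<open>The proof rests on one observation about truth and two constructions.

  Truth of a formula of the full modal language at a world depends only on the equality pattern of
  the values of its free variables and on the size of the world, where all sizes above a bound
  computed from the formula count as the same (\<open>stable\<close>). This is a back-and-forth argument: a
  morphism out of one of two similar worlds is matched by a morphism out of the other one into a
  similar world (\<open>lift_hom\<close>). It also shows that finite worlds satisfy the same formulas among all
  sets as among the finite sets (\<open>sat_FinSets\<close>).

  Soundness. The axioms of the normal theories hold for all substitution instances at once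
  (\<open>normal_sound\<close>). T and 4 come from identities and composition; .2, .3 and 5 come from the ways in
  which two accessible worlds can be brought together, again only up to similarity. Grz is not a
  property of the accessibility relation, since chains of injections ascend for ever, but a single
  formula changes its truth value along a morphism only if a number attached to the world
  strictly decreases (\<open>holds_Grz\<close>). The theories \<open>Lollipop\<close>, \<open>Partition\<close> and \<open>Prepartition\<close> are
  given by frames; here the accessible worlds are gathered into finitely many types, which form a
  frame of the required kind (\<open>types_truth\<close>, \<open>Lollipop_sound\<close>).

  Completeness. A formula outside \<open>S4_2\<close> or \<open>S5\<close> is refuted in a filtration of the canonical model;
  one outside \<open>Grz_2\<close>, \<open>Grz_3\<close> or \<open>Grz_3J n\<close> is refuted on a finite partial order made from the
  points of the canonical model that never return to their type after leaving it
  (\<open>complete_Grz_2\<close>, \<open>complete_linear\<close>). Such a finite model is simulated by worlds: if the node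
  simulated by a world is determined by the equality pattern of finitely many parameters and by the
  size up to a bound, then the valuation is definable in the language of equality, and the refutation
  turns into a false substitution instance (\<open>not_valid_by_simulation\<close>). Sizes alone give the finite
  linear orders, descending along surjections and ascending along injections. Equality patterns
  form the lattice of equivalence relations, which maps onto every finite preorder with a least and
  a greatest cluster (\<open>eqv_map_directed\<close>) and onto its own upper cones (\<open>eqv_map_cone\<close>). For
  arbitrary functions the target may moreover be enlarged at will, so that sizes move around inside
  a cluster (\<open>not_valid_Func\<close>).\<close>

section \<open>Normal theories and maximal consistent sets\<close>

abbreviation PTop :: pm where "PTop \<equiv> PImp (PVar 0) (PVar 0)"

primrec PConj :: "pm list \<Rightarrow> pm" where
  "PConj [] = PTop"
| "PConj (q # qs) = PAnd q (PConj qs)"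

lemma beval_PConj [simp]: "beval v (PConj qs) \<longleftrightarrow> (\<forall>q\<in>set qs. beval v q)"
  by (induction qs) auto

definition consistent :: "pm set \<Rightarrow> pm set \<Rightarrow> bool" where
  "consistent A \<Gamma> \<longleftrightarrow> (\<forall>qs. set qs \<subseteq> \<Gamma> \<longrightarrow> PNeg (PConj qs) \<notin> normal_theory A)"

definition mcs :: "pm set \<Rightarrow> pm set \<Rightarrow> bool" where
  "mcs A \<Gamma> \<longleftrightarrow> consistent A \<Gamma> \<and> (\<forall>\<Delta>. \<Gamma> \<subseteq> \<Delta> \<and> consistent A \<Delta> \<longrightarrow> \<Delta> = \<Gamma>)"

definition canonical :: "pm set \<Rightarrow> pm set \<Rightarrow> bool" where
  "canonical \<Gamma> \<Delta> \<longleftrightarrow> (\<forall>q. PBox q \<in> \<Gamma> \<longrightarrow> q \<in> \<Delta>)"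

lemma taut_mp:
  "tautology (PImp p q) \<Longrightarrow> p \<in> normal_theory A \<Longrightarrow> q \<in> normal_theory A"
  by (blast intro: normal_theory.taut normal_theory.mp)

lemma taut_mp2:
  "tautology (PImp p (PImp q r)) \<Longrightarrow> p \<in> normal_theory A \<Longrightarrow> q \<in> normal_theory A \<Longrightarrow>
    r \<in> normal_theory A"
  by (blast intro: normal_theory.taut normal_theory.mp)

lemma taut_mp3:
  "tautology (PImp p (PImp q (PImp r s))) \<Longrightarrow> p \<in> normal_theory A \<Longrightarrow> q \<in> normal_theory A \<Longrightarrow>
    r \<in> normal_theory A \<Longrightarrow> s \<in> normal_theory A"
  by (blast intro: normal_theory.taut normal_theory.mp)

lemma box_mono:
  assumes "PImp p q \<in> normal_theory A"
  shows "PImp (PBox p) (PBox q) \<in> normal_theory A"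
proof -
  have "psubst (\<lambda>i. if i = 0 then p else q) ax_K \<in> normal_theory A"
    by (rule normal_theory.subst[OF normal_theory.K])
  then show ?thesis
    using normal_theory.nec[OF assms] by (auto simp: ax_K_def intro: normal_theory.mp)
qed

lemma box_conj: "PImp (PConj (map PBox qs)) (PBox (PConj qs)) \<in> normal_theory A"
proof (induction qs)
  case Nil
  have "PBox PTop \<in> normal_theory A"
    by (intro normal_theory.nec normal_theory.taut) (auto simp: tautology_def)
  then show ?case
    by (rule taut_mp[rotated]) (auto simp: tautology_def)
next
  case (Cons q qs)
  have 1: "PImp (PBox q) (PBox (PImp (PConj qs) (PAnd q (PConj qs)))) \<in> normal_theory A"
    by (intro box_mono normal_theory.taut) (auto simp: tautology_def)
  have 2: "psubst (\<lambda>i. if i = 0 then PConj qs else PAnd q (PConj qs)) ax_K \<in> normal_theory A"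
    by (rule normal_theory.subst[OF normal_theory.K])
  show ?case
    by (rule taut_mp3[OF _ Cons 1 2]) (auto simp: ax_K_def tautology_def)
qed

lemma lindenbaum:
  assumes "consistent A \<Gamma>"
  obtains \<Delta> where "\<Gamma> \<subseteq> \<Delta>" "mcs A \<Delta>"
proof -
  let ?A = "{\<Delta>. \<Gamma> \<subseteq> \<Delta> \<and> consistent A \<Delta>}"
  have "\<exists>M\<in>?A. \<forall>X\<in>?A. M \<subseteq> X \<longrightarrow> X = M"
  proof (rule subset_Zorn_nonempty)
    show "?A \<noteq> {}" using assms by auto
    fix C assume C: "C \<noteq> {}" "subset.chain ?A C"
    have "consistent A (\<Union>C)"
      unfolding consistent_def
    proof (intro allI impI)
      fix qs assume "set qs \<subseteq> \<Union>C"
      then obtain B where "B \<in> C" "set qs \<subseteq> B"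
        using finite_subset_Union_chain[OF _ _ C(1,2)] by blast
      then show "PNeg (PConj qs) \<notin> normal_theory A"
        using C(2) by (auto simp: subset.chain_def consistent_def)
    qed
    moreover obtain B where "B \<in> C" using C(1) by auto
    moreover have "\<Gamma> \<subseteq> B" using C(2) \<open>B \<in> C\<close> unfolding subset.chain_def by blast
    ultimately show "\<Union>C \<in> ?A" by blast
  qed
  then obtain M where "M \<in> ?A" "\<forall>X\<in>?A. M \<subseteq> X \<longrightarrow> X = M" by blast
  then show ?thesis
    by (intro that[of M]) (auto simp: mcs_def)
qed

lemma mcs_closed:
  assumes "mcs A \<Gamma>" "set qs \<subseteq> \<Gamma>" "PImp (PConj qs) q \<in> normal_theory A"
  shows "q \<in> \<Gamma>"
proof -
  have "consistent A (insert q \<Gamma>)"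
    unfolding consistent_def
  proof (intro allI impI notI)
    fix rs assume rs: "set rs \<subseteq> insert q \<Gamma>" "PNeg (PConj rs) \<in> normal_theory A"
    have "PNeg (PConj (filter (\<lambda>x. x \<noteq> q) rs @ qs)) \<in> normal_theory A"
      by (rule taut_mp2[OF _ rs(2) assms(3)]) (auto simp: tautology_def)
    moreover have "set (filter (\<lambda>x. x \<noteq> q) rs @ qs) \<subseteq> \<Gamma>" using rs assms by auto
    ultimately show False using assms(1) by (auto simp: mcs_def consistent_def)
  qed
  then show ?thesis using assms(1) by (auto simp: mcs_def)
qed

lemma mcs_theory: "mcs A \<Gamma> \<Longrightarrow> q \<in> normal_theory A \<Longrightarrow> q \<in> \<Gamma>"
  by (rule mcs_closed[of A \<Gamma> "[]"]) (auto intro!: taut_mp[of q] simp: tautology_def)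

lemma mcs_neg:
  assumes "mcs A \<Gamma>" shows "PNeg q \<in> \<Gamma> \<longleftrightarrow> q \<notin> \<Gamma>"
proof
  assume "PNeg q \<in> \<Gamma>"
  moreover have "PNeg (PConj [q, PNeg q]) \<in> normal_theory A"
    by (rule normal_theory.taut) (auto simp: tautology_def)
  ultimately show "q \<notin> \<Gamma>"
    using assms by (fastforce simp: mcs_def consistent_def simp del: PConj.simps)
next
  assume "q \<notin> \<Gamma>"
  then have "\<not> consistent A (insert q \<Gamma>)" using assms by (auto simp: mcs_def)
  then obtain rs where rs: "set rs \<subseteq> insert q \<Gamma>" "PNeg (PConj rs) \<in> normal_theory A"
    by (auto simp: consistent_def)
  have "PImp (PConj (filter (\<lambda>x. x \<noteq> q) rs)) (PNeg q) \<in> normal_theory A"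
    by (rule taut_mp[OF _ rs(2)]) (auto simp: tautology_def)
  then show "PNeg q \<in> \<Gamma>"
    by (rule mcs_closed[OF assms, rotated]) (use rs in auto)
qed

lemma mcs_and:
  assumes "mcs A \<Gamma>" shows "PAnd p q \<in> \<Gamma> \<longleftrightarrow> p \<in> \<Gamma> \<and> q \<in> \<Gamma>"
proof -
  have h: "PImp (PConj [PAnd p q]) p \<in> normal_theory A" "PImp (PConj [PAnd p q]) q \<in> normal_theory A"
    "PImp (PConj [p, q]) (PAnd p q) \<in> normal_theory A"
    by (auto intro!: normal_theory.taut simp: tautology_def)
  have "p \<in> \<Gamma>" "q \<in> \<Gamma>" if "PAnd p q \<in> \<Gamma>"
    using mcs_closed[OF assms _ h(1)] mcs_closed[OF assms _ h(2)] that by simp_all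
  moreover have "PAnd p q \<in> \<Gamma>" if "p \<in> \<Gamma>" "q \<in> \<Gamma>"
    using that by (intro mcs_closed[OF assms _ h(3)]) simp
  ultimately show ?thesis by blast
qed

lemma mcs_mp: "mcs A \<Gamma> \<Longrightarrow> PImp p q \<in> \<Gamma> \<Longrightarrow> p \<in> \<Gamma> \<Longrightarrow> q \<in> \<Gamma>"
  by (auto simp: mcs_neg mcs_and)

lemma mcs_conj: "mcs A \<Gamma> \<Longrightarrow> PConj qs \<in> \<Gamma> \<longleftrightarrow> set qs \<subseteq> \<Gamma>"
  by (induction qs) (auto simp: mcs_and mcs_neg)

lemma mcs_subst: "mcs A \<Gamma> \<Longrightarrow> p \<in> normal_theory A \<Longrightarrow> psubst s p \<in> \<Gamma>"
  by (blast intro: mcs_theory normal_theory.subst)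

lemma mcs_box_mp:
  assumes "mcs A \<Gamma>" "PBox p \<in> \<Gamma>" "PImp p q \<in> normal_theory A"
  shows "PBox q \<in> \<Gamma>"
  using assms box_mono[OF assms(3)] by (blast intro: mcs_mp mcs_theory)

lemma mcs_box_conj:
  assumes "mcs A \<Gamma>" "set qs \<subseteq> {q. PBox q \<in> \<Gamma>}"
  shows "PBox (PConj qs) \<in> \<Gamma>"
  using mcs_closed[OF assms(1) _ box_conj[of qs]] assms(2) by auto

lemma mcs_dia:
  assumes "mcs A \<Gamma>" shows "PDia q \<in> \<Gamma> \<longleftrightarrow> PBox (PNeg q) \<notin> \<Gamma>"
  using mcs_subst[OF assms normal_theory.Dual, of "\<lambda>_. q"] assms
  by (auto simp: ax_Dual_def mcs_and mcs_neg)

lemma mcs_box: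
  assumes "mcs A \<Gamma>"
  shows "PBox p \<in> \<Gamma> \<longleftrightarrow> (\<forall>\<Delta>. mcs A \<Delta> \<and> canonical \<Gamma> \<Delta> \<longrightarrow> p \<in> \<Delta>)"
proof (intro iffI allI impI)
  assume R: "\<forall>\<Delta>. mcs A \<Delta> \<and> canonical \<Gamma> \<Delta> \<longrightarrow> p \<in> \<Delta>"
  show "PBox p \<in> \<Gamma>"
  proof (rule ccontr)
    assume p: "PBox p \<notin> \<Gamma>"
    have "consistent A (insert (PNeg p) {q. PBox q \<in> \<Gamma>})"
      unfolding consistent_def
    proof (intro allI impI notI)
      fix rs assume rs: "set rs \<subseteq> insert (PNeg p) {q. PBox q \<in> \<Gamma>}" "PNeg (PConj rs) \<in> normal_theory A"
      let ?qs = "filter (\<lambda>x. x \<noteq> PNeg p) rs"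
      have "PImp (PConj ?qs) p \<in> normal_theory A"
        by (rule taut_mp[OF _ rs(2)]) (auto simp: tautology_def)
      moreover have "PBox (PConj ?qs) \<in> \<Gamma>"
        by (rule mcs_box_conj[OF assms]) (use rs in auto)
      ultimately show False using p mcs_box_mp[OF assms] by blast
    qed
    then obtain \<Delta> where "insert (PNeg p) {q. PBox q \<in> \<Gamma>} \<subseteq> \<Delta>" "mcs A \<Delta>"
      by (rule lindenbaum)
    then show False using R by (auto simp: canonical_def mcs_neg)
  qed
qed (auto simp: canonical_def)

lemma mcs_dia_ex:
  assumes "mcs A \<Gamma>"
  shows "PDia p \<in> \<Gamma> \<longleftrightarrow> (\<exists>\<Delta>. mcs A \<Delta> \<and> canonical \<Gamma> \<Delta> \<and> p \<in> \<Delta>)"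
  unfolding mcs_dia[OF assms] mcs_box[OF assms] by (auto simp: mcs_neg)

lemma mcs_refute:
  assumes "p \<notin> normal_theory A"
  shows "\<exists>\<Gamma>. mcs A \<Gamma> \<and> p \<notin> \<Gamma>"
proof -
  have "consistent A {PNeg p}"
    unfolding consistent_def
  proof (intro allI impI notI)
    fix rs assume rs: "set rs \<subseteq> {PNeg p}" "PNeg (PConj rs) \<in> normal_theory A"
    have "p \<in> normal_theory A"
      by (rule taut_mp[OF _ rs(2)]) (use rs(1) in \<open>auto simp: tautology_def\<close>)
    then show False using assms by simp
  qed
  then show ?thesis
    by (rule lindenbaum) (auto simp: mcs_neg)
qed

lemma complete_Triv:
  assumes "p \<notin> Triv"
  shows "\<exists>V. \<not> ksat {()} UNIV V () p"
proof -
  obtain \<Gamma> where G: "mcs {ax_Triv, ax_4} \<Gamma>" "p \<notin> \<Gamma>"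
    using assms mcs_refute unfolding Triv_def by blast
  have box: "PBox q \<in> \<Gamma> \<longleftrightarrow> q \<in> \<Gamma>" for q
    using mcs_subst[OF G(1) normal_theory.axiom, of ax_Triv "\<lambda>_. q"] G(1)
    by (auto simp: ax_Triv_def mcs_and mcs_neg)
  have "ksat {()} UNIV (\<lambda>i. {_. PVar i \<in> \<Gamma>}) () q \<longleftrightarrow> q \<in> \<Gamma>" for q
    by (induction q) (auto simp: box mcs_neg[OF G(1)] mcs_and[OF G(1)] mcs_dia[OF G(1)])
  then show ?thesis using G by blast
qed

section \<open>The canonical frame of an extension of S4\<close>

locale s4 =
  fixes A :: "pm set"
  assumes ax_T: "ax_T \<in> normal_theory A" and ax_4: "ax_4 \<in> normal_theory A"
begin

lemma box_T: "mcs A \<Gamma> \<Longrightarrow> PBox p \<in> \<Gamma> \<Longrightarrow> p \<in> \<Gamma>"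
  using mcs_subst[OF _ ax_T, of \<Gamma> "\<lambda>_. p"] by (auto simp: ax_T_def mcs_and mcs_neg)

lemma box_4: "mcs A \<Gamma> \<Longrightarrow> PBox p \<in> \<Gamma> \<Longrightarrow> PBox (PBox p) \<in> \<Gamma>"
  using mcs_subst[OF _ ax_4, of \<Gamma> "\<lambda>_. p"] by (auto simp: ax_4_def mcs_and mcs_neg)

lemma canonical_refl: "mcs A \<Gamma> \<Longrightarrow> canonical \<Gamma> \<Gamma>"
  by (auto simp: canonical_def box_T)

lemma canonical_trans: "mcs A \<Gamma> \<Longrightarrow> canonical \<Gamma> \<Delta> \<Longrightarrow> canonical \<Delta> \<Theta> \<Longrightarrow> canonical \<Gamma> \<Theta>"
  using box_4 by (force simp: canonical_def)

text \<open>If the demands of two successors contradicted each other, there would be \<open>Box a\<close> in the first and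
  \<open>Box b\<close> in the second with \<open>a implies not b\<close> a theorem; but .2 carries \<open>Dia b\<close> into the first.\<close>

lemma canonical_directed:
  assumes "ax_dot2 \<in> normal_theory A"
    and "mcs A \<Gamma>" "mcs A \<Delta>" "mcs A \<Theta>" "canonical \<Gamma> \<Delta>" "canonical \<Gamma> \<Theta>"
  shows "\<exists>\<Xi>. mcs A \<Xi> \<and> canonical \<Delta> \<Xi> \<and> canonical \<Theta> \<Xi>"
proof -
  have "consistent A ({q. PBox q \<in> \<Delta>} \<union> {q. PBox q \<in> \<Theta>})"
    unfolding consistent_def
  proof (intro allI impI notI)
    fix rs assume rs: "set rs \<subseteq> {q. PBox q \<in> \<Delta>} \<union> {q. PBox q \<in> \<Theta>}" "PNeg (PConj rs) \<in> normal_theory A"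
    define a where "a = PConj (filter (\<lambda>q. PBox q \<in> \<Delta>) rs)"
    define b where "b = PConj (filter (\<lambda>q. PBox q \<in> \<Theta>) rs)"
    have "PImp a (PNeg b) \<in> normal_theory A"
      unfolding a_def b_def
      by (rule taut_mp[OF _ rs(2)]) (use rs(1) in \<open>auto simp: tautology_def\<close>)
    moreover have "PBox a \<in> \<Delta>" "PBox b \<in> \<Theta>"
      unfolding a_def b_def using assms by (auto intro!: mcs_box_conj)
    ultimately have "PBox (PNeg b) \<in> \<Delta>"
      using assms mcs_box_mp by blast
    moreover have "PDia (PBox b) \<in> \<Gamma>"
      using assms \<open>PBox b \<in> \<Theta>\<close> by (auto simp: mcs_dia_ex)
    then have "PBox (PDia b) \<in> \<Gamma>"
      using mcs_subst[OF assms(2,1), of "\<lambda>_. b"] assms(2) mcs_mp by (auto simp: ax_dot2_def)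
    then have "PDia b \<in> \<Delta>" using assms by (auto simp: canonical_def)
    ultimately show False using assms by (auto simp: mcs_dia)
  qed
  then show ?thesis by (rule lindenbaum) (auto simp: canonical_def)
qed

lemma canonical_linear:
  assumes "ax_dot3 \<in> normal_theory A"
    and "mcs A \<Gamma>" "mcs A \<Delta>" "mcs A \<Theta>" "canonical \<Gamma> \<Delta>" "canonical \<Gamma> \<Theta>"
  shows "canonical \<Delta> \<Theta> \<or> canonical \<Theta> \<Delta>"
proof (rule ccontr)
  assume "\<not> ?thesis"
  then obtain a b where ab: "PBox a \<in> \<Delta>" "a \<notin> \<Theta>" "PBox b \<in> \<Theta>" "b \<notin> \<Delta>"
    by (auto simp: canonical_def)
  have "PBox (PImp (PBox a) b) \<in> \<Gamma> \<or> PBox (PImp (PBox b) a) \<in> \<Gamma>"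
    using mcs_subst[OF assms(2,1), of "\<lambda>i. if i = 0 then a else b"] assms(2)
    by (auto simp: ax_dot3_def mcs_and mcs_neg)
  then show False
    using ab assms by (auto simp: canonical_def dest!: mcs_mp)
qed

lemma canonical_sym:
  assumes "ax_5 \<in> normal_theory A" and "mcs A \<Gamma>" "mcs A \<Delta>" "canonical \<Gamma> \<Delta>"
  shows "canonical \<Delta> \<Gamma>"
  unfolding canonical_def
proof (intro allI impI)
  fix q assume "PBox q \<in> \<Delta>"
  then have "PDia (PBox q) \<in> \<Gamma>" using assms by (auto simp: mcs_dia_ex)
  then show "q \<in> \<Gamma>"
    using mcs_subst[OF assms(2,1), of "\<lambda>_. q"] assms(2) mcs_mp by (auto simp: ax_5_def)
qed

end

primrec subfm :: "pm \<Rightarrow> pm set" where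
  "subfm (PVar i) = {PVar i}"
| "subfm (PNeg p) = insert (PNeg p) (subfm p)"
| "subfm (PAnd p q) = insert (PAnd p q) (subfm p \<union> subfm q)"
| "subfm (PBox p) = insert (PBox p) (subfm p)"
| "subfm (PDia p) = insert (PDia p) (subfm p)"

lemma finite_subfm [simp]: "finite (subfm p)"
  by (induction p) auto

lemma subfm_self [simp]: "p \<in> subfm p"
  by (cases p) auto

lemma subfm_closed:
  "PNeg q \<in> subfm p \<Longrightarrow> q \<in> subfm p"
  "PAnd q r \<in> subfm p \<Longrightarrow> q \<in> subfm p \<and> r \<in> subfm p"
  "PBox q \<in> subfm p \<Longrightarrow> q \<in> subfm p"
  "PDia q \<in> subfm p \<Longrightarrow> q \<in> subfm p"
  by (induction p) auto

text \<open>The truth lemma is the same for filtrations and for the partial orders below. Their nodes carry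
  traces of maximal consistent sets on the subformulas, and only the modal clauses depend on the
  construction.\<close>

lemma ksat_labels:
  assumes "\<And>a. a \<in> X \<Longrightarrow> \<exists>\<Delta>. mcs A \<Delta> \<and> l a = \<Delta> \<inter> subfm p"
    and "\<And>a q. a \<in> X \<Longrightarrow> PBox q \<in> subfm p \<Longrightarrow> PBox q \<in> l a \<longleftrightarrow> (\<forall>b\<in>X. (a, b) \<in> r \<longrightarrow> q \<in> l b)"
    and "\<And>a q. a \<in> X \<Longrightarrow> PDia q \<in> subfm p \<Longrightarrow> PDia q \<in> l a \<longleftrightarrow> (\<exists>b\<in>X. (a, b) \<in> r \<and> q \<in> l b)"
  shows "q \<in> subfm p \<Longrightarrow> a \<in> X \<Longrightarrow> ksat X r (\<lambda>i. {a. PVar i \<in> l a}) a q \<longleftrightarrow> q \<in> l a"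
proof (induction q arbitrary: a)
  case (PNeg q)
  moreover from PNeg have "q \<in> subfm p" by (auto dest: subfm_closed)
  moreover obtain \<Delta> where "mcs A \<Delta>" "l a = \<Delta> \<inter> subfm p" using assms(1) PNeg by blast
  ultimately show ?case by (simp add: mcs_neg)
next
  case (PAnd q q')
  moreover from PAnd have "q \<in> subfm p" "q' \<in> subfm p" by (auto dest: subfm_closed)
  moreover obtain \<Delta> where "mcs A \<Delta>" "l a = \<Delta> \<inter> subfm p" using assms(1) PAnd by blast
  ultimately show ?case by (simp add: mcs_and)
next
  case (PBox q)
  moreover from PBox have "q \<in> subfm p" by (auto dest: subfm_closed)
  ultimately show ?case using assms(2) by simp
next
  case (PDia q)
  moreover from PDia have "q \<in> subfm p" by (auto dest: subfm_closed)
  ultimately show ?case using assms(3) by simp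
qed simp

subsection \<open>Filtration\<close>

context s4
begin

definition filt_nodes :: "pm set \<Rightarrow> pm \<Rightarrow> pm set set" where
  "filt_nodes \<Gamma> p = {\<Delta> \<inter> subfm p | \<Delta>. mcs A \<Delta> \<and> canonical \<Gamma> \<Delta>}"

definition filt_rel :: "pm set \<Rightarrow> pm \<Rightarrow> pm set rel" where
  "filt_rel \<Gamma> p = {(a, b). a \<in> filt_nodes \<Gamma> p \<and> b \<in> filt_nodes \<Gamma> p \<and>
     (\<forall>q. PBox q \<in> a \<longrightarrow> PBox q \<in> b) \<and> (\<forall>q. PDia q \<in> b \<longrightarrow> PDia q \<in> a)}"

lemma finite_filt_nodes: "finite (filt_nodes \<Gamma> p)"
  by (rule finite_subset[of _ "Pow (subfm p)"]) (auto simp: filt_nodes_def)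

lemma filt_preorder: "preorder_on (filt_nodes \<Gamma> p) (filt_rel \<Gamma> p)"
  by (auto simp: preorder_on_def filt_rel_def refl_on_def trans_def)

lemma dia_mono: "mcs A \<Gamma> \<Longrightarrow> mcs A \<Delta> \<Longrightarrow> canonical \<Gamma> \<Delta> \<Longrightarrow> PDia q \<in> \<Delta> \<Longrightarrow> PDia q \<in> \<Gamma>"
  by (meson mcs_dia_ex canonical_trans)

text \<open>The filtration keeps every instance of canonical accessibility. Hence it inherits directedness
  and symmetry from the cone of the root.\<close>

lemma filt_relI:
  assumes "mcs A \<Gamma>" "mcs A \<Delta>" "mcs A \<Theta>" "canonical \<Gamma> \<Delta>" "canonical \<Delta> \<Theta>"
  shows "(\<Delta> \<inter> subfm p, \<Theta> \<inter> subfm p) \<in> filt_rel \<Gamma> p"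
proof -
  have "canonical \<Gamma> \<Theta>" using assms canonical_trans by blast
  moreover have "PBox q \<in> \<Theta>" if "PBox q \<in> \<Delta>" for q
    using box_4[OF assms(2) that] assms(5) by (auto simp: canonical_def)
  moreover have "PDia q \<in> \<Delta>" if "PDia q \<in> \<Theta>" for q
    using dia_mono[OF assms(2,3,5) that] .
  ultimately show ?thesis
    using assms by (auto simp: filt_rel_def filt_nodes_def)
qed

lemma filt_truth:
  assumes G: "mcs A \<Gamma>" and q: "q \<in> subfm p" and a: "a \<in> filt_nodes \<Gamma> p"
  shows "ksat (filt_nodes \<Gamma> p) (filt_rel \<Gamma> p) (\<lambda>i. {a. PVar i \<in> a}) a q \<longleftrightarrow> q \<in> a"
  using q a
proof (rule ksat_labels[where l = "\<lambda>a. a", rotated 3])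
  fix a assume "a \<in> filt_nodes \<Gamma> p"
  then obtain \<Delta> where D: "mcs A \<Delta>" "canonical \<Gamma> \<Delta>" "a = \<Delta> \<inter> subfm p"
    by (auto simp: filt_nodes_def)
  then show "\<exists>\<Delta>. mcs A \<Delta> \<and> a = \<Delta> \<inter> subfm p" by blast
  have up: "\<Theta> \<inter> subfm p \<in> filt_nodes \<Gamma> p \<and> (a, \<Theta> \<inter> subfm p) \<in> filt_rel \<Gamma> p"
    if "mcs A \<Theta>" "canonical \<Delta> \<Theta>" for \<Theta>
    using filt_relI[OF G D(1) that(1) D(2) that(2)] D(3) by (auto simp: filt_rel_def)
  show "PBox q \<in> a \<longleftrightarrow> (\<forall>b\<in>filt_nodes \<Gamma> p. (a, b) \<in> filt_rel \<Gamma> p \<longrightarrow> q \<in> b)"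
    if mem: "PBox q \<in> subfm p" for q
  proof
    assume "PBox q \<in> a"
    moreover have "q \<in> b" if "PBox q \<in> b" "b \<in> filt_nodes \<Gamma> p" for b
      using that box_T mem subfm_closed(3) by (auto simp: filt_nodes_def)
    ultimately show "\<forall>b\<in>filt_nodes \<Gamma> p. (a, b) \<in> filt_rel \<Gamma> p \<longrightarrow> q \<in> b"
      by (auto simp: filt_rel_def)
  next
    assume R: "\<forall>b\<in>filt_nodes \<Gamma> p. (a, b) \<in> filt_rel \<Gamma> p \<longrightarrow> q \<in> b"
    then have "PBox q \<in> \<Delta>" unfolding mcs_box[OF D(1)] using up by blast
    then show "PBox q \<in> a" using D(3) mem by simp
  qed
  show "PDia q \<in> a \<longleftrightarrow> (\<exists>b\<in>filt_nodes \<Gamma> p. (a, b) \<in> filt_rel \<Gamma> p \<and> q \<in> b)"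
    if mem: "PDia q \<in> subfm p" for q
  proof
    assume "PDia q \<in> a"
    then have "PDia q \<in> \<Delta>" using D(3) by simp
    then obtain \<Theta> where "mcs A \<Theta>" "canonical \<Delta> \<Theta>" "q \<in> \<Theta>" unfolding mcs_dia_ex[OF D(1)] by blast
    then show "\<exists>b\<in>filt_nodes \<Gamma> p. (a, b) \<in> filt_rel \<Gamma> p \<and> q \<in> b"
      using up mem subfm_closed(4) by blast
  next
    assume "\<exists>b\<in>filt_nodes \<Gamma> p. (a, b) \<in> filt_rel \<Gamma> p \<and> q \<in> b"
    then obtain \<Theta> where T: "mcs A \<Theta>" "(a, \<Theta> \<inter> subfm p) \<in> filt_rel \<Gamma> p" "q \<in> \<Theta>"
      by (auto simp: filt_nodes_def)
    then have "PDia q \<in> \<Theta>" unfolding mcs_dia_ex[OF T(1)] using canonical_refl by blast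
    then show "PDia q \<in> a" using T mem by (auto simp: filt_rel_def)
  qed
qed

end

lemma finite_directed_top:
  assumes "finite F" "F \<subseteq> X" "X \<noteq> {}" "trans r" "refl_on X r"
    and dir: "\<And>x y. x \<in> X \<Longrightarrow> y \<in> X \<Longrightarrow> \<exists>z\<in>X. (x, z) \<in> r \<and> (y, z) \<in> r"
  shows "\<exists>t\<in>X. \<forall>x\<in>F. (x, t) \<in> r"
  using assms(1,2)
proof (induction F)
  case empty
  then show ?case using assms(3) by auto
next
  case (insert x F)
  then obtain t where "t \<in> X" "\<forall>x\<in>F. (x, t) \<in> r" by auto
  moreover obtain z where "z \<in> X" "(x, z) \<in> r" "(t, z) \<in> r"
    using dir[of x t] insert \<open>t \<in> X\<close> by blast
  ultimately show ?case
    using \<open>trans r\<close> by (intro bexI[of _ z]) (auto intro: transD)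
qed

lemma complete_S4_2:
  assumes "p \<notin> S4_2"
  shows "\<exists>(X :: pm set set) r V w t. finite X \<and> preorder_on X r \<and> w \<in> X \<and> t \<in> X \<and>
    (\<forall>x\<in>X. (w, x) \<in> r \<and> (x, t) \<in> r) \<and> \<not> ksat X r V w p"
proof -
  interpret s4 "{ax_T, ax_4, ax_dot2}" by standard (auto intro: normal_theory.axiom)
  let ?A = "{ax_T, ax_4, ax_dot2}"
  obtain \<Gamma> where G: "mcs ?A \<Gamma>" "p \<notin> \<Gamma>"
    using assms mcs_refute unfolding S4_2_def by blast
  let ?X = "filt_nodes \<Gamma> p" and ?r = "filt_rel \<Gamma> p"
  have pre: "preorder_on ?X ?r" by (rule filt_preorder)
  have w: "\<Gamma> \<inter> subfm p \<in> ?X" using G canonical_refl by (auto simp: filt_nodes_def)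
  have dir: "\<exists>z\<in>?X. (x, z) \<in> ?r \<and> (y, z) \<in> ?r" if xy: "x \<in> ?X" "y \<in> ?X" for x y
  proof -
    obtain \<Delta> \<Theta> where D: "mcs ?A \<Delta>" "canonical \<Gamma> \<Delta>" "x = \<Delta> \<inter> subfm p"
      "mcs ?A \<Theta>" "canonical \<Gamma> \<Theta>" "y = \<Theta> \<inter> subfm p"
      using xy unfolding filt_nodes_def by blast
    have "ax_dot2 \<in> normal_theory ?A" by (rule normal_theory.axiom) simp
    from canonical_directed[OF this G(1) D(1,4,2,5)] obtain \<Xi>
      where Xi: "mcs ?A \<Xi>" "canonical \<Delta> \<Xi>" "canonical \<Theta> \<Xi>" by blast
    have "(x, \<Xi> \<inter> subfm p) \<in> ?r"
      unfolding D(3) by (rule filt_relI[OF G(1) D(1) Xi(1) D(2) Xi(2)])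
    moreover have "(y, \<Xi> \<inter> subfm p) \<in> ?r"
      unfolding D(6) by (rule filt_relI[OF G(1) D(4) Xi(1) D(5) Xi(3)])
    ultimately show ?thesis unfolding filt_rel_def by blast
  qed
  obtain t where t: "t \<in> ?X" "\<forall>x\<in>?X. (x, t) \<in> ?r"
    using finite_directed_top[OF finite_filt_nodes subset_refl _ _ _ dir] w pre
    by (auto simp: preorder_on_def)
  have "\<forall>x\<in>?X. (\<Gamma> \<inter> subfm p, x) \<in> ?r"
    using filt_relI[OF G(1) G(1) _ canonical_refl[OF G(1)]] by (auto simp: filt_nodes_def)
  moreover have "\<not> ksat ?X ?r (\<lambda>i. {a. PVar i \<in> a}) (\<Gamma> \<inter> subfm p) p"
    using filt_truth[OF G(1) subfm_self w] G(2) by blast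
  ultimately show ?thesis
    using t w pre finite_filt_nodes by blast
qed

lemma complete_S5:
  assumes "p \<notin> S5"
  shows "\<exists>(X :: pm set set) V w. finite X \<and> w \<in> X \<and> \<not> ksat X (X \<times> X) V w p"
proof -
  interpret s4 "{ax_T, ax_4, ax_5}" by standard (auto intro: normal_theory.axiom)
  let ?A = "{ax_T, ax_4, ax_5}"
  obtain \<Gamma> where G: "mcs ?A \<Gamma>" "p \<notin> \<Gamma>"
    using assms mcs_refute unfolding S5_def by blast
  let ?X = "filt_nodes \<Gamma> p" and ?r = "filt_rel \<Gamma> p"
  have w: "\<Gamma> \<inter> subfm p \<in> ?X" using G canonical_refl by (auto simp: filt_nodes_def)
  have "?r = ?X \<times> ?X"
  proof -
    have "(\<Delta> \<inter> subfm p, \<Theta> \<inter> subfm p) \<in> ?r"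
      if "mcs ?A \<Delta>" "canonical \<Gamma> \<Delta>" "mcs ?A \<Theta>" "canonical \<Gamma> \<Theta>" for \<Delta> \<Theta>
    proof -
      have "canonical \<Delta> \<Gamma>" using canonical_sym G that by (blast intro: normal_theory.axiom)
      then have "canonical \<Delta> \<Theta>" using canonical_trans that by blast
      then show ?thesis using filt_relI G that by blast
    qed
    then show ?thesis by (auto simp: filt_nodes_def filt_rel_def)
  qed
  moreover have "\<not> ksat ?X ?r (\<lambda>i. {a. PVar i \<in> a}) (\<Gamma> \<inter> subfm p) p"
    using filt_truth[OF G(1) subfm_self w] G(2) by blast
  ultimately show ?thesis using w finite_filt_nodes by metis
qed

section \<open>The finite models of extensions of Grz\<close>

text \<open>The type of a point is its trace on the subformulas of \<open>p\<close>. A filtration by types may put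
  different types into one cluster; Grz provides enough points for which this does not happen.\<close>

locale grz = s4 +
  assumes ax_Grz: "ax_Grz \<in> normal_theory A"
begin

definition chi :: "pm \<Rightarrow> pm set \<Rightarrow> pm" where
  "chi p t = PConj (map (\<lambda>q. if q \<in> t then q else PNeg q) (SOME qs. set qs = subfm p))"

lemma mcs_chi:
  assumes "mcs A \<Gamma>" shows "chi p t \<in> \<Gamma> \<longleftrightarrow> \<Gamma> \<inter> subfm p = t \<inter> subfm p"
proof -
  have "set (SOME qs. set qs = subfm p) = subfm p"
    by (rule someI_ex) (simp add: finite_list)
  then have "chi p t \<in> \<Gamma> \<longleftrightarrow> (\<forall>q\<in>subfm p. (if q \<in> t then q else PNeg q) \<in> \<Gamma>)"
    using assms by (auto simp: chi_def mcs_conj)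
  also have "\<dots> \<longleftrightarrow> (\<forall>q\<in>subfm p. q \<in> t \<longleftrightarrow> q \<in> \<Gamma>)"
    using assms by (auto simp: mcs_neg split: if_splits)
  finally show ?thesis by blast
qed

definition settled :: "pm \<Rightarrow> pm set \<Rightarrow> bool" where
  "settled p \<Delta> \<longleftrightarrow> (\<forall>\<Theta> \<Xi>. mcs A \<Theta> \<longrightarrow> mcs A \<Xi> \<longrightarrow> canonical \<Delta> \<Theta> \<longrightarrow> canonical \<Theta> \<Xi> \<longrightarrow>
     \<Xi> \<inter> subfm p = \<Delta> \<inter> subfm p \<longrightarrow> \<Theta> \<inter> subfm p = \<Delta> \<inter> subfm p)"

text \<open>This is the instance of Grz for the formula \<open>chi p \<Gamma>\<close> that expresses the type, read
  contrapositively: a point of this type sees one of this type from which the type, once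
  left, does not come back.\<close>

lemma settled_ex:
  assumes "mcs A \<Gamma>"
  shows "\<exists>\<Delta>. mcs A \<Delta> \<and> canonical \<Gamma> \<Delta> \<and> \<Delta> \<inter> subfm p = \<Gamma> \<inter> subfm p \<and> settled p \<Delta>"
proof -
  define q where "q = chi p \<Gamma>"
  have q: "q \<in> \<Delta> \<longleftrightarrow> \<Delta> \<inter> subfm p = \<Gamma> \<inter> subfm p" if "mcs A \<Delta>" for \<Delta>
    unfolding q_def using mcs_chi[OF that] .
  let ?b = "PBox (PImp (PNeg q) (PBox (PNeg q)))"
  have "PNeg q \<notin> \<Gamma>" using q[OF assms] mcs_neg[OF assms] by simp
  then have "PBox (PImp ?b (PNeg q)) \<notin> \<Gamma>"
    using mcs_subst[OF assms ax_Grz, of "\<lambda>_. PNeg q"] mcs_mp[OF assms]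
    by (auto simp: ax_Grz_def)
  then obtain \<Delta> where D: "mcs A \<Delta>" "canonical \<Gamma> \<Delta>" "PImp ?b (PNeg q) \<notin> \<Delta>"
    unfolding mcs_box[OF assms] by blast
  then have b: "?b \<in> \<Delta>" and qD: "q \<in> \<Delta>"
    by (auto simp only: mcs_neg mcs_and)
  have "settled p \<Delta>"
    unfolding settled_def
  proof (intro allI impI)
    fix \<Theta> \<Xi> assume T: "mcs A \<Theta>" "mcs A \<Xi>" "canonical \<Delta> \<Theta>" "canonical \<Theta> \<Xi>" "\<Xi> \<inter> subfm p = \<Delta> \<inter> subfm p"
    have "q \<in> \<Xi>" using T q D qD by auto
    moreover have "PImp (PNeg q) (PBox (PNeg q)) \<in> \<Theta>" using b T by (auto simp: canonical_def)
    ultimately have "q \<in> \<Theta>"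
      using T mcs_mp[OF T(1)] mcs_neg[OF T(1)] mcs_neg[OF T(2)] unfolding canonical_def by blast
    then show "\<Theta> \<inter> subfm p = \<Delta> \<inter> subfm p" using q T D qD by auto
  qed
  then show ?thesis using D q qD by blast
qed

definition seen :: "pm \<Rightarrow> pm set \<Rightarrow> pm set set" where
  "seen p \<Delta> = {\<Theta> \<inter> subfm p | \<Theta>. mcs A \<Theta> \<and> canonical \<Delta> \<Theta>}"

text \<open>There are only finitely many pairs of a type and a set of types seen. A settled point that
  leaves its type sees strictly fewer types afterwards, which makes the order antisymmetric.\<close>

definition grz_nodes :: "pm \<Rightarrow> pm set \<Rightarrow> (pm set \<times> pm set set) set" where
  "grz_nodes p \<Gamma> = {(\<Delta> \<inter> subfm p, seen p \<Delta>) | \<Delta>. mcs A \<Delta> \<and> canonical \<Gamma> \<Delta> \<and> settled p \<Delta>}"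

definition grz_rel :: "pm \<Rightarrow> pm set \<Rightarrow> (pm set \<times> pm set set) rel" where
  "grz_rel p \<Gamma> = {(a, b). a \<in> grz_nodes p \<Gamma> \<and> b \<in> grz_nodes p \<Gamma> \<and>
     (a = b \<or> snd b \<subseteq> snd a \<and> fst a \<notin> snd b)}"

lemma finite_seen: "finite (seen p \<Delta>)"
  by (rule finite_subset[of _ "Pow (subfm p)"]) (auto simp: seen_def)

lemma finite_grz_nodes: "finite (grz_nodes p \<Gamma>)"
  by (rule finite_subset[of _ "Pow (subfm p) \<times> Pow (Pow (subfm p))"])
    (auto simp: grz_nodes_def seen_def)

lemma seen_self: "mcs A \<Delta> \<Longrightarrow> \<Delta> \<inter> subfm p \<in> seen p \<Delta>"
  using canonical_refl by (auto simp: seen_def)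

lemma seen_mono: "mcs A \<Gamma> \<Longrightarrow> canonical \<Gamma> \<Delta> \<Longrightarrow> seen p \<Delta> \<subseteq> seen p \<Gamma>"
  using canonical_trans by (fastforce simp: seen_def)

lemma grz_partial_order: "partial_order_on (grz_nodes p \<Gamma>) (grz_rel p \<Gamma>)"
proof -
  have "fst a \<in> snd a" if "a \<in> grz_nodes p \<Gamma>" for a
    using that seen_self by (auto simp: grz_nodes_def)
  then have "antisym (grz_rel p \<Gamma>)"
    by (intro antisymI) (auto simp: grz_rel_def)
  moreover have "trans (grz_rel p \<Gamma>)"
    by (intro transI) (auto simp: grz_rel_def)
  ultimately show ?thesis
    by (auto simp: partial_order_on_def preorder_on_def refl_on_def grz_rel_def)
qed

lemma settled_leave:
  assumes "settled p \<Delta>" "mcs A \<Delta>" "mcs A \<Theta>" "canonical \<Delta> \<Theta>" "\<Theta> \<inter> subfm p \<noteq> \<Delta> \<inter> subfm p"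
  shows "\<Delta> \<inter> subfm p \<notin> seen p \<Theta>"
  using assms unfolding settled_def seen_def by blast

text \<open>A type seen from \<open>\<Delta>\<close> and different from its own is the type of some settled point above,
  and that point does not see the type of \<open>\<Delta>\<close> any more.\<close>

lemma grz_successors:
  assumes "mcs A \<Gamma>" "mcs A \<Delta>" "canonical \<Gamma> \<Delta>" "settled p \<Delta>"
  shows "fst ` {b \<in> grz_nodes p \<Gamma>. ((\<Delta> \<inter> subfm p, seen p \<Delta>), b) \<in> grz_rel p \<Gamma>} = seen p \<Delta>"
proof (intro equalityI subsetI)
  fix t assume "t \<in> fst ` {b \<in> grz_nodes p \<Gamma>. ((\<Delta> \<inter> subfm p, seen p \<Delta>), b) \<in> grz_rel p \<Gamma>}"
  then obtain \<Theta> where T: "mcs A \<Theta>" "t = \<Theta> \<inter> subfm p"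
    "((\<Delta> \<inter> subfm p, seen p \<Delta>), (\<Theta> \<inter> subfm p, seen p \<Theta>)) \<in> grz_rel p \<Gamma>"
    by (auto simp: grz_nodes_def)
  then have "seen p \<Theta> \<subseteq> seen p \<Delta>" by (auto simp: grz_rel_def)
  then show "t \<in> seen p \<Delta>" using T seen_self by auto
next
  fix t assume "t \<in> seen p \<Delta>"
  then obtain \<Theta> where T: "mcs A \<Theta>" "canonical \<Delta> \<Theta>" "t = \<Theta> \<inter> subfm p" by (auto simp: seen_def)
  have node: "(\<Delta> \<inter> subfm p, seen p \<Delta>) \<in> grz_nodes p \<Gamma>" using assms by (auto simp: grz_nodes_def)
  show "t \<in> fst ` {b \<in> grz_nodes p \<Gamma>. ((\<Delta> \<inter> subfm p, seen p \<Delta>), b) \<in> grz_rel p \<Gamma>}"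
  proof (cases "t = \<Delta> \<inter> subfm p")
    case True
    then show ?thesis
      using node by (intro image_eqI[of _ _ "(\<Delta> \<inter> subfm p, seen p \<Delta>)"]) (auto simp: grz_rel_def)
  next
    case False
    obtain \<Xi> where X: "mcs A \<Xi>" "canonical \<Theta> \<Xi>" "\<Xi> \<inter> subfm p = \<Theta> \<inter> subfm p" "settled p \<Xi>"
      using settled_ex[OF T(1)] by blast
    have DX: "canonical \<Delta> \<Xi>" using canonical_trans assms T X by blast
    have GX: "canonical \<Gamma> \<Xi>" using canonical_trans assms DX by blast
    have "\<Delta> \<inter> subfm p \<notin> seen p \<Xi>"
      using settled_leave[OF assms(4,2) X(1) DX] X T False by auto
    moreover have "seen p \<Xi> \<subseteq> seen p \<Delta>" using seen_mono assms DX by blast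
    moreover have "(\<Xi> \<inter> subfm p, seen p \<Xi>) \<in> grz_nodes p \<Gamma>"
      using X GX by (auto simp: grz_nodes_def)
    ultimately show ?thesis
      using node X T by (intro image_eqI[of _ _ "(\<Xi> \<inter> subfm p, seen p \<Xi>)"]) (auto simp: grz_rel_def)
  qed
qed

lemma box_seen:
  assumes "mcs A \<Delta>" "q \<in> subfm p"
  shows "PBox q \<in> \<Delta> \<longleftrightarrow> (\<forall>t\<in>seen p \<Delta>. q \<in> t)" "PDia q \<in> \<Delta> \<longleftrightarrow> (\<exists>t\<in>seen p \<Delta>. q \<in> t)"
  unfolding mcs_box[OF assms(1)] mcs_dia_ex[OF assms(1)] using assms(2) by (auto simp: seen_def)

lemma grz_truth:
  assumes G: "mcs A \<Gamma>" and a: "a \<in> grz_nodes p \<Gamma>" and q: "q \<in> subfm p"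
  shows "ksat (grz_nodes p \<Gamma>) (grz_rel p \<Gamma>) (\<lambda>i. {a. PVar i \<in> fst a}) a q \<longleftrightarrow> q \<in> fst a"
  using q a
proof (rule ksat_labels[where l = fst, rotated 3])
  fix a assume "a \<in> grz_nodes p \<Gamma>"
  then obtain \<Delta> where D: "mcs A \<Delta>" "canonical \<Gamma> \<Delta>" "settled p \<Delta>" "a = (\<Delta> \<inter> subfm p, seen p \<Delta>)"
    by (auto simp: grz_nodes_def)
  then show "\<exists>\<Delta>. mcs A \<Delta> \<and> fst a = \<Delta> \<inter> subfm p" by auto
  have succ: "seen p \<Delta> = fst ` {b \<in> grz_nodes p \<Gamma>. (a, b) \<in> grz_rel p \<Gamma>}"
    using grz_successors[OF G D(1-3)] D(4) by simp
  have a: "q \<in> fst a \<longleftrightarrow> q \<in> \<Delta>" if "q \<in> subfm p" for q using D(4) that by simp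
  show "PBox q \<in> fst a \<longleftrightarrow> (\<forall>b\<in>grz_nodes p \<Gamma>. (a, b) \<in> grz_rel p \<Gamma> \<longrightarrow> q \<in> fst b)"
    if "PBox q \<in> subfm p" for q
    unfolding a[OF that] box_seen(1)[OF D(1) subfm_closed(3)[OF that]] succ by blast
  show "PDia q \<in> fst a \<longleftrightarrow> (\<exists>b\<in>grz_nodes p \<Gamma>. (a, b) \<in> grz_rel p \<Gamma> \<and> q \<in> fst b)"
    if "PDia q \<in> subfm p" for q
    unfolding a[OF that] box_seen(2)[OF D(1) subfm_closed(4)[OF that]] succ by blast
qed

end

lemma ksat_generated:
  assumes "trans r" "w \<in> X" "x \<in> {x \<in> X. (w, x) \<in> r}"
  shows "ksat {x \<in> X. (w, x) \<in> r} r V x p \<longleftrightarrow> ksat X r V x p"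
  using assms(3)
proof (induction p arbitrary: x)
  case (PBox p)
  then show ?case using assms(1) by (auto dest: transD)
next
  case (PDia p)
  then show ?case using assms(1) by (auto 4 3 dest: transD)
qed auto

context grz
begin

lemma grz_model:
  assumes "mcs A \<Gamma>" "p \<notin> \<Gamma>"
  obtains \<Delta> w Y where "mcs A \<Delta>" "settled p \<Delta>" "w = (\<Delta> \<inter> subfm p, seen p \<Delta>)"
    "Y = {x \<in> grz_nodes p \<Delta>. (w, x) \<in> grz_rel p \<Delta>}" "w \<in> Y"
    "\<not> ksat Y (grz_rel p \<Delta>) (\<lambda>i. {a. PVar i \<in> fst a}) w p"
proof -
  obtain \<Delta> where D: "mcs A \<Delta>" "canonical \<Gamma> \<Delta>" "\<Delta> \<inter> subfm p = \<Gamma> \<inter> subfm p" "settled p \<Delta>"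
    using settled_ex[OF assms(1)] by blast
  let ?w = "(\<Delta> \<inter> subfm p, seen p \<Delta>)"
  have w: "?w \<in> grz_nodes p \<Delta>"
    using D(1,4) canonical_refl[OF D(1)] unfolding grz_nodes_def by blast
  have po: "trans (grz_rel p \<Delta>)" "(?w, ?w) \<in> grz_rel p \<Delta>"
    using grz_partial_order[of p \<Delta>] w by (auto simp: partial_order_on_def preorder_on_def refl_on_def)
  have "p \<notin> \<Delta> \<inter> subfm p" using D(3) assms(2) subfm_self[of p] by blast
  then have "\<not> ksat (grz_nodes p \<Delta>) (grz_rel p \<Delta>) (\<lambda>i. {a. PVar i \<in> fst a}) ?w p"
    using grz_truth[OF D(1) w subfm_self] by simp
  then show ?thesis
    using that[OF D(1,4) refl refl] ksat_generated[OF po(1) w] w po by simp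
qed

text \<open>A settled point that sees as few types as possible sees only its own type: it cannot leave a
  type that every later point still sees. By directedness, every other point sees that type.\<close>

lemma grz_top:
  assumes "ax_dot2 \<in> normal_theory A" "mcs A \<Gamma>"
  shows "\<exists>t\<in>grz_nodes p \<Gamma>. \<forall>x\<in>grz_nodes p \<Gamma>. (x, t) \<in> grz_rel p \<Gamma>"
proof -
  let ?P = "\<lambda>\<Delta>. mcs A \<Delta> \<and> canonical \<Gamma> \<Delta>"
  obtain \<Delta>0 where D0: "?P \<Delta>0" "\<And>\<Theta>. ?P \<Theta> \<Longrightarrow> card (seen p \<Delta>0) \<le> card (seen p \<Theta>)"
    using assms(2) canonical_refl ex_has_least_nat[of ?P \<Gamma> "\<lambda>\<Delta>. card (seen p \<Delta>)"] by blast
  obtain \<Delta> where D: "mcs A \<Delta>" "canonical \<Delta>0 \<Delta>" "settled p \<Delta>"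
    using settled_ex D0 by blast
  have PD: "?P \<Delta>" using canonical_trans D D0 assms(2) by blast
  have const: "seen p \<Theta> = seen p \<Delta>" if T: "mcs A \<Theta>" "canonical \<Delta> \<Theta>" for \<Theta>
  proof (rule card_subset_eq[OF finite_seen seen_mono[OF D(1) T(2)]])
    have "?P \<Theta>" using canonical_trans T PD assms(2) by blast
    then have "card (seen p \<Delta>0) \<le> card (seen p \<Theta>)" using D0 by blast
    moreover have "card (seen p \<Theta>) \<le> card (seen p \<Delta>)"
      by (rule card_mono[OF finite_seen seen_mono[OF D(1) T(2)]])
    moreover have "card (seen p \<Delta>) \<le> card (seen p \<Delta>0)"
      using D0(1) D by (intro card_mono[OF finite_seen seen_mono]) auto
    ultimately show "card (seen p \<Theta>) = card (seen p \<Delta>)" by simp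
  qed
  have tp: "\<Theta> \<inter> subfm p = \<Delta> \<inter> subfm p" if T: "mcs A \<Theta>" "canonical \<Delta> \<Theta>" for \<Theta>
  proof (rule ccontr)
    assume "\<Theta> \<inter> subfm p \<noteq> \<Delta> \<inter> subfm p"
    from settled_leave[OF D(3,1) T this] show False
      using const[OF T] seen_self[OF D(1)] by blast
  qed
  then have seenD: "seen p \<Delta> = {\<Delta> \<inter> subfm p}"
    using seen_self[OF D(1)] by (auto simp: seen_def)
  have node: "(\<Delta> \<inter> subfm p, seen p \<Delta>) \<in> grz_nodes p \<Gamma>" using D PD by (auto simp: grz_nodes_def)
  have "(x, (\<Delta> \<inter> subfm p, seen p \<Delta>)) \<in> grz_rel p \<Gamma>" if x: "x \<in> grz_nodes p \<Gamma>" for x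
  proof -
    obtain \<Lambda> where L: "mcs A \<Lambda>" "canonical \<Gamma> \<Lambda>" "settled p \<Lambda>" "x = (\<Lambda> \<inter> subfm p, seen p \<Lambda>)"
      using x by (auto simp: grz_nodes_def)
    have com: "\<exists>\<Xi>. mcs A \<Xi> \<and> canonical \<Theta> \<Xi> \<and> \<Xi> \<inter> subfm p = \<Delta> \<inter> subfm p"
      if T: "mcs A \<Theta>" "canonical \<Gamma> \<Theta>" for \<Theta>
      using canonical_directed[OF assms(1,2) T(1) D(1) T(2)] PD tp by blast
    have "seen p \<Delta> \<subseteq> seen p \<Lambda>"
      using com[OF L(1,2)] unfolding seenD by (auto simp: seen_def)
    moreover have "seen p \<Lambda> = seen p \<Delta>" if eq: "\<Lambda> \<inter> subfm p = \<Delta> \<inter> subfm p"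
    proof -
      have "\<Theta> \<inter> subfm p = \<Lambda> \<inter> subfm p" if T: "mcs A \<Theta>" "canonical \<Lambda> \<Theta>" for \<Theta>
      proof -
        have "canonical \<Gamma> \<Theta>" using canonical_trans assms(2) L T by blast
        then obtain \<Xi> where "mcs A \<Xi>" "canonical \<Theta> \<Xi>" "\<Xi> \<inter> subfm p = \<Delta> \<inter> subfm p"
          using com T by blast
        then show ?thesis using L(3) T eq unfolding settled_def by blast
      qed
      then show ?thesis
        unfolding seenD using eq seen_self[OF L(1), of p] by (auto simp: seen_def)
    qed
    ultimately show ?thesis
      using L x node unfolding grz_rel_def seenD by auto
  qed
  then show ?thesis using node by blast
qed

text \<open>If two comparable settled points have the same type, then they see the same types: a third point
  above the lower one is either above the upper one as well, or between the two, where the type cannot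
  have changed.\<close>

lemma grz_linear:
  assumes "ax_dot3 \<in> normal_theory A" "mcs A \<Gamma>" "x \<in> grz_nodes p \<Gamma>" "y \<in> grz_nodes p \<Gamma>"
  shows "(x, y) \<in> grz_rel p \<Gamma> \<or> (y, x) \<in> grz_rel p \<Gamma>"
proof -
  have *: "((\<Delta> \<inter> subfm p, seen p \<Delta>), (\<Theta> \<inter> subfm p, seen p \<Theta>)) \<in> grz_rel p \<Gamma>"
    if D: "mcs A \<Delta>" "canonical \<Gamma> \<Delta>" "settled p \<Delta>" and T: "mcs A \<Theta>" "canonical \<Gamma> \<Theta>" "settled p \<Theta>"
      and DT: "canonical \<Delta> \<Theta>" for \<Delta> \<Theta>
  proof -
    have sub: "seen p \<Theta> \<subseteq> seen p \<Delta>" using seen_mono D DT by blast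
    have "\<Delta> \<inter> subfm p \<notin> seen p \<Theta> \<or> (\<Delta> \<inter> subfm p = \<Theta> \<inter> subfm p \<and> seen p \<Delta> = seen p \<Theta>)"
    proof (rule disjCI)
      assume "\<not> (\<Delta> \<inter> subfm p = \<Theta> \<inter> subfm p \<and> seen p \<Delta> = seen p \<Theta>)"
      moreover have "seen p \<Delta> \<subseteq> seen p \<Theta>" if eq: "\<Delta> \<inter> subfm p = \<Theta> \<inter> subfm p"
      proof
        fix t assume "t \<in> seen p \<Delta>"
        then obtain \<Xi> where X: "mcs A \<Xi>" "canonical \<Delta> \<Xi>" "t = \<Xi> \<inter> subfm p" by (auto simp: seen_def)
        have "canonical \<Theta> \<Xi> \<or> canonical \<Xi> \<Theta>"
          by (rule canonical_linear[OF assms(1) D(1) T(1) X(1) DT X(2)])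
        then show "t \<in> seen p \<Theta>"
        proof
          assume "canonical \<Theta> \<Xi>" then show ?thesis using X by (auto simp: seen_def)
        next
          assume "canonical \<Xi> \<Theta>"
          then have "\<Xi> \<inter> subfm p = \<Delta> \<inter> subfm p"
            using D(3) X T(1) eq unfolding settled_def by blast
          then show ?thesis using X eq seen_self[OF T(1)] by auto
        qed
      qed
      ultimately have "\<Theta> \<inter> subfm p \<noteq> \<Delta> \<inter> subfm p" using sub by auto
      then show "\<Delta> \<inter> subfm p \<notin> seen p \<Theta>" using settled_leave D T DT by blast
    qed
    then show ?thesis using D T sub by (auto simp: grz_rel_def grz_nodes_def)
  qed
  obtain \<Delta> \<Theta> where "mcs A \<Delta>" "canonical \<Gamma> \<Delta>" "settled p \<Delta>" "x = (\<Delta> \<inter> subfm p, seen p \<Delta>)"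
    "mcs A \<Theta>" "canonical \<Gamma> \<Theta>" "settled p \<Theta>" "y = (\<Theta> \<inter> subfm p, seen p \<Theta>)"
    using assms(3,4) unfolding grz_nodes_def by blast
  then show ?thesis
    using * canonical_linear[OF assms(1,2)] by metis
qed

lemma grz_strict:
  assumes "ax_dot3 \<in> normal_theory A" "mcs A \<Gamma>" "mcs A \<Delta>" "mcs A \<Theta>" "canonical \<Gamma> \<Delta>" "canonical \<Gamma> \<Theta>"
    and lt: "((\<Delta> \<inter> subfm p, seen p \<Delta>), (\<Theta> \<inter> subfm p, seen p \<Theta>)) \<in> grz_rel p \<Gamma>"
      "(\<Delta> \<inter> subfm p, seen p \<Delta>) \<noteq> (\<Theta> \<inter> subfm p, seen p \<Theta>)"
  shows "canonical \<Delta> \<Theta>" "PBox (PNeg (chi p \<Delta>)) \<in> \<Theta>"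
proof -
  have notin: "\<Delta> \<inter> subfm p \<notin> seen p \<Theta>" using lt by (auto simp: grz_rel_def)
  then show "canonical \<Delta> \<Theta>"
    using canonical_linear[OF assms(1-6)] assms(3) by (auto simp: seen_def)
  show "PBox (PNeg (chi p \<Delta>)) \<in> \<Theta>"
    unfolding mcs_box[OF assms(4)] using notin by (auto simp: mcs_neg mcs_chi seen_def)
qed

end

lemma ax_J_Suc: "n > 0 \<Longrightarrow>
  ax_J (Suc n) = PImp (PDia (PAnd (PBox (PVar (Suc n))) (PNeg (ax_J n)))) (PVar (Suc n))"
  by (cases n) auto

text \<open>The variables of \<open>J n\<close> are instantiated from the end of the chain: the \<open>j\<close>-th one expresses that
  the marker of the point \<open>D (n - j)\<close> is absent. Then \<open>J j\<close> fails at \<open>D (n - j)\<close>.\<close>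

lemma (in s4) J_chain:
  assumes "n > 0" and D: "\<And>i. i \<le> n \<Longrightarrow> mcs A (D i)" "\<And>i. i < n \<Longrightarrow> canonical (D i) (D (Suc i))"
    and c: "\<And>i. i < n \<Longrightarrow> c i \<in> D i" "\<And>i. i < n \<Longrightarrow> PBox (PNeg (c i)) \<in> D (Suc i)"
  shows "ax_J n \<notin> normal_theory A"
proof
  assume J: "ax_J n \<in> normal_theory A"
  let ?s = "\<lambda>k. PNeg (c (n - k))"
  have "psubst ?s (ax_J (Suc j)) \<notin> D (n - Suc j)" if "Suc j \<le> n" for j
    using that
  proof (induction j)
    case 0
    have "Suc (n - 1) = n" using assms(1) by simp
    then have "PDia (PBox (PNeg (c (n - 1)))) \<in> D (n - 1)"
      using D(1)[of n] D(2)[of "n - 1"] c(2)[of "n - 1"] assms(1) mcs_dia_ex[OF D(1)[of "n - 1"]] by auto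
    moreover have "c (n - 1) \<in> D (n - 1)" using c assms(1) by simp
    ultimately show ?case
      using D(1)[of "n - 1"] mcs_mp[OF D(1)[of "n - 1"]] by (auto simp: mcs_neg mcs_and)
  next
    case (Suc j)
    let ?k = "n - Suc (Suc j)"
    have k: "Suc ?k = n - Suc j" "?k < n" using Suc.prems by auto
    have D': "mcs A (D ?k)" "mcs A (D (n - Suc j))" "canonical (D ?k) (D (n - Suc j))"
      using D(1)[of ?k] D(1)[of "n - Suc j"] D(2)[of ?k] k by auto
    have "PBox (PNeg (c ?k)) \<in> D (n - Suc j)" using c(2)[of ?k] k by auto
    then have "PAnd (PBox (PNeg (c ?k))) (PNeg (psubst ?s (ax_J (Suc j)))) \<in> D (n - Suc j)"
      using Suc D'(2) by (auto simp: mcs_and mcs_neg)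
    then have "PDia (PAnd (PBox (PNeg (c ?k))) (PNeg (psubst ?s (ax_J (Suc j))))) \<in> D ?k"
      unfolding mcs_dia_ex[OF D'(1)] using D' by blast
    moreover have "c ?k \<in> D ?k" using c k by simp
    ultimately show ?case
      using D'(1) by (auto simp: ax_J_Suc mcs_and mcs_neg)
  qed
  from this[of "n - 1"] have "psubst ?s (ax_J n) \<notin> D 0" using assms(1) by simp
  then show False using mcs_subst[OF D(1) J] by blast
qed

lemma ksat_iso:
  assumes f: "bij_betw f X Y" "\<And>x y. x \<in> X \<Longrightarrow> y \<in> X \<Longrightarrow> (x, y) \<in> r \<longleftrightarrow> (f x, f y) \<in> s"
    and "x \<in> X"
  shows "ksat Y s (\<lambda>i. f ` (V i \<inter> X)) (f x) p \<longleftrightarrow> ksat X r V x p"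
  using assms(3)
proof (induction p arbitrary: x)
  case (PVar i)
  then show ?case using f(1) by (auto simp: bij_betw_def inj_on_def)
next
  case (PBox p)
  have "f ` X = Y" using f by (simp add: bij_betw_def)
  then show ?case using PBox f(2) by force
next
  case (PDia p)
  have "f ` X = Y" using f by (simp add: bij_betw_def)
  then show ?case using PDia f(2) by force
qed auto

lemma finite_linear_enum:
  assumes "finite X" "partial_order_on X r" "\<And>x y. x \<in> X \<Longrightarrow> y \<in> X \<Longrightarrow> (x, y) \<in> r \<or> (y, x) \<in> r"
    and "w \<in> X" "\<And>x. x \<in> X \<Longrightarrow> (w, x) \<in> r"
  obtains f where "bij_betw f X {..<card X}" "f w = 0"
    "\<And>x y. x \<in> X \<Longrightarrow> y \<in> X \<Longrightarrow> (x, y) \<in> r \<longleftrightarrow> f x \<le> (f y :: nat)"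
proof -
  have po: "trans r" "antisym r" "\<And>x. x \<in> X \<Longrightarrow> (x, x) \<in> r"
    using assms(2) by (auto simp: partial_order_on_def preorder_on_def refl_on_def)
  define B where "B x = {y \<in> X. (y, x) \<in> r \<and> y \<noteq> x}" for x
  define f where "f x = card (B x)" for x
  have fin: "finite (B x)" for x using assms(1) by (auto simp: B_def)
  have less: "f x < f y" if "x \<in> X" "y \<in> X" "(x, y) \<in> r" "x \<noteq> y" for x y
  proof -
    have "B x \<subseteq> B y" "x \<in> B y" "x \<notin> B x"
      using that po by (auto simp: B_def dest: transD antisymD)
    then show ?thesis
      unfolding f_def by (intro psubset_card_mono[OF fin]) blast
  qed
  have mono: "(x, y) \<in> r \<longleftrightarrow> f x \<le> f y" if "x \<in> X" "y \<in> X" for x y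
    using less[of x y] less[of y x] assms(3)[OF that] that po(3) by (cases "x = y") force+
  have "inj_on f X"
    by (rule inj_onI) (metis less assms(3) less_irrefl)
  moreover have "f ` X \<subseteq> {..<card X}"
  proof
    fix k assume "k \<in> f ` X"
    then obtain x where "x \<in> X" "k = f x" by auto
    moreover from this have "B x \<subset> X" by (auto simp: B_def)
    ultimately show "k \<in> {..<card X}" using psubset_card_mono[OF assms(1)] by (auto simp: f_def)
  qed
  ultimately have "bij_betw f X {..<card X}"
    by (metis bij_betw_def card_image card_lessThan card_subset_eq finite_lessThan)
  moreover have "B w = {}" using assms(4,5) po by (auto simp: B_def dest: antisymD)
  then have "f w = 0" by (simp add: f_def)
  ultimately show ?thesis using that mono by blast
qed

lemma partial_order_on_restrict:
  assumes "partial_order_on X r" "Y \<subseteq> X"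
  shows "partial_order_on Y (r \<inter> Y \<times> Y)"
proof -
  have "trans (r \<inter> Y \<times> Y)"
    using assms by (intro trans_Int) (auto simp: partial_order_on_def preorder_on_def trans_def)
  moreover have "antisym (r \<inter> Y \<times> Y)"
    using assms by (auto simp: partial_order_on_def antisym_def)
  ultimately show ?thesis
    using assms by (auto simp: partial_order_on_def preorder_on_def refl_on_def)
qed

lemma complete_Grz_2:
  assumes "p \<notin> Grz_2"
  shows "\<exists>(X :: (pm set \<times> pm set set) set) r V w t. finite X \<and> partial_order_on X r \<and> w \<in> X \<and> t \<in> X \<and>
    (\<forall>x\<in>X. (w, x) \<in> r \<and> (x, t) \<in> r) \<and> \<not> ksat X r V w p"
proof -
  let ?A = "{ax_T, ax_4, ax_dot2, ax_Grz}"
  interpret grz ?A by standard (auto intro: normal_theory.axiom)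
  have d2: "ax_dot2 \<in> normal_theory ?A" by (rule normal_theory.axiom) simp
  obtain \<Gamma> where G: "mcs ?A \<Gamma>" "p \<notin> \<Gamma>"
    using assms mcs_refute unfolding Grz_2_def by blast
  obtain \<Delta> w Y where D: "mcs ?A \<Delta>" "settled p \<Delta>" "w = (\<Delta> \<inter> subfm p, seen p \<Delta>)"
    "Y = {x \<in> grz_nodes p \<Delta>. (w, x) \<in> grz_rel p \<Delta>}" "w \<in> Y"
    "\<not> ksat Y (grz_rel p \<Delta>) (\<lambda>i. {a. PVar i \<in> fst a}) w p"
    by (rule grz_model[OF G])
  obtain t where t: "t \<in> grz_nodes p \<Delta>" "\<forall>x\<in>grz_nodes p \<Delta>. (x, t) \<in> grz_rel p \<Delta>"
    using grz_top[OF d2 D(1)] by blast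
  let ?r = "grz_rel p \<Delta> \<inter> Y \<times> Y"
  have "partial_order_on Y ?r"
    by (rule partial_order_on_restrict[OF grz_partial_order]) (use D(4) in auto)
  moreover have "ksat Y ?r V x q \<longleftrightarrow> ksat Y (grz_rel p \<Delta>) V x q" if "x \<in> Y" for x V q
    using that by (induction q arbitrary: x) auto
  then have "\<not> ksat Y ?r (\<lambda>i. {a. PVar i \<in> fst a}) w p" using D(5,6) by blast
  moreover have "finite Y" using D(4) finite_grz_nodes by auto
  moreover have "t \<in> Y" using t D(3-5) by auto
  moreover have "\<forall>x\<in>Y. (w, x) \<in> ?r \<and> (x, t) \<in> ?r"
    using t(2) D(4,5) \<open>t \<in> Y\<close> by blast
  ultimately show ?thesis using D(5) by blast
qed

text \<open>A chain of more than \<open>n\<close> nodes comes from a chain of points each of which has left the types of the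
  earlier ones for good, so their characteristic formulas are markers that refute \<open>J n\<close>.\<close>

lemma complete_linear:
  assumes "grz A" "ax_dot3 \<in> normal_theory A" "p \<notin> normal_theory A"
  shows "\<exists>k>0. (\<forall>n>0. ax_J n \<in> normal_theory A \<longrightarrow> k \<le> n) \<and>
    (\<exists>V. \<not> ksat {..<k :: nat} {(i, j). i \<le> j} V 0 p)"
proof -
  interpret grz A by fact
  obtain \<Gamma> where G: "mcs A \<Gamma>" "p \<notin> \<Gamma>"
    using assms mcs_refute by blast
  obtain \<Delta> w Y where D: "mcs A \<Delta>" "settled p \<Delta>" "w = (\<Delta> \<inter> subfm p, seen p \<Delta>)"
    "Y = {x \<in> grz_nodes p \<Delta>. (w, x) \<in> grz_rel p \<Delta>}" "w \<in> Y"
    "\<not> ksat Y (grz_rel p \<Delta>) (\<lambda>i. {a. PVar i \<in> fst a}) w p"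
    by (rule grz_model[OF G])
  let ?r = "grz_rel p \<Delta> \<inter> Y \<times> Y"
  have po: "partial_order_on Y ?r"
    by (rule partial_order_on_restrict[OF grz_partial_order]) (use D(4) in auto)
  have fin: "finite Y" using D(4) finite_grz_nodes by auto
  have lin: "(x, y) \<in> ?r \<or> (y, x) \<in> ?r" if "x \<in> Y" "y \<in> Y" for x y
    using grz_linear[OF assms(2) D(1), of x p y] that D(4) by blast
  have least: "(w, x) \<in> ?r" if "x \<in> Y" for x
    using that D(4,5) by blast
  obtain f where f: "bij_betw f Y {..<card Y}" "f w = 0"
    "\<And>x y. x \<in> Y \<Longrightarrow> y \<in> Y \<Longrightarrow> (x, y) \<in> ?r \<longleftrightarrow> f x \<le> f y"
    using finite_linear_enum[OF fin po lin D(5) least] by metis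
  have "card Y > 0" using fin D(5) by (auto simp: card_gt_0_iff)
  moreover have "\<not> ksat {..<card Y} {(i, j). i \<le> j} (\<lambda>i. f ` ({a. PVar i \<in> fst a} \<inter> Y)) 0 p"
  proof -
    have "(x, y) \<in> grz_rel p \<Delta> \<longleftrightarrow> (f x, f y) \<in> {(i, j). i \<le> j}" if "x \<in> Y" "y \<in> Y" for x y
      using f(3)[OF that] that by simp
    from ksat_iso[OF f(1) this D(5), of "\<lambda>i. {a. PVar i \<in> fst a}" p] show ?thesis
      using D(6) unfolding f(2) by blast
  qed
  moreover have "card Y \<le> n" if n: "n > 0" "ax_J n \<in> normal_theory A" for n
  proof (rule ccontr)
    assume less: "\<not> card Y \<le> n"
    define e where "e = the_inv_into Y f"
    have e: "e i \<in> Y" "f (e i) = i" if "i \<le> n" for i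
      using that less f(1) bij_betwE[OF bij_betw_the_inv_into[OF f(1)]] f_the_inv_into_f_bij_betw[OF f(1)]
      by (auto simp: e_def)
    have "\<exists>\<Theta>. mcs A \<Theta> \<and> canonical \<Delta> \<Theta> \<and> e i = (\<Theta> \<inter> subfm p, seen p \<Theta>)" if "i \<le> n" for i
      using e(1)[OF that] D(4) by (auto simp: grz_nodes_def)
    then obtain E where E: "\<And>i. i \<le> n \<Longrightarrow> mcs A (E i) \<and> canonical \<Delta> (E i) \<and> e i = (E i \<inter> subfm p, seen p (E i))"
      by metis
    have st: "canonical (E i) (E (Suc i)) \<and> PBox (PNeg (chi p (E i))) \<in> E (Suc i)" if i: "i < n" for i
    proof -
      have "(e i, e (Suc i)) \<in> grz_rel p \<Delta>" "e i \<noteq> e (Suc i)"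
        using f(3)[of "e i" "e (Suc i)"] e[of i] e[of "Suc i"] i by auto
      then show ?thesis
        using E[of i] E[of "Suc i"] i grz_strict[OF assms(2) D(1), of "E i" "E (Suc i)" p] by auto
    qed
    have "ax_J n \<notin> normal_theory A"
      by (rule J_chain[OF n(1), of E "\<lambda>i. chi p (E i)"]) (use E st in \<open>auto simp: mcs_chi\<close>)
    then show False using n by simp
  qed
  ultimately show ?thesis by blast
qed

lemma complete_Grz_3:
  assumes "p \<notin> Grz_3"
  shows "\<exists>k>0. \<exists>V. \<not> ksat {..<k :: nat} {(i, j). i \<le> j} V 0 p"
proof -
  have "grz {ax_T, ax_4, ax_dot3, ax_Grz}"
    by standard (auto intro: normal_theory.axiom)
  from complete_linear[OF this _ assms[unfolded Grz_3_def]] show ?thesis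
    by (auto intro: normal_theory.axiom)
qed

lemma complete_Grz_3J:
  assumes "p \<notin> Grz_3J n" "n > 0"
  shows "\<exists>k>0. k \<le> n \<and> (\<exists>V. \<not> ksat {..<k :: nat} {(i, j). i \<le> j} V 0 p)"
proof -
  have "grz {ax_T, ax_4, ax_dot3, ax_Grz, ax_J n}"
    by standard (auto intro: normal_theory.axiom)
  from complete_linear[OF this _ assms(1)[unfolded Grz_3J_def]] show ?thesis
    using assms(2) by (auto intro: normal_theory.axiom)
qed

section \<open>Categories of sets and the stability of truth\<close>

primrec pvars :: "pm \<Rightarrow> nat set" where
  "pvars (PVar i) = {i}"
| "pvars (PNeg p) = pvars p"
| "pvars (PAnd p q) = pvars p \<union> pvars q"
| "pvars (PBox p) = pvars p"
| "pvars (PDia p) = pvars p"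

lemma finite_pvars [simp]: "finite (pvars p)"
  by (induction p) auto

lemma finite_fv [simp]: "finite (fv \<phi>)"
  by (induction \<phi>) auto

lemma fv_inst: "fv (inst \<sigma> p) = (\<Union>i\<in>pvars p. fv (\<sigma> i))"
  by (induction p) auto

lemma inst_psubst: "inst \<sigma> (psubst s p) = inst (\<lambda>i. inst \<sigma> (s i)) p"
  by (induction p) auto

lemma sat_cong: "(\<And>x. x \<in> fv \<phi> \<Longrightarrow> \<mu> x = \<mu>' x) \<Longrightarrow> sat C W \<mu> \<phi> \<longleftrightarrow> sat C W \<mu>' \<phi>"
proof (induction \<phi> arbitrary: W \<mu> \<mu>')
  case (Ex x \<phi>)
  have "sat C W (\<mu>(x := a)) \<phi> \<longleftrightarrow> sat C W (\<mu>'(x := a)) \<phi>" for a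
    by (rule Ex.IH) (use Ex.prems in auto)
  then show ?case by simp
next
  case (All x \<phi>)
  have "sat C W (\<mu>(x := a)) \<phi> \<longleftrightarrow> sat C W (\<mu>'(x := a)) \<phi>" for a
    by (rule All.IH) (use All.prems in auto)
  then show ?case by simp
next
  case (Dia \<phi>)
  have "sat C U (f \<circ> \<mu>) \<phi> \<longleftrightarrow> sat C U (f \<circ> \<mu>') \<phi>" for f U
    by (rule Dia.IH) (use Dia.prems in auto)
  then show ?case by simp
next
  case (Box \<phi>)
  have "sat C U (f \<circ> \<mu>) \<phi> \<longleftrightarrow> sat C U (f \<circ> \<mu>') \<phi>" for f U
    by (rule Box.IH) (use Box.prems in auto)
  then show ?case by simp
next
  case (And \<phi> \<psi>)
  have "sat C W \<mu> \<phi> \<longleftrightarrow> sat C W \<mu>' \<phi>" by (rule And.IH) (use And.prems in auto)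
  moreover have "sat C W \<mu> \<psi> \<longleftrightarrow> sat C W \<mu>' \<psi>" by (rule And.IH) (use And.prems in auto)
  ultimately show ?case by simp
next
  case (Neg \<phi>)
  have "sat C W \<mu> \<phi> \<longleftrightarrow> sat C W \<mu>' \<phi>" by (rule Neg.IH) (use Neg.prems in auto)
  then show ?case by simp
qed simp

lemma id_hom: "(\<lambda>x\<in>W. x) \<in> hom_maps k W W"
  by (cases k) (auto simp: inj_on_def bij_betw_def)

lemma hom_PiE: "f \<in> hom_maps k W U \<Longrightarrow> f \<in> W \<rightarrow>\<^sub>E U"
  by (cases k) auto

lemma hom_image: "f \<in> hom_maps k W U \<Longrightarrow> x \<in> W \<Longrightarrow> f x \<in> U"
  using hom_PiE by fastforce

lemma comp_hom:
  assumes "f \<in> hom_maps k W U" "g \<in> hom_maps k U V"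
  shows "compose W g f \<in> hom_maps k W V"
proof -
  have E: "compose W g f \<in> W \<rightarrow>\<^sub>E V"
    using hom_PiE[OF assms(1)] hom_PiE[OF assms(2)] by (auto simp: compose_def)
  show ?thesis
  proof (cases k)
    case Surj
    then have "compose W g f ` W = g ` f ` W" by (auto simp: compose_def image_def)
    then show ?thesis using Surj assms E by auto
  next
    case Inj
    then show ?thesis using assms E by (auto simp: inj_on_def compose_def PiE_def Pi_def)
  next
    case Incl
    then show ?thesis using assms by (auto simp: compose_def fun_eq_iff)
  next
    case Bij
    then show ?thesis using assms E by (auto intro: bij_betw_compose)
  next
    case Ident
    then show ?thesis using assms by (auto simp: compose_def fun_eq_iff)
  qed (use E in auto)
qed

subsection \<open>Universes\<close>

lemma universe_subset: "set_universe \<U> \<Longrightarrow> W \<in> \<U> \<Longrightarrow> U \<subseteq> W \<Longrightarrow> U \<in> \<U>"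
  unfolding set_universe_def by blast

lemma universe_image: "set_universe \<U> \<Longrightarrow> W \<in> \<U> \<Longrightarrow> f ` W \<in> \<U>"
  unfolding set_universe_def by blast

lemma universe_insert:
  assumes "set_universe \<U>" "W \<in> \<U>" "infinite W"
  shows "insert a W \<in> \<U>"
proof -
  obtain h where "bij_betw h W (W \<union> {a})" using infinite_imp_bij_betw2[OF assms(3)] by blast
  then have "h ` W = insert a W" by (simp add: bij_betw_def)
  then show ?thesis using universe_image[OF assms(1,2), of h] by simp
qed

lemma universe_union:
  assumes "set_universe \<U>" "W \<in> \<U>" "infinite W" "finite F"
  shows "F \<union> W \<in> \<U>"
  using assms(4)
proof (induction F)
  case (insert x F)
  then show ?case using universe_insert[OF assms(1) insert.IH, of x] assms(3) by auto
qed (use assms in simp)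

lemma universe_finite:
  assumes "set_universe \<U>" "finite F"
  shows "F \<in> \<U>"
proof -
  obtain W where "W \<in> \<U>" "infinite W" using assms(1) unfolding set_universe_def by auto
  then have "F \<union> W \<in> \<U>" by (rule universe_union[OF assms(1) _ _ assms(2)])
  then show ?thesis using universe_subset[OF assms(1), of "F \<union> W" F] by auto
qed

lemma universe_type_infinite:
  fixes \<U> :: "'a set set"
  assumes "set_universe \<U>" shows "infinite (UNIV :: 'a set)"
  using assms rev_finite_subset[of UNIV] unfolding set_universe_def by auto

subsection \<open>Sizes and equality patterns\<close>

definition large :: "nat \<Rightarrow> 'a set \<Rightarrow> bool" where
  "large N U \<longleftrightarrow> infinite U \<or> N \<le> card U"

text \<open>The sizes that a formula with bound \<open>N\<close> cannot tell apart.\<close>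

definition szeq :: "nat \<Rightarrow> 'a set \<Rightarrow> 'b set \<Rightarrow> bool" where
  "szeq N U V \<longleftrightarrow> large N U \<and> large N V \<or> finite U \<and> finite V \<and> card U = card V"

definition samepat :: "nat set \<Rightarrow> (nat \<Rightarrow> 'a) \<Rightarrow> (nat \<Rightarrow> 'b) \<Rightarrow> bool" where
  "samepat A \<mu> \<mu>' \<longleftrightarrow> (\<forall>x\<in>A. \<forall>y\<in>A. \<mu> x = \<mu> y \<longleftrightarrow> \<mu>' x = \<mu>' y)"

lemma szeq_refl [simp]: "szeq N U U"
  by (auto simp: szeq_def large_def)

lemma szeq_sym: "szeq N U V \<Longrightarrow> szeq N V U"
  by (auto simp: szeq_def)

lemma szeq_mono: "szeq N U V \<Longrightarrow> M \<le> N \<Longrightarrow> szeq M U V"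
  by (auto simp: szeq_def large_def)

lemma szeq_infinite: "infinite U \<Longrightarrow> infinite V \<Longrightarrow> szeq N U V"
  by (auto simp: szeq_def large_def)

lemma samepat_sym: "samepat A \<mu> \<mu>' \<Longrightarrow> samepat A \<mu>' \<mu>"
  by (auto simp: samepat_def)

lemma samepat_mono: "samepat A \<mu> \<mu>' \<Longrightarrow> B \<subseteq> A \<Longrightarrow> samepat B \<mu> \<mu>'"
  by (auto simp: samepat_def)

lemma samepat_card:
  assumes "samepat A \<mu> \<mu>'"
  shows "bij_betw (\<lambda>a. \<mu>' (inv_into A \<mu> a)) (\<mu> ` A) (\<mu>' ` A)" "x \<in> A \<Longrightarrow> \<mu>' (inv_into A \<mu> (\<mu> x)) = \<mu>' x"
proof -
  have *: "\<mu>' (inv_into A \<mu> (\<mu> x)) = \<mu>' x" if "x \<in> A" for x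
    using assms that f_inv_into_f[of "\<mu> x" \<mu> A] inv_into_into[of "\<mu> x" \<mu> A]
    by (auto simp: samepat_def)
  then show "x \<in> A \<Longrightarrow> \<mu>' (inv_into A \<mu> (\<mu> x)) = \<mu>' x" .
  show "bij_betw (\<lambda>a. \<mu>' (inv_into A \<mu> a)) (\<mu> ` A) (\<mu>' ` A)"
    using assms * by (auto simp: bij_betw_def inj_on_def samepat_def image_image)
qed

lemma extend_bij:
  assumes "finite U" "finite V" "card U = card V" "samepat A \<mu> \<mu>'" "\<mu> ` A \<subseteq> U" "\<mu>' ` A \<subseteq> V"
  shows "\<exists>\<beta>. bij_betw \<beta> U V \<and> (\<forall>x\<in>A. \<beta> (\<mu> x) = \<mu>' x)"
proof -
  let ?e = "\<lambda>a. \<mu>' (inv_into A \<mu> a)"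
  have e: "bij_betw ?e (\<mu> ` A) (\<mu>' ` A)" by (rule samepat_card(1)[OF assms(4)])
  have fin: "finite (\<mu> ` A)" "finite (\<mu>' ` A)" using assms finite_subset by blast+
  have "card (U - \<mu> ` A) = card (V - \<mu>' ` A)"
    using assms bij_betw_same_card[OF e] fin by (simp add: card_Diff_subset)
  then obtain b where b: "bij_betw b (U - \<mu> ` A) (V - \<mu>' ` A)"
    using assms finite_same_card_bij by (metis finite_Diff)
  let ?\<beta> = "\<lambda>a. if a \<in> \<mu> ` A then ?e a else b a"
  have 1: "bij_betw ?\<beta> (\<mu> ` A) (\<mu>' ` A)"
    using e by (rule bij_betw_cong[THEN iffD1, rotated]) auto
  have 2: "bij_betw ?\<beta> (U - \<mu> ` A) (V - \<mu>' ` A)"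
    using b by (rule bij_betw_cong[THEN iffD1, rotated]) auto
  have "bij_betw ?\<beta> (\<mu> ` A \<union> (U - \<mu> ` A)) (\<mu>' ` A \<union> (V - \<mu>' ` A))"
    by (rule bij_betw_combine[OF 1 2]) auto
  moreover have "\<mu> ` A \<union> (U - \<mu> ` A) = U" "\<mu>' ` A \<union> (V - \<mu>' ` A) = V" using assms by auto
  ultimately show ?thesis
    using samepat_card(2)[OF assms(4)] by (intro exI[of _ ?\<beta>]) simp
qed

lemma match_element:
  assumes "finite A" "samepat A \<mu> \<mu>'" "szeq (Suc (card A)) U V" "\<mu> ` A \<subseteq> U" "\<mu>' ` A \<subseteq> V" "a \<in> U"
  shows "\<exists>b\<in>V. \<forall>y\<in>A. \<mu> y = a \<longleftrightarrow> \<mu>' y = b"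
proof (cases "a \<in> \<mu> ` A")
  case True
  then obtain y where "y \<in> A" "a = \<mu> y" by auto
  then show ?thesis using assms by (intro bexI[of _ "\<mu>' y"]) (auto simp: samepat_def)
next
  case False
  have "\<not> V \<subseteq> \<mu>' ` A"
  proof
    assume V: "V \<subseteq> \<mu>' ` A"
    then have fV: "finite V" using assms(1) finite_subset by blast
    have le: "card V \<le> card (\<mu>' ` A)" by (rule card_mono) (use V assms(1) in auto)
    have "card (\<mu>' ` A) \<le> card A" using assms(1) by (rule card_image_le)
    then have eq: "finite U" "card U = card V"
      using assms(3) fV le by (auto simp: szeq_def large_def)
    have "card (\<mu> ` A) < card U"
      by (rule psubset_card_mono) (use eq False assms in auto)
    moreover have "card (\<mu> ` A) = card (\<mu>' ` A)"
      using bij_betw_same_card[OF samepat_card(1)[OF assms(2)]] .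
    ultimately show False using eq le by simp
  qed
  then show ?thesis using False by fastforce
qed

subsection \<open>Lifting morphisms\<close>

lemma surjection_exists:
  assumes "T \<noteq> {}" "finite T" "large (card T) S"
  shows "\<exists>s. s ` S = T"
proof -
  obtain B where B: "B \<subseteq> S" "finite B" "card B = card T"
  proof (cases "finite S")
    case True
    then show ?thesis
      using that assms(3) obtain_subset_with_card_n[of "card T" S] finite_subset
      by (metis large_def)
  next
    case False
    then show ?thesis using that infinite_arbitrarily_large by metis
  qed
  obtain f where "bij_betw f B T" using finite_same_card_bij[OF B(2) assms(2) B(3)] by blast
  moreover obtain t where "t \<in> T" using assms(1) by auto
  ultimately have "(\<lambda>x. if x \<in> B then f x else t) ` S = T"
    using B(1) by (auto simp: bij_betw_def)
  then show ?thesis by blast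
qed

text \<open>Sending each named element to a representative of its new class leaves the unnamed elements
  in place. So infinite worlds stay infinite, and large worlds lose few elements.\<close>

lemma collapse:
  assumes "\<mu> ` A \<subseteq> V" "\<And>x y. x \<in> A \<Longrightarrow> y \<in> A \<Longrightarrow> \<mu> x = \<mu> y \<Longrightarrow> \<psi> x = \<psi> y"
  shows "\<exists>V' h. V' \<subseteq> V \<and> V - \<mu> ` A \<subseteq> V' \<and> h \<in> hom_maps Surj V V' \<and> samepat A (h \<circ> \<mu>) \<psi>"
proof -
  define rep where "rep b = (SOME y. y \<in> A \<and> \<psi> y = b)" for b
  have rep: "rep (\<psi> x) \<in> A" "\<psi> (rep (\<psi> x)) = \<psi> x" if "x \<in> A" for x
    using someI[of "\<lambda>y. y \<in> A \<and> \<psi> y = \<psi> x" x] that unfolding rep_def by auto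
  define h where "h = (\<lambda>v\<in>V. if v \<in> \<mu> ` A then \<mu> (rep (\<psi> (inv_into A \<mu> v))) else v)"
  have h: "h (\<mu> x) = \<mu> (rep (\<psi> x))" if x: "x \<in> A" for x
  proof -
    have "inv_into A \<mu> (\<mu> x) \<in> A" "\<mu> (inv_into A \<mu> (\<mu> x)) = \<mu> x"
      using x by (auto intro: inv_into_into f_inv_into_f)
    then have "\<psi> (inv_into A \<mu> (\<mu> x)) = \<psi> x" using assms(2) x by blast
    then show ?thesis using x assms(1) by (auto simp: h_def)
  qed
  have "h v \<in> V" if "v \<in> V" for v
  proof (cases "v \<in> \<mu> ` A")
    case True
    then obtain x where "x \<in> A" "v = \<mu> x" by blast
    then show ?thesis using h[of x] rep(1)[of x] assms(1) by auto
  next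
    case False
    then show ?thesis using that by (simp add: h_def)
  qed
  then have "h ` V \<subseteq> V" by blast
  moreover have "V - \<mu> ` A \<subseteq> h ` V"
    by (auto simp: h_def image_iff)
  moreover have "h \<in> hom_maps Surj V (h ` V)" by (auto simp: h_def)
  moreover have "samepat A (h \<circ> \<mu>) \<psi>"
    unfolding samepat_def
  proof (intro ballI)
    fix x y assume xy: "x \<in> A" "y \<in> A"
    have "\<psi> x = \<psi> y" if "\<mu> (rep (\<psi> x)) = \<mu> (rep (\<psi> y))"
      using assms(2)[OF rep(1)[OF xy(1)] rep(1)[OF xy(2)] that] rep xy by simp
    then show "(h \<circ> \<mu>) x = (h \<circ> \<mu>) y \<longleftrightarrow> \<psi> x = \<psi> y"
      using h xy by auto
  qed
  ultimately show ?thesis by blast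
qed

lemma bij_hom:
  assumes "bij_betw \<beta> V U" "k \<notin> {Incl, Ident}"
  shows "restrict \<beta> V \<in> hom_maps k V U"
proof -
  have "inj_on (restrict \<beta> V) V" "restrict \<beta> V ` V = U" "restrict \<beta> V \<in> V \<rightarrow>\<^sub>E U"
    using assms(1) by (auto simp: bij_betw_def inj_on_def)
  then show ?thesis using assms(2) by (cases k) (auto simp: bij_betw_def)
qed

lemma surj_homI: "h \<in> V \<rightarrow>\<^sub>E U \<Longrightarrow> U \<subseteq> h ` V \<Longrightarrow> h \<in> hom_maps Surj V U"
  by auto

lemma inj_hom:
  assumes "g \<in> hom_maps k U U'" "k \<notin> {Func, Surj}"
  shows "inj_on g U"
  using assms by (cases k) (auto simp: bij_betw_def inj_on_def)

definition sets_cat :: "'a set set \<Rightarrow> mor_class \<Rightarrow> 'a setcat \<Rightarrow> bool" where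
  "sets_cat \<U> k C \<longleftrightarrow> set_universe \<U> \<and> Hom C = hom_maps k \<and>
     (Obj C = \<U> \<or> Obj C = {W \<in> \<U>. infinite W})"

lemma superset_of_size:
  assumes "set_universe \<U>" "finite V" "U \<in> \<U>" "infinite U \<or> card V \<le> card U"
  shows "\<exists>V'\<in>\<U>. V \<subseteq> V' \<and> szeq N V' U"
proof (cases "finite U")
  case True
  have "infinite (UNIV - V)" using universe_type_infinite[OF assms(1)] assms(2) by simp
  then obtain B where B: "finite B" "card B = card U - card V" "B \<subseteq> UNIV - V"
    using infinite_arbitrarily_large by metis
  have "card (V \<union> B) = card U" using card_Un_disjoint[of V B] B assms True by auto
  then show ?thesis
    using universe_finite[OF assms(1), of "V \<union> B"] B assms(2) True
    by (intro bexI[of _ "V \<union> B"]) (auto simp: szeq_def)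
next
  case False
  then show ?thesis
    using universe_union[OF assms(1,3) False assms(2)]
    by (intro bexI[of _ "V \<union> U"]) (auto intro: szeq_infinite)
qed

text \<open>A bijection that respects the named elements transports the morphism. Only inclusions and
  identities are not closed under composition with bijections; for inclusions the world is
  extended to a superset of the right size.\<close>

lemma lift_exact:
  assumes C: "sets_cat \<U> k C" and ob: "U \<in> Obj C" "V \<in> Obj C" "U' \<in> Obj C"
    and g: "g \<in> hom_maps k U U'"
    and fin: "finite U" "finite V" "card U = card V"
    and pat: "samepat A \<mu> \<mu>'" "\<mu> ` A \<subseteq> U" "\<mu>' ` A \<subseteq> V"
  shows "\<exists>V'\<in>Obj C. \<exists>h\<in>hom_maps k V V'. szeq N U' V' \<and> samepat A (g \<circ> \<mu>) (h \<circ> \<mu>')"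
proof (cases "k \<in> {Incl, Ident}")
  case False
  obtain \<beta> where \<beta>: "bij_betw \<beta> V U" "\<forall>x\<in>A. \<beta> (\<mu>' x) = \<mu> x"
    using extend_bij[OF fin(2,1) fin(3)[symmetric] samepat_sym[OF pat(1)] pat(3,2)] by blast
  let ?h = "compose V g (restrict \<beta> V)"
  have "?h \<in> hom_maps k V U'"
    using comp_hom[OF bij_hom[OF \<beta>(1) False] g] .
  moreover have "?h (\<mu>' x) = g (\<mu> x)" if "x \<in> A" for x
    using that pat(3) \<beta>(2) by (auto simp: compose_def)
  then have "samepat A (g \<circ> \<mu>) (?h \<circ> \<mu>')" by (auto simp: samepat_def)
  ultimately show ?thesis using ob by (intro bexI[of _ U'] bexI[of _ ?h]) auto
next
  case True
  then have gU: "U \<subseteq> U'" "g = (\<lambda>x\<in>U. x)" using g by auto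
  have pat': "samepat A (g \<circ> \<mu>) ((\<lambda>x\<in>V. x) \<circ> \<mu>')"
    using pat gU(2) by (auto simp: samepat_def image_subset_iff)
  show ?thesis
  proof (cases "k = Ident")
    case k: True
    then have "szeq N U' V" using fin g by (auto simp: szeq_def)
    then show ?thesis using ob(2) id_hom pat' by blast
  next
    case False
    then have k: "k = Incl" using True by auto
    have U: "set_universe \<U>" "Obj C = \<U>" using C fin(1) ob(1) by (auto simp: sets_cat_def)
    have "infinite U' \<or> card V \<le> card U'" using card_mono[OF _ gU(1)] fin(3) by metis
    then obtain V' where V': "V \<subseteq> V'" "V' \<in> \<U>" "szeq N U' V'"
      using superset_of_size[OF U(1) fin(2), of U'] ob(3) U(2) szeq_sym by blast
    then have "(\<lambda>x\<in>V. x) \<in> hom_maps k V V'" using k by auto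
    then show ?thesis using V' U(2) pat' by blast
  qed
qed

text \<open>An injective morphism preserves the pattern and leads from large worlds to large worlds, so
  an identity matches it. A function is matched by one into the same target. A surjection onto a
  small world is copied, using the unnamed elements to reach the whole target; one onto a large world
  is matched by collapsing the named elements alone.\<close>

lemma lift_large:
  assumes C: "sets_cat \<U> k C" and ob: "U \<in> Obj C" "V \<in> Obj C" "U' \<in> Obj C"
    and g: "g \<in> hom_maps k U U'"
    and lg: "large (Suc (N + card A)) U" "large (Suc (N + card A)) V"
    and pat: "finite A" "samepat A \<mu> \<mu>'" "\<mu> ` A \<subseteq> U" "\<mu>' ` A \<subseteq> V"
  shows "\<exists>V'\<in>Obj C. \<exists>h\<in>hom_maps k V V'. szeq N U' V' \<and> samepat A (g \<circ> \<mu>) (h \<circ> \<mu>')"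
proof (cases "k \<in> {Func, Surj}")
  case False
  then have inj: "inj_on g U" using inj_hom g by blast
  have img: "g ` U \<subseteq> U'" using hom_image[OF g] by blast
  have "large N U'"
  proof (cases "finite U'")
    case True
    then have "finite U" "card U \<le> card U'"
      using inj img True inj_on_finite[of g U U'] card_inj_on_le[of g U U'] by auto
    then show ?thesis using lg by (auto simp: large_def)
  qed (simp add: large_def)
  then have "szeq N U' V" using lg by (auto simp: szeq_def large_def)
  moreover have "samepat A (g \<circ> \<mu>) ((\<lambda>x\<in>V. x) \<circ> \<mu>')"
    using pat inj by (auto simp: samepat_def image_subset_iff inj_on_eq_iff)
  ultimately show ?thesis using ob(2) id_hom by blast
next
  case True
  have "U \<noteq> {}" using lg(1) by (auto simp: large_def)
  then obtain u where u: "u \<in> U'" using hom_image[OF g] by blast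
  let ?e = "\<lambda>v. g (\<mu> (inv_into A \<mu>' v))"
  have e: "?e (\<mu>' x) = g (\<mu> x)" if "x \<in> A" for x
    using samepat_card(2)[OF samepat_sym[OF pat(2)] that] by simp
  have emem: "?e v \<in> U'" if "v \<in> \<mu>' ` A" for v
    using that e pat(3) hom_image[OF g] by auto
  have pat': "samepat A (g \<circ> \<mu>) (h \<circ> \<mu>')" if "\<And>v. v \<in> \<mu>' ` A \<Longrightarrow> h v = ?e v" for h
    using that e by (auto simp: samepat_def)
  consider "k = Func" | "k = Surj" "\<not> large N U'" | "k = Surj" "large N U'" using True by auto
  then show ?thesis
  proof cases
    case 1
    let ?h = "\<lambda>v\<in>V. if v \<in> \<mu>' ` A then ?e v else u"
    have "?h \<in> hom_maps k V U'" using 1 u emem by (auto simp: PiE_def extensional_def)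
    moreover have "samepat A (g \<circ> \<mu>) (?h \<circ> \<mu>')" by (rule pat') (use pat(4) in auto)
    ultimately show ?thesis using ob(3) szeq_refl by blast
  next
    case 2
    let ?S = "V - \<mu>' ` A"
    have cA: "card (\<mu>' ` A) \<le> card A" using pat(1) card_image_le by blast
    have "large N ?S"
    proof (cases "finite V")
      case f: True
      then have "card ?S = card V - card (\<mu>' ` A)" using pat(4) by (meson card_Diff_subset finite_subset)
      then show ?thesis using lg(2) f cA by (auto simp: large_def)
    qed (use pat(1) in \<open>simp add: large_def\<close>)
    then have "large (card U') ?S" using 2 by (auto simp: large_def)
    then obtain s where s: "s ` ?S = U'"
      using surjection_exists[of U' ?S] 2 u by (auto simp: large_def)
    let ?h = "\<lambda>v\<in>V. if v \<in> \<mu>' ` A then ?e v else s v"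
    have "?h \<in> V \<rightarrow>\<^sub>E U'" using emem s by (auto simp: PiE_def extensional_def)
    moreover have "U' \<subseteq> ?h ` V"
    proof
      fix y assume "y \<in> U'"
      then obtain v where "v \<in> ?S" "y = s v" using s by auto
      then show "y \<in> ?h ` V" by (intro image_eqI[of _ _ v]) auto
    qed
    ultimately have "?h \<in> hom_maps k V U'" unfolding 2(1) by (rule surj_homI)
    moreover have "samepat A (g \<circ> \<mu>) (?h \<circ> \<mu>')" by (rule pat') (use pat(4) in auto)
    ultimately show ?thesis using ob(3) szeq_refl by blast
  next
    case 3
    have "(g \<circ> \<mu>) x = (g \<circ> \<mu>) y" if "x \<in> A" "y \<in> A" "\<mu>' x = \<mu>' y" for x y
      using that pat(2) unfolding samepat_def o_apply by metis
    from collapse[OF pat(4) this]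
    have "\<exists>V' h. V' \<subseteq> V \<and> V - \<mu>' ` A \<subseteq> V' \<and> h \<in> hom_maps Surj V V' \<and> samepat A (h \<circ> \<mu>') (g \<circ> \<mu>)" .
    then obtain V' h where V': "V' \<subseteq> V" "V - \<mu>' ` A \<subseteq> V'" "h \<in> hom_maps Surj V V'"
      "samepat A (h \<circ> \<mu>') (g \<circ> \<mu>)" by blast
    have inf: "infinite V' \<or> (finite V \<and> N \<le> card V')"
    proof (cases "finite V")
      case f: True
      have "card V - card (\<mu>' ` A) \<le> card (V - \<mu>' ` A)" using diff_card_le_card_Diff pat(1) by blast
      also have "\<dots> \<le> card V'" using V' f by (meson card_mono finite_subset)
      finally show ?thesis using lg(2) f card_image_le[OF pat(1), of \<mu>'] by (auto simp: large_def)
    next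
      case False
      then have "infinite (V - \<mu>' ` A)" using pat(1) by simp
      then show ?thesis using V'(2) finite_subset by blast
    qed
    have "V' \<in> Obj C"
      using C ob(2) V'(1) inf universe_subset[of \<U> V V'] by (auto simp: sets_cat_def)
    moreover have "szeq N U' V'" using 3 inf by (auto simp: szeq_def large_def)
    ultimately show ?thesis using V' 3 samepat_sym by blast
  qed
qed

text \<open>A quantifier needs one element besides the named ones. In the modal clauses, collapsing may cost as
  many elements as there are named ones, and one more keeps the world nonempty.\<close>

primrec bound :: "fm \<Rightarrow> nat" where
  "bound (Eq x y) = 0"
| "bound (Neg \<phi>) = bound \<phi>"
| "bound (And \<phi> \<psi>) = max (bound \<phi>) (bound \<psi>)"
| "bound (Ex x \<phi>) = max (bound \<phi>) (Suc (card (fv \<phi>)))"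
| "bound (All x \<phi>) = max (bound \<phi>) (Suc (card (fv \<phi>)))"
| "bound (Dia \<phi>) = Suc (bound \<phi> + card (fv \<phi>))"
| "bound (Box \<phi>) = Suc (bound \<phi> + card (fv \<phi>))"

lemma lift_hom:
  assumes "sets_cat \<U> k C" "U \<in> Obj C" "V \<in> Obj C" "U' \<in> Obj C" "g \<in> hom_maps k U U'"
    "szeq (Suc (N + card A)) U V" "finite A" "samepat A \<mu> \<mu>'" "\<mu> ` A \<subseteq> U" "\<mu>' ` A \<subseteq> V"
  shows "\<exists>V'\<in>Obj C. \<exists>h\<in>hom_maps k V V'. szeq N U' V' \<and> samepat A (g \<circ> \<mu>) (h \<circ> \<mu>')"
  using assms(6) lift_large[OF assms(1-5) _ _ assms(7-10)] lift_exact[OF assms(1-5) _ _ _ assms(8-10)]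
  unfolding szeq_def by blast

definition stable_at :: "'a setcat \<Rightarrow> fm \<Rightarrow> bool" where
  "stable_at C \<phi> \<longleftrightarrow> (\<forall>U\<in>Obj C. \<forall>V\<in>Obj C. \<forall>\<mu> \<mu>'. szeq (bound \<phi>) U V \<longrightarrow> samepat (fv \<phi>) \<mu> \<mu>' \<longrightarrow>
     \<mu> ` fv \<phi> \<subseteq> U \<longrightarrow> \<mu>' ` fv \<phi> \<subseteq> V \<longrightarrow> (sat C U \<mu> \<phi> \<longleftrightarrow> sat C V \<mu>' \<phi>))"

lemma stable_atD:
  "stable_at C \<phi> \<Longrightarrow> U \<in> Obj C \<Longrightarrow> V \<in> Obj C \<Longrightarrow> szeq (bound \<phi>) U V \<Longrightarrow> samepat (fv \<phi>) \<mu> \<mu>' \<Longrightarrow>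
    \<mu> ` fv \<phi> \<subseteq> U \<Longrightarrow> \<mu>' ` fv \<phi> \<subseteq> V \<Longrightarrow> sat C U \<mu> \<phi> \<longleftrightarrow> sat C V \<mu>' \<phi>"
  by (simp add: stable_at_def)

lemma stable_element:
  assumes "stable_at C \<phi>" and a: "a \<in> U" and p: "U \<in> Obj C" "V \<in> Obj C"
    "szeq (bound (Ex x \<phi>)) U V" "samepat (fv \<phi> - {x}) \<mu> \<mu>'" "\<mu> ` (fv \<phi> - {x}) \<subseteq> U" "\<mu>' ` (fv \<phi> - {x}) \<subseteq> V"
  shows "\<exists>b\<in>V. sat C U (\<mu>(x := a)) \<phi> \<longleftrightarrow> sat C V (\<mu>'(x := b)) \<phi>"
proof -
  have "szeq (Suc (card (fv \<phi> - {x}))) U V"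
    by (rule szeq_mono[OF p(3)]) (simp add: card_mono le_max_iff_disj)
  then obtain b where b: "b \<in> V" "\<forall>y\<in>fv \<phi> - {x}. \<mu> y = a \<longleftrightarrow> \<mu>' y = b"
    using match_element[of "fv \<phi> - {x}" \<mu> \<mu>' U V a] p a by auto
  have "sat C U (\<mu>(x := a)) \<phi> \<longleftrightarrow> sat C V (\<mu>'(x := b)) \<phi>"
  proof (rule stable_atD[OF assms(1) p(1,2)])
    show "szeq (bound \<phi>) U V" using p(3) by (auto intro: szeq_mono)
    show "samepat (fv \<phi>) (\<mu>(x := a)) (\<mu>'(x := b))" using p(4) b(2) by (auto simp: samepat_def)
    show "(\<mu>(x := a)) ` fv \<phi> \<subseteq> U" "(\<mu>'(x := b)) ` fv \<phi> \<subseteq> V" using p(5,6) a b(1) by auto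
  qed
  then show ?thesis using b(1) by blast
qed

lemma stable_successor:
  assumes "stable_at C \<phi>" and C: "sets_cat \<U> k C" and g: "U' \<in> Obj C" "g \<in> hom_maps k U U'"
    and p: "U \<in> Obj C" "V \<in> Obj C" "szeq (bound (Dia \<phi>)) U V" "samepat (fv \<phi>) \<mu> \<mu>'"
      "\<mu> ` fv \<phi> \<subseteq> U" "\<mu>' ` fv \<phi> \<subseteq> V"
  shows "\<exists>V'\<in>Obj C. \<exists>h\<in>hom_maps k V V'. sat C U' (g \<circ> \<mu>) \<phi> \<longleftrightarrow> sat C V' (h \<circ> \<mu>') \<phi>"
proof -
  obtain V' h where h: "V' \<in> Obj C" "h \<in> hom_maps k V V'" "szeq (bound \<phi>) U' V'"
    "samepat (fv \<phi>) (g \<circ> \<mu>) (h \<circ> \<mu>')"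
    using lift_hom[OF C p(1,2) g p(3)[unfolded bound.simps] finite_fv p(4-6)] by blast
  have "sat C U' (g \<circ> \<mu>) \<phi> \<longleftrightarrow> sat C V' (h \<circ> \<mu>') \<phi>"
  proof (rule stable_atD[OF assms(1) g(1) h(1,3,4)])
    show "(g \<circ> \<mu>) ` fv \<phi> \<subseteq> U'" using p(5) hom_image[OF g(2)] by auto
    show "(h \<circ> \<mu>') ` fv \<phi> \<subseteq> V'" using p(6) hom_image[OF h(2)] by auto
  qed
  then show ?thesis using h(1,2) by blast
qed

lemma stable_everywhere:
  assumes C: "sets_cat \<U> k C"
  shows "stable_at C \<phi>"
proof (induction \<phi>)
  case (Eq x y)
  show ?case by (simp add: stable_at_def samepat_def)
next
  case (Neg \<phi>)
  then show ?case by (simp add: stable_at_def)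
next
  case (And \<phi> \<psi>)
  show ?case
    unfolding stable_at_def
  proof (intro ballI allI impI)
    fix U V \<mu> and \<mu>' :: "nat \<Rightarrow> 'a"
    assume p: "U \<in> Obj C" "V \<in> Obj C" "szeq (bound (And \<phi> \<psi>)) U V" "samepat (fv (And \<phi> \<psi>)) \<mu> \<mu>'"
      "\<mu> ` fv (And \<phi> \<psi>) \<subseteq> U" "\<mu>' ` fv (And \<phi> \<psi>) \<subseteq> V"
    have "sat C U \<mu> \<phi> \<longleftrightarrow> sat C V \<mu>' \<phi>"
      by (rule stable_atD[OF And.IH(1) p(1,2)]) (use p(3-6) in \<open>auto intro: szeq_mono samepat_mono\<close>)
    moreover have "sat C U \<mu> \<psi> \<longleftrightarrow> sat C V \<mu>' \<psi>"
      by (rule stable_atD[OF And.IH(2) p(1,2)]) (use p(3-6) in \<open>auto intro: szeq_mono samepat_mono\<close>)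
    ultimately show "sat C U \<mu> (And \<phi> \<psi>) \<longleftrightarrow> sat C V \<mu>' (And \<phi> \<psi>)" by simp
  qed
next
  case (Ex x \<phi>)
  show ?case
    unfolding stable_at_def fv.simps sat.simps
  proof (intro ballI allI impI)
    fix U V \<mu> and \<mu>' :: "nat \<Rightarrow> 'a"
    assume p: "U \<in> Obj C" "V \<in> Obj C" "szeq (bound (Ex x \<phi>)) U V" "samepat (fv \<phi> - {x}) \<mu> \<mu>'"
      "\<mu> ` (fv \<phi> - {x}) \<subseteq> U" "\<mu>' ` (fv \<phi> - {x}) \<subseteq> V"
    show "(\<exists>a\<in>U. sat C U (\<mu>(x := a)) \<phi>) \<longleftrightarrow> (\<exists>b\<in>V. sat C V (\<mu>'(x := b)) \<phi>)"
      using stable_element[OF Ex _ p]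
        stable_element[OF Ex _ p(2,1) szeq_sym[OF p(3)] samepat_sym[OF p(4)] p(6,5)] by blast
  qed
next
  case (All x \<phi>)
  show ?case
    unfolding stable_at_def fv.simps sat.simps
  proof (intro ballI allI impI)
    fix U V \<mu> and \<mu>' :: "nat \<Rightarrow> 'a"
    assume "szeq (bound (All x \<phi>)) U V" and q: "U \<in> Obj C" "V \<in> Obj C" "samepat (fv \<phi> - {x}) \<mu> \<mu>'"
      "\<mu> ` (fv \<phi> - {x}) \<subseteq> U" "\<mu>' ` (fv \<phi> - {x}) \<subseteq> V"
    then have s: "szeq (bound (Ex x \<phi>)) U V" by simp
    show "(\<forall>a\<in>U. sat C U (\<mu>(x := a)) \<phi>) \<longleftrightarrow> (\<forall>b\<in>V. sat C V (\<mu>'(x := b)) \<phi>)"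
      using stable_element[OF All _ q(1,2) s q(3-5)]
        stable_element[OF All _ q(2,1) szeq_sym[OF s] samepat_sym[OF q(3)] q(5,4)] by blast
  qed
next
  case (Dia \<phi>)
  have H: "Hom C = hom_maps k" using C by (simp add: sets_cat_def)
  show ?case
    unfolding stable_at_def fv.simps sat.simps H
  proof (intro ballI allI impI)
    fix U V \<mu> and \<mu>' :: "nat \<Rightarrow> 'a"
    assume p: "U \<in> Obj C" "V \<in> Obj C" "szeq (bound (Dia \<phi>)) U V" "samepat (fv \<phi>) \<mu> \<mu>'"
      "\<mu> ` fv \<phi> \<subseteq> U" "\<mu>' ` fv \<phi> \<subseteq> V"
    show "(\<exists>U'\<in>Obj C. \<exists>g\<in>hom_maps k U U'. sat C U' (g \<circ> \<mu>) \<phi>) \<longleftrightarrow>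
        (\<exists>V'\<in>Obj C. \<exists>h\<in>hom_maps k V V'. sat C V' (h \<circ> \<mu>') \<phi>)"
      using stable_successor[OF Dia C _ _ p]
        stable_successor[OF Dia C _ _ p(2,1) szeq_sym[OF p(3)] samepat_sym[OF p(4)] p(6,5)] by meson
  qed
next
  case (Box \<phi>)
  have H: "Hom C = hom_maps k" using C by (simp add: sets_cat_def)
  show ?case
    unfolding stable_at_def fv.simps sat.simps H
  proof (intro ballI allI impI)
    fix U V \<mu> and \<mu>' :: "nat \<Rightarrow> 'a"
    assume "szeq (bound (Box \<phi>)) U V" and q: "U \<in> Obj C" "V \<in> Obj C" "samepat (fv \<phi>) \<mu> \<mu>'"
      "\<mu> ` fv \<phi> \<subseteq> U" "\<mu>' ` fv \<phi> \<subseteq> V"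
    then have s: "szeq (bound (Dia \<phi>)) U V" by simp
    show "(\<forall>U'\<in>Obj C. \<forall>g\<in>hom_maps k U U'. sat C U' (g \<circ> \<mu>) \<phi>) \<longleftrightarrow>
        (\<forall>V'\<in>Obj C. \<forall>h\<in>hom_maps k V V'. sat C V' (h \<circ> \<mu>') \<phi>)"
      using stable_successor[OF Box C _ _ q(1,2) s q(3-5)]
        stable_successor[OF Box C _ _ q(2,1) szeq_sym[OF s] samepat_sym[OF q(3)] q(5,4)] by meson
  qed
qed

lemma stable:
  assumes "sets_cat \<U> k C" "U \<in> Obj C" "V \<in> Obj C" "szeq (bound \<phi>) U V" "samepat (fv \<phi>) \<mu> \<mu>'"
    "\<mu> ` fv \<phi> \<subseteq> U" "\<mu>' ` fv \<phi> \<subseteq> V"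
  shows "sat C U \<mu> \<phi> \<longleftrightarrow> sat C V \<mu>' \<phi>"
  using stable_everywhere[OF assms(1), of \<phi>] assms(2-) unfolding stable_at_def by blast

section \<open>Soundness\<close>

text \<open>The set \<open>B\<close> contains the variables that may occur free in substituted formulas: it is empty for
  sentences and \<open>UNIV\<close> for formulas with parameters.\<close>

definition holds :: "'a setcat \<Rightarrow> 'a set set \<Rightarrow> nat set \<Rightarrow> pm \<Rightarrow> bool" where
  "holds C K B p \<longleftrightarrow> (\<forall>U\<in>K. \<forall>\<sigma> \<mu>. (\<forall>i. fv (\<sigma> i) \<subseteq> B \<and> \<mu> ` fv (\<sigma> i) \<subseteq> U) \<longrightarrow> sat C U \<mu> (inst \<sigma> p))"

lemma holdsD:
  "holds C K B p \<Longrightarrow> U \<in> K \<Longrightarrow> (\<And>i. fv (\<sigma> i) \<subseteq> B) \<Longrightarrow> (\<And>i. \<mu> ` fv (\<sigma> i) \<subseteq> U) \<Longrightarrow> sat C U \<mu> (inst \<sigma> p)"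
  by (simp add: holds_def)

lemma holds_sent: "W \<in> K \<Longrightarrow> holds C K {} p \<Longrightarrow> p \<in> Val_sent C W UNIV"
  by (auto simp: holds_def Val_sent_def)

lemma holds_form: "W \<in> K \<Longrightarrow> holds C K UNIV p \<Longrightarrow> p \<in> Val_form C W UNIV"
  by (auto simp: holds_def Val_form_def)

lemma sentential_validitiesI:
  assumes "T \<subseteq> Val_sent C W UNIV" "Val_sent C W L_eq \<subseteq> T"
  shows "sentential_validities C W T"
proof -
  have "Val_sent C W UNIV \<subseteq> Val_sent C W L" "L_eq \<subseteq> L \<Longrightarrow> Val_sent C W L \<subseteq> Val_sent C W L_eq" for L
    unfolding Val_sent_def by blast+
  then show ?thesis unfolding sentential_validities_def using assms by blast
qed

lemma formulaic_validitiesI: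
  assumes "T \<subseteq> Val_form C W UNIV" "Val_form C W L_eq \<subseteq> T"
  shows "formulaic_validities C W T"
proof -
  have "Val_form C W UNIV \<subseteq> Val_form C W L" "L_eq \<subseteq> L \<Longrightarrow> Val_form C W L \<subseteq> Val_form C W L_eq" for L
    unfolding Val_form_def by blast+
  then show ?thesis unfolding formulaic_validities_def using assms by blast
qed

lemma Val_form_subset_sent: "Val_form C W L \<subseteq> Val_sent C W L"
  by (auto simp: Val_form_def Val_sent_def)

locale sets_category =
  fixes \<U> :: "'a set set" and k :: mor_class and C :: "'a setcat"
  assumes C: "sets_cat \<U> k C"
begin

lemma Hom_eq: "Hom C = hom_maps k"
  using C by (simp add: sets_cat_def)

lemma sat_Box: "sat C U \<mu> (Box \<phi>) \<longleftrightarrow> (\<forall>U'\<in>Obj C. \<forall>g\<in>hom_maps k U U'. sat C U' (g \<circ> \<mu>) \<phi>)"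
  by (simp add: Hom_eq)

lemma sat_Dia: "sat C U \<mu> (Dia \<phi>) \<longleftrightarrow> (\<exists>U'\<in>Obj C. \<exists>g\<in>hom_maps k U U'. sat C U' (g \<circ> \<mu>) \<phi>)"
  by (simp add: Hom_eq)

lemma sat_id: "\<mu> ` fv \<phi> \<subseteq> U \<Longrightarrow> sat C U ((\<lambda>x\<in>U. x) \<circ> \<mu>) \<phi> \<longleftrightarrow> sat C U \<mu> \<phi>"
  by (rule sat_cong) auto

lemma sat_comp: "\<mu> ` fv \<phi> \<subseteq> U \<Longrightarrow> sat C U'' (compose U h g \<circ> \<mu>) \<phi> \<longleftrightarrow> sat C U'' (h \<circ> (g \<circ> \<mu>)) \<phi>"
  by (rule sat_cong) (auto simp: compose_def)

lemma sat_Box_T: "sat C U \<mu> (Box \<phi>) \<Longrightarrow> \<mu> ` fv \<phi> \<subseteq> U \<Longrightarrow> U \<in> Obj C \<Longrightarrow> sat C U \<mu> \<phi>"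
  unfolding sat_Box using id_hom sat_id by blast

lemma sat_Box_4:
  assumes "sat C U \<mu> (Box \<phi>)" "\<mu> ` fv \<phi> \<subseteq> U" "g \<in> hom_maps k U U'"
  shows "sat C U' (g \<circ> \<mu>) (Box \<phi>)"
  unfolding sat_Box
proof (intro ballI)
  fix U'' h assume "U'' \<in> Obj C" "h \<in> hom_maps k U' U''"
  then have "sat C U'' (compose U h g \<circ> \<mu>) \<phi>"
    using assms comp_hom[OF assms(3)] unfolding sat_Box by blast
  then show "sat C U'' (h \<circ> (g \<circ> \<mu>)) \<phi>" using sat_comp[OF assms(2)] by blast
qed

lemma image_fv: "g \<in> hom_maps k U U' \<Longrightarrow> \<mu> ` F \<subseteq> U \<Longrightarrow> (g \<circ> \<mu>) ` F \<subseteq> U'"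
  using hom_image by fastforce

end

locale world_class = sets_category +
  fixes K :: "'a set set" and B :: "nat set"
  assumes K: "K \<subseteq> Obj C"
    and closed: "\<And>U U' g. U \<in> K \<Longrightarrow> U' \<in> Obj C \<Longrightarrow> g \<in> hom_maps k U U' \<Longrightarrow> U' \<in> K"
begin

lemma normal_sound:
  assumes "\<And>p. p \<in> A \<Longrightarrow> holds C K B p"
  shows "p \<in> normal_theory A \<Longrightarrow> holds C K B p"
proof (induction p rule: normal_theory.induct)
  case (taut p)
  have bev: "beval (\<lambda>q. sat C U \<mu> (inst \<sigma> q)) q \<longleftrightarrow> sat C U \<mu> (inst \<sigma> q)" for U \<mu> \<sigma> q
    by (induction q) auto
  have "sat C U \<mu> (inst \<sigma> p)" for U \<mu> \<sigma>
    using taut bev[of U \<mu> \<sigma> p] unfolding tautology_def by blast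
  then show ?case by (simp add: holds_def)
next
  case (mp p q)
  then show ?case by (fastforce simp: holds_def)
next
  case (subst p s)
  show ?case
    unfolding holds_def inst_psubst
  proof (intro ballI allI impI)
    fix U and \<sigma> :: "nat \<Rightarrow> fm" and \<mu> assume "U \<in> K" and \<sigma>: "\<forall>i. fv (\<sigma> i) \<subseteq> B \<and> \<mu> ` fv (\<sigma> i) \<subseteq> U"
    have "\<forall>i. fv (inst \<sigma> (s i)) \<subseteq> B \<and> \<mu> ` fv (inst \<sigma> (s i)) \<subseteq> U"
      using \<sigma> unfolding fv_inst by blast
    then show "sat C U \<mu> (inst (\<lambda>i. inst \<sigma> (s i)) p)"
      using subst.IH[unfolded holds_def, rule_format, OF \<open>U \<in> K\<close>, of "\<lambda>i. inst \<sigma> (s i)"] by blast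
  qed
next
  case (nec p)
  show ?case
    unfolding holds_def inst.simps sat_Box
  proof (intro ballI allI impI)
    fix U and \<sigma> :: "nat \<Rightarrow> fm" and \<mu> U' g assume *: "U \<in> K" "\<forall>i. fv (\<sigma> i) \<subseteq> B \<and> \<mu> ` fv (\<sigma> i) \<subseteq> U" "U' \<in> Obj C"
      "g \<in> hom_maps k U U'"
    show "sat C U' (g \<circ> \<mu>) (inst \<sigma> p)"
    proof (rule holdsD[OF nec.IH closed[OF *(1,3,4)]])
      show "fv (\<sigma> i) \<subseteq> B" for i using *(2) by blast
      show "(g \<circ> \<mu>) ` fv (\<sigma> i) \<subseteq> U'" for i by (rule image_fv[OF *(4)]) (use *(2) in blast)
    qed
  qed
qed (use assms in \<open>auto simp: holds_def ax_K_def ax_Dual_def\<close>)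

lemma holds_T: "holds C K B ax_T"
  unfolding holds_def
proof (intro ballI allI impI)
  fix U and \<sigma> :: "nat \<Rightarrow> fm" and \<mu> assume *: "U \<in> K" "\<forall>i. fv (\<sigma> i) \<subseteq> B \<and> \<mu> ` fv (\<sigma> i) \<subseteq> U"
  have "sat C U \<mu> (\<sigma> 0)" if "sat C U \<mu> (Box (\<sigma> 0))"
    using sat_Box_T[OF that] * K by blast
  then show "sat C U \<mu> (inst \<sigma> ax_T)"
    by (simp del: sat.simps(7) add: ax_T_def)
qed

lemma holds_4: "holds C K B ax_4"
  unfolding holds_def ax_4_def
proof (intro ballI allI impI)
  fix U and \<sigma> :: "nat \<Rightarrow> fm" and \<mu> assume *: "U \<in> K" "\<forall>i. fv (\<sigma> i) \<subseteq> B \<and> \<mu> ` fv (\<sigma> i) \<subseteq> U"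
  have "sat C U \<mu> (Box (Box (\<sigma> 0)))" if "sat C U \<mu> (Box (\<sigma> 0))"
    unfolding sat_Box[of _ _ "Box (\<sigma> 0)"] using sat_Box_4[OF that] * by blast
  then show "sat C U \<mu> (inst \<sigma> (PImp (PBox p0) (PBox (PBox p0))))"
    by (simp del: sat.simps(7) add: sat.simps(2,3))
qed

text \<open>By \<open>stable\<close>, the two successors need not be brought together in one world; similar
  worlds are enough.\<close>

lemma holds_dot2:
  assumes "\<And>A U \<mu> U1 g1 U2 g2 N. \<lbrakk>finite A; U \<in> K; \<mu> ` A \<subseteq> U; U1 \<in> Obj C; g1 \<in> hom_maps k U U1;
      U2 \<in> Obj C; g2 \<in> hom_maps k U U2\<rbrakk> \<Longrightarrow>
    \<exists>V1\<in>Obj C. \<exists>h1\<in>hom_maps k U1 V1. \<exists>V2\<in>Obj C. \<exists>h2\<in>hom_maps k U2 V2.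
      szeq N V1 V2 \<and> samepat A (h1 \<circ> (g1 \<circ> \<mu>)) (h2 \<circ> (g2 \<circ> \<mu>))"
  shows "holds C K B ax_dot2"
  unfolding holds_def
proof (intro ballI allI impI)
  fix U and \<sigma> :: "nat \<Rightarrow> fm" and \<mu> assume *: "U \<in> K" "\<forall>i. fv (\<sigma> i) \<subseteq> B \<and> \<mu> ` fv (\<sigma> i) \<subseteq> U"
  have "sat C U \<mu> (Box (Dia (\<sigma> 0)))" if d: "sat C U \<mu> (Dia (Box (\<sigma> 0)))"
  proof -
    obtain U1 g1 where 1: "U1 \<in> Obj C" "g1 \<in> hom_maps k U U1" "sat C U1 (g1 \<circ> \<mu>) (Box (\<sigma> 0))"
      using d unfolding sat_Dia[of _ _ "Box (\<sigma> 0)"] by blast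
    have mu: "\<mu> ` fv (\<sigma> 0) \<subseteq> U" using * by blast
    show ?thesis
      unfolding sat_Box[of _ _ "Dia (\<sigma> 0)"]
    proof (intro ballI)
      fix U2 g2 assume 2: "U2 \<in> Obj C" "g2 \<in> hom_maps k U U2"
      obtain V1 h1 V2 h2 where V: "V1 \<in> Obj C" "h1 \<in> hom_maps k U1 V1" "V2 \<in> Obj C" "h2 \<in> hom_maps k U2 V2"
        "szeq (bound (\<sigma> 0)) V1 V2" "samepat (fv (\<sigma> 0)) (h1 \<circ> (g1 \<circ> \<mu>)) (h2 \<circ> (g2 \<circ> \<mu>))"
        using assms[OF finite_fv *(1) mu 1(1,2) 2] by blast
      have "sat C V1 (h1 \<circ> (g1 \<circ> \<mu>)) (\<sigma> 0)" using 1(3) V unfolding sat_Box by blast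
      then have "sat C V2 (h2 \<circ> (g2 \<circ> \<mu>)) (\<sigma> 0)"
        using stable[OF C V(1,3,5,6) image_fv[OF V(2) image_fv[OF 1(2) mu]]
            image_fv[OF V(4) image_fv[OF 2(2) mu]]] by blast
      then show "sat C U2 (g2 \<circ> \<mu>) (Dia (\<sigma> 0))" unfolding sat_Dia using V by blast
    qed
  qed
  then show "sat C U \<mu> (inst \<sigma> ax_dot2)"
    by (simp del: sat.simps(6,7) add: ax_dot2_def)
qed

lemma holds_dot3:
  assumes "\<And>A U \<mu> U1 g1 U2 g2 N. \<lbrakk>finite A; A \<subseteq> B; U \<in> K; \<mu> ` A \<subseteq> U; U1 \<in> Obj C; g1 \<in> hom_maps k U U1;
      U2 \<in> Obj C; g2 \<in> hom_maps k U U2; infinite U2 \<or> finite U1 \<and> finite U2 \<and> card U1 \<le> card U2\<rbrakk> \<Longrightarrow>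
    (\<exists>V\<in>Obj C. \<exists>h\<in>hom_maps k U1 V. szeq N V U2 \<and> samepat A (h \<circ> (g1 \<circ> \<mu>)) (g2 \<circ> \<mu>)) \<or>
    (\<exists>V\<in>Obj C. \<exists>h\<in>hom_maps k U2 V. szeq N V U1 \<and> samepat A (h \<circ> (g2 \<circ> \<mu>)) (g1 \<circ> \<mu>))"
  shows "holds C K B ax_dot3"
  unfolding holds_def
proof (intro ballI allI impI, rule ccontr)
  fix U and \<sigma> :: "nat \<Rightarrow> fm" and \<mu> assume *: "U \<in> K" "\<forall>i. fv (\<sigma> i) \<subseteq> B \<and> \<mu> ` fv (\<sigma> i) \<subseteq> U"
    and "\<not> sat C U \<mu> (inst \<sigma> ax_dot3)"
  then have "\<not> sat C U \<mu> (Box (inst \<sigma> (PImp (PBox p0) q0)))" "\<not> sat C U \<mu> (Box (inst \<sigma> (PImp (PBox q0) p0)))"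
    by (simp_all del: sat.simps(7) add: ax_dot3_def)
  then obtain U1 g1 U2 g2 where 1: "U1 \<in> Obj C" "g1 \<in> hom_maps k U U1" and 2: "U2 \<in> Obj C" "g2 \<in> hom_maps k U U2"
    and s: "\<not> sat C U1 (g1 \<circ> \<mu>) (inst \<sigma> (PImp (PBox p0) q0))"
      "\<not> sat C U2 (g2 \<circ> \<mu>) (inst \<sigma> (PImp (PBox q0) p0))"
    unfolding sat_Box by blast
  from s have s: "sat C U1 (g1 \<circ> \<mu>) (Box (\<sigma> 0))" "\<not> sat C U1 (g1 \<circ> \<mu>) (\<sigma> 1)"
    "sat C U2 (g2 \<circ> \<mu>) (Box (\<sigma> 1))" "\<not> sat C U2 (g2 \<circ> \<mu>) (\<sigma> 0)"
    by (simp_all del: sat.simps(7))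
  let ?A = "fv (\<sigma> 0) \<union> fv (\<sigma> 1)" and ?N = "max (bound (\<sigma> 0)) (bound (\<sigma> 1))"
  have A: "finite ?A" "?A \<subseteq> B" "\<mu> ` ?A \<subseteq> U" using * by auto
  have key: False if V: "V \<in> Obj C" "h \<in> hom_maps k U1 V" "szeq ?N V U2" "samepat ?A (h \<circ> (g1 \<circ> \<mu>)) (g2 \<circ> \<mu>)"
    and 1: "U1 \<in> Obj C" "g1 \<in> hom_maps k U U1" and 2: "U2 \<in> Obj C" "g2 \<in> hom_maps k U U2"
    and s: "sat C U1 (g1 \<circ> \<mu>) (Box (\<sigma> j))" "\<not> sat C U2 (g2 \<circ> \<mu>) (\<sigma> j)" and j: "j = 0 \<or> j = 1"
    for V h U1 g1 U2 g2 and j :: nat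
  proof -
    have mu: "\<mu> ` fv (\<sigma> j) \<subseteq> U" using * by blast
    have sz: "szeq (bound (\<sigma> j)) V U2" by (rule szeq_mono[OF V(3)]) (use j in auto)
    have pt: "samepat (fv (\<sigma> j)) (h \<circ> (g1 \<circ> \<mu>)) (g2 \<circ> \<mu>)" by (rule samepat_mono[OF V(4)]) (use j in auto)
    have "sat C V (h \<circ> (g1 \<circ> \<mu>)) (\<sigma> j)" using s V unfolding sat_Box by blast
    then show False
      using stable[OF C V(1) 2(1) sz pt image_fv[OF V(2) image_fv[OF 1(2) mu]] image_fv[OF 2(2) mu]] s by blast
  qed
  have "infinite U2 \<or> finite U1 \<and> finite U2 \<and> card U1 \<le> card U2 \<or>
    infinite U1 \<or> finite U2 \<and> finite U1 \<and> card U2 \<le> card U1" by linarith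
  then have "(\<exists>V\<in>Obj C. \<exists>h\<in>hom_maps k U1 V. szeq ?N V U2 \<and> samepat ?A (h \<circ> (g1 \<circ> \<mu>)) (g2 \<circ> \<mu>)) \<or>
    (\<exists>V\<in>Obj C. \<exists>h\<in>hom_maps k U2 V. szeq ?N V U1 \<and> samepat ?A (h \<circ> (g2 \<circ> \<mu>)) (g1 \<circ> \<mu>))"
    using assms[OF A(1,2) *(1) A(3) 1 2, of ?N] assms[OF A(1,2) *(1) A(3) 2 1, of ?N] by blast
  then show False
    using key[OF _ _ _ _ 1 2 s(1,4)] key[OF _ _ _ _ 2 1 s(3,2)] by blast
qed

text \<open>If the premise of Grz holds where \<open>\<phi>\<close> fails, then \<open>\<phi>\<close> becomes true and then false again at worlds
  further on, where the premise still holds. Each such round lowers the rank.\<close>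

lemma holds_Grz:
  assumes rk: "\<And>\<phi>. fv \<phi> \<subseteq> B \<Longrightarrow> \<exists>rk :: 'a set \<Rightarrow> (nat \<Rightarrow> 'a) \<Rightarrow> nat. \<forall>U\<in>K. \<forall>\<mu>. \<mu> ` fv \<phi> \<subseteq> U \<longrightarrow>
    (\<forall>U'\<in>Obj C. \<forall>g\<in>hom_maps k U U'. rk U' (g \<circ> \<mu>) \<le> rk U \<mu> \<and>
      (rk U' (g \<circ> \<mu>) = rk U \<mu> \<longrightarrow> (sat C U' (g \<circ> \<mu>) \<phi> \<longleftrightarrow> sat C U \<mu> \<phi>)))"
  shows "holds C K B ax_Grz"
  unfolding holds_def
proof (intro ballI allI impI)
  fix U and \<sigma> :: "nat \<Rightarrow> fm" and \<mu> assume *: "U \<in> K" "\<forall>i. fv (\<sigma> i) \<subseteq> B \<and> \<mu> ` fv (\<sigma> i) \<subseteq> U"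
  define \<phi> where "\<phi> = \<sigma> 0"
  define I where "I = inst \<sigma> (PImp p0 (PBox p0))"
  define J where "J = inst \<sigma> (PImp (PBox (PImp p0 (PBox p0))) p0)"
  obtain rk :: "'a set \<Rightarrow> (nat \<Rightarrow> 'a) \<Rightarrow> nat" where
    rk: "\<And>U \<mu> U' g. \<lbrakk>U \<in> K; \<mu> ` fv \<phi> \<subseteq> U; U' \<in> Obj C; g \<in> hom_maps k U U'\<rbrakk> \<Longrightarrow>
      rk U' (g \<circ> \<mu>) \<le> rk U \<mu> \<and> (rk U' (g \<circ> \<mu>) = rk U \<mu> \<longrightarrow> (sat C U' (g \<circ> \<mu>) \<phi> \<longleftrightarrow> sat C U \<mu> \<phi>))"
  proof -
    have "fv \<phi> \<subseteq> B" using * unfolding \<phi>_def by blast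
    from rk[OF this] obtain rk :: "'a set \<Rightarrow> (nat \<Rightarrow> 'a) \<Rightarrow> nat" where
      "\<forall>U\<in>K. \<forall>\<mu>. \<mu> ` fv \<phi> \<subseteq> U \<longrightarrow> (\<forall>U'\<in>Obj C. \<forall>g\<in>hom_maps k U U'. rk U' (g \<circ> \<mu>) \<le> rk U \<mu> \<and>
        (rk U' (g \<circ> \<mu>) = rk U \<mu> \<longrightarrow> (sat C U' (g \<circ> \<mu>) \<phi> \<longleftrightarrow> sat C U \<mu> \<phi>)))" by (rule exE)
    then show thesis by (intro that[of rk]) blast
  qed
  have fvs: "fv I = fv \<phi>" "fv J = fv \<phi>" by (simp_all add: I_def J_def \<phi>_def)
  have "sat C U \<mu> \<phi>" if "U \<in> K" "\<mu> ` fv \<phi> \<subseteq> U" "sat C U \<mu> (Box J)" for U \<mu>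
    using that
  proof (induction "rk U \<mu>" arbitrary: U \<mu> rule: less_induct)
    case less
    show ?case
    proof (rule ccontr)
      assume np: "\<not> sat C U \<mu> \<phi>"
      have "sat C U \<mu> J" using sat_Box_T[OF less.prems(3)] less.prems K fvs by blast
      then have "\<not> sat C U \<mu> (Box I)"
        using np unfolding J_def I_def by (simp del: sat.simps(7) add: \<phi>_def)
      then obtain U1 g1 where 1: "U1 \<in> Obj C" "g1 \<in> hom_maps k U U1" "\<not> sat C U1 (g1 \<circ> \<mu>) I"
        unfolding sat_Box by blast
      then have p1: "sat C U1 (g1 \<circ> \<mu>) \<phi>" "\<not> sat C U1 (g1 \<circ> \<mu>) (Box \<phi>)"
        unfolding I_def by (simp_all del: sat.simps(7) add: \<phi>_def)
      then obtain U2 g2 where 2: "U2 \<in> Obj C" "g2 \<in> hom_maps k U1 U2" "\<not> sat C U2 (g2 \<circ> (g1 \<circ> \<mu>)) \<phi>"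
        unfolding sat_Box by blast
      have U1: "U1 \<in> K" using closed less.prems 1 by blast
      have U2: "U2 \<in> K" using closed U1 2 by blast
      have m1: "(g1 \<circ> \<mu>) ` fv \<phi> \<subseteq> U1" by (rule image_fv[OF 1(2) less.prems(2)])
      have m2: "(g2 \<circ> (g1 \<circ> \<mu>)) ` fv \<phi> \<subseteq> U2" by (rule image_fv[OF 2(2) m1])
      have "sat C U1 (g1 \<circ> \<mu>) (Box J)"
        by (rule sat_Box_4[OF less.prems(3) _ 1(2)]) (use less.prems fvs in simp)
      then have "sat C U2 (g2 \<circ> (g1 \<circ> \<mu>)) (Box J)"
        by (rule sat_Box_4[OF _ _ 2(2)]) (use m1 fvs in simp)
      moreover have "rk U2 (g2 \<circ> (g1 \<circ> \<mu>)) < rk U \<mu>"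
        using rk[OF less.prems(1,2) 1(1,2)] rk[OF U1 m1 2(1,2)] p1(1) 2(3) by linarith
      ultimately show False using less.hyps U2 m2 2(3) by blast
    qed
  qed
  then have "sat C U \<mu> (Box J) \<longrightarrow> sat C U \<mu> \<phi>" using * \<phi>_def by blast
  then show "sat C U \<mu> (inst \<sigma> ax_Grz)"
    unfolding J_def \<phi>_def by (simp del: sat.simps(7) add: ax_Grz_def)
qed

lemma holds_Triv:
  assumes "\<And>\<phi> U \<mu> U' g. \<lbrakk>fv \<phi> \<subseteq> B; U \<in> K; \<mu> ` fv \<phi> \<subseteq> U; U' \<in> Obj C; g \<in> hom_maps k U U'\<rbrakk> \<Longrightarrow>
    sat C U' (g \<circ> \<mu>) \<phi> \<longleftrightarrow> sat C U \<mu> \<phi>"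
    and "p \<in> Triv"
  shows "holds C K B p"
proof -
  have "holds C K B ax_Triv"
    unfolding holds_def
  proof (intro ballI allI impI)
    fix U and \<sigma> :: "nat \<Rightarrow> fm" and \<mu> assume *: "U \<in> K" "\<forall>i. fv (\<sigma> i) \<subseteq> B \<and> \<mu> ` fv (\<sigma> i) \<subseteq> U"
    have "sat C U \<mu> (Box (\<sigma> 0)) \<longleftrightarrow> sat C U \<mu> (\<sigma> 0)"
      using assms(1)[OF _ *(1), of "\<sigma> 0" \<mu>] sat_Box_T[of U \<mu> "\<sigma> 0"] * K unfolding sat_Box by blast
    then show "sat C U \<mu> (inst \<sigma> ax_Triv)"
      by (simp del: sat.simps(7) add: ax_Triv_def)
  qed
  then show ?thesis
    using normal_sound[of "{ax_Triv, ax_4}" p] holds_4 assms(2) unfolding Triv_def by blast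
qed

end

subsection \<open>Rank functions for Grz\<close>

definition trunc :: "nat \<Rightarrow> 'a set \<Rightarrow> nat" where
  "trunc N U = (if large N U then N else card U)"

lemma trunc_eq: "trunc N U = trunc N V \<Longrightarrow> szeq N U V"
  by (auto simp: trunc_def szeq_def large_def split: if_splits)

lemma trunc_le: "trunc N U \<le> N"
  by (auto simp: trunc_def large_def)

lemma trunc_surj: "g ` U = V \<Longrightarrow> trunc N V \<le> trunc N U"
  using card_image_le[of U g] finite_imageI[of U g] by (auto simp: trunc_def large_def)

lemma trunc_inj: "inj_on g U \<Longrightarrow> g ` U \<subseteq> V \<Longrightarrow> trunc N U \<le> trunc N V"
  using card_inj_on_le[of g U V] inj_on_finite[of g U V] by (auto simp: trunc_def large_def)

text \<open>Quotients identify parameters and shrink the world, extensions enlarge it. Either way the changes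
  that the formula can notice are bounded.\<close>

context world_class
begin

lemma holds_Grz_quotient:
  assumes "k = Surj \<or> k = Func \<and> (\<forall>U\<in>K. infinite U)"
  shows "holds C K B ax_Grz"
proof (rule holds_Grz)
  fix \<phi>
  let ?rk = "\<lambda>U \<mu>. card (\<mu> ` fv \<phi>) + trunc (bound \<phi>) U"
  have "?rk U' (g \<circ> \<mu>) \<le> ?rk U \<mu> \<and> (?rk U' (g \<circ> \<mu>) = ?rk U \<mu> \<longrightarrow> (sat C U' (g \<circ> \<mu>) \<phi> \<longleftrightarrow> sat C U \<mu> \<phi>))"
    if *: "U \<in> K" "\<mu> ` fv \<phi> \<subseteq> U" "U' \<in> Obj C" "g \<in> hom_maps k U U'" for U \<mu> U' g
  proof -
    have tr: "trunc (bound \<phi>) U' \<le> trunc (bound \<phi>) U"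
    proof (cases "k = Surj")
      case True then show ?thesis using *(4) by (auto intro: trunc_surj)
    next
      case False
      then have "infinite U" using assms *(1) by blast
      then show ?thesis using trunc_le by (auto simp: trunc_def large_def)
    qed
    have im: "(g \<circ> \<mu>) ` fv \<phi> = g ` \<mu> ` fv \<phi>" by auto
    have ca: "card ((g \<circ> \<mu>) ` fv \<phi>) \<le> card (\<mu> ` fv \<phi>)" unfolding im by (rule card_image_le) simp
    have "sat C U' (g \<circ> \<mu>) \<phi> \<longleftrightarrow> sat C U \<mu> \<phi>" if "?rk U' (g \<circ> \<mu>) = ?rk U \<mu>"
    proof (rule stable[OF C *(3)])
      have e: "trunc (bound \<phi>) U' = trunc (bound \<phi>) U" "card (g ` \<mu> ` fv \<phi>) = card (\<mu> ` fv \<phi>)"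
        using that tr ca unfolding im by linarith+
      show "szeq (bound \<phi>) U' U" by (rule trunc_eq[OF e(1)])
      have "inj_on g (\<mu> ` fv \<phi>)" using e(2) by (simp add: inj_on_iff_eq_card)
      then show "samepat (fv \<phi>) (g \<circ> \<mu>) \<mu>" by (auto simp: samepat_def inj_on_def)
      show "U \<in> Obj C" using *(1) K by blast
      show "(g \<circ> \<mu>) ` fv \<phi> \<subseteq> U'" by (rule image_fv[OF *(4,2)])
    qed fact
    then show ?thesis using tr ca by (simp add: add_mono)
  qed
  then show "\<exists>rk :: 'a set \<Rightarrow> (nat \<Rightarrow> 'a) \<Rightarrow> nat. \<forall>U\<in>K. \<forall>\<mu>. \<mu> ` fv \<phi> \<subseteq> U \<longrightarrow>
    (\<forall>U'\<in>Obj C. \<forall>g\<in>hom_maps k U U'. rk U' (g \<circ> \<mu>) \<le> rk U \<mu> \<and>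
      (rk U' (g \<circ> \<mu>) = rk U \<mu> \<longrightarrow> (sat C U' (g \<circ> \<mu>) \<phi> \<longleftrightarrow> sat C U \<mu> \<phi>)))"
    by (intro exI[of _ ?rk]) blast
qed

lemma holds_Grz_extension:
  assumes "k \<notin> {Func, Surj}"
  shows "holds C K B ax_Grz"
proof (rule holds_Grz)
  fix \<phi>
  let ?rk = "\<lambda>U (\<mu> :: nat \<Rightarrow> 'a). bound \<phi> - trunc (bound \<phi>) U"
  have "?rk U' (g \<circ> \<mu>) \<le> ?rk U \<mu> \<and> (?rk U' (g \<circ> \<mu>) = ?rk U \<mu> \<longrightarrow> (sat C U' (g \<circ> \<mu>) \<phi> \<longleftrightarrow> sat C U \<mu> \<phi>))"
    if *: "U \<in> K" "\<mu> ` fv \<phi> \<subseteq> U" "U' \<in> Obj C" "g \<in> hom_maps k U U'" for U \<mu> U' g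
  proof -
    have inj: "inj_on g U" by (rule inj_hom[OF *(4) assms])
    have tr: "trunc (bound \<phi>) U \<le> trunc (bound \<phi>) U'"
      by (rule trunc_inj[OF inj]) (use hom_image[OF *(4)] in blast)
    have "sat C U' (g \<circ> \<mu>) \<phi> \<longleftrightarrow> sat C U \<mu> \<phi>" if "?rk U' (g \<circ> \<mu>) = ?rk U \<mu>"
    proof (rule stable[OF C *(3)])
      have "trunc (bound \<phi>) U' = trunc (bound \<phi>) U"
        using that tr trunc_le[of "bound \<phi>" U] trunc_le[of "bound \<phi>" U'] by linarith
      then show "szeq (bound \<phi>) U' U" by (rule trunc_eq)
      show "samepat (fv \<phi>) (g \<circ> \<mu>) \<mu>" using inj *(2) by (auto simp: samepat_def inj_on_def)
      show "U \<in> Obj C" using *(1) K by blast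
      show "(g \<circ> \<mu>) ` fv \<phi> \<subseteq> U'" by (rule image_fv[OF *(4,2)])
    qed fact
    then show ?thesis using tr by simp
  qed
  then show "\<exists>rk :: 'a set \<Rightarrow> (nat \<Rightarrow> 'a) \<Rightarrow> nat. \<forall>U\<in>K. \<forall>\<mu>. \<mu> ` fv \<phi> \<subseteq> U \<longrightarrow>
    (\<forall>U'\<in>Obj C. \<forall>g\<in>hom_maps k U U'. rk U' (g \<circ> \<mu>) \<le> rk U \<mu> \<and>
      (rk U' (g \<circ> \<mu>) = rk U \<mu> \<longrightarrow> (sat C U' (g \<circ> \<mu>) \<phi> \<longleftrightarrow> sat C U \<mu> \<phi>)))"
    by (intro exI[of _ ?rk]) blast
qed

end

section \<open>Soundness in the categories of sets\<close>

lemma sets_cat_Sets: "set_universe \<U> \<Longrightarrow> sets_cat \<U> k (Sets \<U> k)"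
  by (simp add: sets_cat_def Sets_def)

lemma sets_cat_InfSets: "set_universe \<U> \<Longrightarrow> sets_cat \<U> k (InfSets \<U> k)"
  by (simp add: sets_cat_def InfSets_def)

lemma Obj_Sets [simp]: "Obj (Sets \<U> k) = \<U>" and Hom_Sets [simp]: "Hom (Sets \<U> k) = hom_maps k"
  by (simp_all add: Sets_def)

lemma Obj_FinSets [simp]: "Obj (FinSets \<U> k) = {W \<in> \<U>. finite W}"
  and Hom_FinSets [simp]: "Hom (FinSets \<U> k) = hom_maps k"
  by (simp_all add: FinSets_def)

lemma Obj_InfSets [simp]: "Obj (InfSets \<U> k) = {W \<in> \<U>. infinite W}"
  and Hom_InfSets [simp]: "Hom (InfSets \<U> k) = hom_maps k"
  by (simp_all add: InfSets_def)

subsection \<open>Trivial validities\<close>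

text \<open>These morphisms preserve the equality pattern. Bijections preserve the size as well, and an injection
  out of an infinite world leads to an infinite world.\<close>

lemma Triv_rigid:
  assumes C: "sets_cat \<U> k C" and W: "W \<in> Obj C"
    and k: "k \<in> {Bij, Ident} \<or> k \<in> {Inj, Incl} \<and> infinite W"
  shows "Triv \<subseteq> Val_form C W UNIV"
proof -
  let ?K = "{U \<in> Obj C. k \<in> {Bij, Ident} \<or> infinite U}"
  have inf: "infinite U'" if "infinite U" "g \<in> hom_maps k U U'" for U U' :: "'a set" and g
  proof -
    have "inj_on g U" by (rule inj_hom[OF that(2)]) (use k in auto)
    then show ?thesis using that inj_on_finite[of g U U'] hom_image[OF that(2)] by blast
  qed
  interpret world_class \<U> k C ?K UNIV
    by standard (use C inf in auto)
  have "holds C ?K UNIV p" if "p \<in> Triv" for p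
  proof (rule holds_Triv[OF _ that])
    fix \<phi> U \<mu> U' g assume *: "U \<in> ?K" "\<mu> ` fv \<phi> \<subseteq> U" "U' \<in> Obj C" "g \<in> hom_maps k U U'"
    have inj: "inj_on g U" by (rule inj_hom[OF *(4)]) (use k in auto)
    show "sat C U' (g \<circ> \<mu>) \<phi> \<longleftrightarrow> sat C U \<mu> \<phi>"
    proof (rule stable[OF C *(3)])
      show "szeq (bound \<phi>) U' U"
      proof (cases "infinite U")
        case True
        then show ?thesis using inf[OF True *(4)] by (intro szeq_infinite) auto
      next
        case False
        then have "bij_betw g U U'"
          using *(1,4) by (auto simp: bij_betw_def inj_on_def)
        then show ?thesis
          using False bij_betw_same_card[of g U U'] bij_betw_finite[of g U U'] by (auto simp: szeq_def)
      qed
      show "samepat (fv \<phi>) (g \<circ> \<mu>) \<mu>" using inj *(2) by (auto simp: samepat_def inj_on_def)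
      show "U \<in> Obj C" "(g \<circ> \<mu>) ` fv \<phi> \<subseteq> U'" using * image_fv[OF *(4,2)] by auto
    qed fact
  qed
  then show ?thesis using holds_form[of W ?K] W k by blast
qed

lemma Triv_InfSets:
  assumes "set_universe \<U>" "W \<in> Obj (InfSets \<U> k)"
  shows "Triv \<subseteq> Val_sent (InfSets \<U> k) W UNIV"
proof -
  interpret world_class \<U> k "InfSets \<U> k" "Obj (InfSets \<U> k)" "{}"
    by standard (use sets_cat_InfSets[OF assms(1)] in auto)
  have "holds (InfSets \<U> k) (Obj (InfSets \<U> k)) {} p" if "p \<in> Triv" for p
  proof (rule holds_Triv[OF _ that])
    fix \<phi> U \<mu> U' and g :: "'a \<Rightarrow> 'a" assume *: "fv \<phi> \<subseteq> {}" "U \<in> Obj (InfSets \<U> k)" "U' \<in> Obj (InfSets \<U> k)"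
    show "sat (InfSets \<U> k) U' (g \<circ> \<mu>) \<phi> \<longleftrightarrow> sat (InfSets \<U> k) U \<mu> \<phi>"
      by (rule stable[OF C *(3,2)]) (use * in \<open>auto simp: samepat_def intro: szeq_infinite\<close>)
  qed
  then show ?thesis using holds_sent assms(2) by blast
qed

lemma Triv_Surj_empty:
  assumes "set_universe \<U>"
  shows "Triv \<subseteq> Val_form (Sets \<U> Surj) {} UNIV"
proof -
  have e: "{} \<in> \<U>" using universe_finite[OF assms] by simp
  interpret world_class \<U> Surj "Sets \<U> Surj" "{{}}" UNIV
    by standard (use sets_cat_Sets[OF assms] e in auto)
  have "holds (Sets \<U> Surj) {{}} UNIV p" if "p \<in> Triv" for p
  proof (rule holds_Triv[OF _ that])
    fix \<phi> U \<mu> U' and g :: "'a \<Rightarrow> 'a" assume *: "U \<in> {{}}" "\<mu> ` fv \<phi> \<subseteq> U" "g \<in> hom_maps Surj U U'"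
    then have "U' = U" by auto
    moreover have "fv \<phi> = {}" using *(1,2) by auto
    ultimately show "sat (Sets \<U> Surj) U' (g \<circ> \<mu>) \<phi> \<longleftrightarrow> sat (Sets \<U> Surj) U \<mu> \<phi>"
      by (simp only:) (rule sat_cong, simp)
  qed
  then show ?thesis using holds_form by blast
qed

subsection \<open>Functions\<close>

lemma const_hom:
  assumes "W \<noteq> {}" "k \<in> {Func, Surj}"
  shows "(\<lambda>x\<in>W. c) \<in> hom_maps k W {c}"
  using assms by auto

text \<open>Any two nonempty worlds have maps onto the same singleton.\<close>

lemma dot2_terminal:
  assumes "set_universe \<U>" "k \<in> {Func, Surj}"
  shows "world_class \<U> k (Sets \<U> k) (\<U> - {{}})" "holds (Sets \<U> k) (\<U> - {{}}) UNIV ax_dot2"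
proof -
  have ne: "U' \<noteq> {}" if "g \<in> hom_maps k U U'" "U \<noteq> {}" for U U' :: "'a set" and g
    using that hom_image by fastforce
  show wc: "world_class \<U> k (Sets \<U> k) (\<U> - {{}})"
    by standard (use sets_cat_Sets[OF assms(1)] ne in auto)
  then interpret world_class \<U> k "Sets \<U> k" "\<U> - {{}}" UNIV .
  show "holds (Sets \<U> k) (\<U> - {{}}) UNIV ax_dot2"
  proof (rule holds_dot2)
    fix A :: "nat set" and U U1 U2 and \<mu> :: "nat \<Rightarrow> 'a" and g1 g2 N
    assume *: "U \<in> \<U> - {{}}" "\<mu> ` A \<subseteq> U" "g1 \<in> hom_maps k U U1" "g2 \<in> hom_maps k U U2"
    obtain c :: 'a where True by simp
    have "{c} \<in> \<U>" using universe_finite[OF assms(1)] by simp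
    moreover have "U1 \<noteq> {}" "U2 \<noteq> {}" using ne *(1,3,4) by auto
    then have "(\<lambda>x\<in>U1. c) \<in> hom_maps k U1 {c}" "(\<lambda>x\<in>U2. c) \<in> hom_maps k U2 {c}"
      using const_hom[OF \<open>U1 \<noteq> {}\<close> assms(2)] const_hom[OF \<open>U2 \<noteq> {}\<close> assms(2)] by blast+
    moreover have "samepat A ((\<lambda>x\<in>U1. c) \<circ> (g1 \<circ> \<mu>)) ((\<lambda>x\<in>U2. c) \<circ> (g2 \<circ> \<mu>))"
      using hom_image[OF *(3)] hom_image[OF *(4)] *(2) by (simp add: samepat_def image_subset_iff)
    ultimately show "\<exists>V1\<in>Obj (Sets \<U> k). \<exists>h1\<in>hom_maps k U1 V1. \<exists>V2\<in>Obj (Sets \<U> k). \<exists>h2\<in>hom_maps k U2 V2.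
        szeq N V1 V2 \<and> samepat A (h1 \<circ> (g1 \<circ> \<mu>)) (h2 \<circ> (g2 \<circ> \<mu>))"
      unfolding Obj_Sets using szeq_refl by blast
  qed
qed

lemma S4_2_sound:
  assumes "set_universe \<U>" "W \<in> \<U>" "W \<noteq> {}"
  shows "S4_2 \<subseteq> Val_form (Sets \<U> Func) W UNIV"
proof -
  interpret world_class \<U> Func "Sets \<U> Func" "\<U> - {{}}" UNIV
    by (rule dot2_terminal(1)[OF assms(1)]) simp
  have "holds (Sets \<U> Func) (\<U> - {{}}) UNIV ax_dot2" by (rule dot2_terminal(2)[OF assms(1)]) simp
  then have ax: "holds (Sets \<U> Func) (\<U> - {{}}) UNIV q" if "q \<in> {ax_T, ax_4, ax_dot2}" for q
    using that holds_T holds_4 by blast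
  have "holds (Sets \<U> Func) (\<U> - {{}}) UNIV p" if "p \<in> S4_2" for p
    by (rule normal_sound[OF ax that[unfolded S4_2_def]])
  moreover have "W \<in> \<U> - {{}}" using assms by blast
  ultimately show ?thesis using holds_form[of W "\<U> - {{}}"] by blast
qed

lemma S5_sound:
  assumes "set_universe \<U>" "W \<in> \<U>" "W \<noteq> {}"
  shows "S5 \<subseteq> Val_sent (Sets \<U> Func) W UNIV"
proof -
  interpret world_class \<U> Func "Sets \<U> Func" "\<U> - {{}}" "{}"
    by (rule dot2_terminal(1)[OF assms(1)]) simp
  have "holds (Sets \<U> Func) (\<U> - {{}}) {} ax_5"
    unfolding holds_def
  proof (intro ballI allI impI)
    fix U and \<sigma> :: "nat \<Rightarrow> fm" and \<mu> assume *: "U \<in> \<U> - {{}}" "\<forall>i. fv (\<sigma> i) \<subseteq> {} \<and> \<mu> ` fv (\<sigma> i) \<subseteq> U"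
    have "sat (Sets \<U> Func) U \<mu> (\<sigma> 0)" if "sat (Sets \<U> Func) U \<mu> (Dia (Box (\<sigma> 0)))"
    proof -
      obtain U' g where "U' \<in> \<U>" "sat (Sets \<U> Func) U' (g \<circ> \<mu>) (Box (\<sigma> 0))"
        using \<open>sat (Sets \<U> Func) U \<mu> (Dia (Box (\<sigma> 0)))\<close> unfolding sat_Dia[of _ _ "Box (\<sigma> 0)"] by auto
      moreover obtain u where "u \<in> U" using * by auto
      then have "(\<lambda>x\<in>U'. u) \<in> hom_maps Func U' U" by auto
      ultimately have "sat (Sets \<U> Func) U ((\<lambda>x\<in>U'. u) \<circ> (g \<circ> \<mu>)) (\<sigma> 0)"
        using * unfolding sat_Box by auto
      moreover have "fv (\<sigma> 0) = {}" using * by blast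
      ultimately show ?thesis using sat_cong[of "\<sigma> 0" "(\<lambda>x\<in>U'. u) \<circ> (g \<circ> \<mu>)" \<mu>] by blast
    qed
    then show "sat (Sets \<U> Func) U \<mu> (inst \<sigma> ax_5)"
      by (simp del: sat.simps(6,7) add: ax_5_def)
  qed
  then have ax: "holds (Sets \<U> Func) (\<U> - {{}}) {} q" if "q \<in> {ax_T, ax_4, ax_5}" for q
    using that holds_T holds_4 by blast
  have "holds (Sets \<U> Func) (\<U> - {{}}) {} p" if "p \<in> S5" for p
    by (rule normal_sound[OF ax that[unfolded S5_def]])
  moreover have "W \<in> \<U> - {{}}" using assms by blast
  ultimately show ?thesis using holds_sent[of W "\<U> - {{}}"] by blast
qed

subsection \<open>Surjections\<close>

lemma Grz_2_Surj:
  assumes "set_universe \<U>" "W \<in> \<U>" "W \<noteq> {}"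
  shows "Grz_2 \<subseteq> Val_form (Sets \<U> Surj) W UNIV"
proof -
  interpret world_class \<U> Surj "Sets \<U> Surj" "\<U> - {{}}" UNIV
    by (rule dot2_terminal(1)[OF assms(1)]) simp
  have "holds (Sets \<U> Surj) (\<U> - {{}}) UNIV ax_dot2" by (rule dot2_terminal(2)[OF assms(1)]) simp
  then have ax: "holds (Sets \<U> Surj) (\<U> - {{}}) UNIV q" if "q \<in> {ax_T, ax_4, ax_dot2, ax_Grz}" for q
    using that holds_T holds_4 holds_Grz_quotient by blast
  have "holds (Sets \<U> Surj) (\<U> - {{}}) UNIV p" if "p \<in> Grz_2" for p
    by (rule normal_sound[OF ax that[unfolded Grz_2_def]])
  moreover have "W \<in> \<U> - {{}}" using assms by blast
  ultimately show ?thesis using holds_form[of W "\<U> - {{}}"] by blast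
qed

lemma Grz_2_InfSets:
  assumes "set_universe \<U>" "W \<in> Obj (InfSets \<U> k)" "k \<in> {Func, Surj}"
  shows "Grz_2 \<subseteq> Val_form (InfSets \<U> k) W UNIV"
proof -
  let ?C = "InfSets \<U> k"
  interpret world_class \<U> k ?C "Obj ?C" UNIV
    by standard (use sets_cat_InfSets[OF assms(1)] in auto)
  have col: "\<exists>V\<in>Obj ?C. \<exists>h\<in>hom_maps k U V. samepat A (h \<circ> \<mu>) (\<lambda>_. ())"
    if A: "finite A" "U \<in> Obj ?C" "\<mu> ` A \<subseteq> U" for A U and \<mu> :: "nat \<Rightarrow> 'a"
  proof -
    obtain V h where V: "V \<subseteq> U" "U - \<mu> ` A \<subseteq> V" "h \<in> hom_maps Surj U V" "samepat A (h \<circ> \<mu>) (\<lambda>_. ())"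
      using collapse[OF A(3), of "\<lambda>_. ()"] by blast
    have "infinite (U - \<mu> ` A)" using A by simp
    then have "infinite V" using V(2) finite_subset by blast
    then have "V \<in> Obj ?C" using V(1) A(2) \<open>infinite V\<close> universe_subset[OF assms(1)] by auto
    moreover have "h \<in> hom_maps k U V" using V(3) assms(3) by auto
    ultimately show ?thesis using V by blast
  qed
  have "holds ?C (Obj ?C) UNIV ax_dot2"
  proof (rule holds_dot2)
    fix A :: "nat set" and U U1 U2 and \<mu> :: "nat \<Rightarrow> 'a" and g1 g2 N
    assume *: "finite A" "\<mu> ` A \<subseteq> U" "U1 \<in> Obj ?C" "g1 \<in> hom_maps k U U1" "U2 \<in> Obj ?C" "g2 \<in> hom_maps k U U2"
    obtain V1 h1 where 1: "V1 \<in> Obj ?C" "h1 \<in> hom_maps k U1 V1" "samepat A (h1 \<circ> (g1 \<circ> \<mu>)) (\<lambda>_. ())"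
      using col[OF *(1,3) image_fv[OF *(4,2)]] by blast
    obtain V2 h2 where 2: "V2 \<in> Obj ?C" "h2 \<in> hom_maps k U2 V2" "samepat A (h2 \<circ> (g2 \<circ> \<mu>)) (\<lambda>_. ())"
      using col[OF *(1,5) image_fv[OF *(6,2)]] by blast
    have "szeq N V1 V2" using 1(1) 2(1) unfolding Obj_InfSets by (intro szeq_infinite) auto
    moreover have "samepat A (h1 \<circ> (g1 \<circ> \<mu>)) (h2 \<circ> (g2 \<circ> \<mu>))" using 1(3) 2(3) unfolding samepat_def by blast
    ultimately show "\<exists>V1\<in>Obj ?C. \<exists>h1\<in>hom_maps k U1 V1. \<exists>V2\<in>Obj ?C. \<exists>h2\<in>hom_maps k U2 V2.
        szeq N V1 V2 \<and> samepat A (h1 \<circ> (g1 \<circ> \<mu>)) (h2 \<circ> (g2 \<circ> \<mu>))"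
      using 1 2 by blast
  qed
  moreover have "holds ?C (Obj ?C) UNIV ax_Grz"
    by (rule holds_Grz_quotient) (use assms(3) in auto)
  ultimately have ax: "holds ?C (Obj ?C) UNIV q" if "q \<in> {ax_T, ax_4, ax_dot2, ax_Grz}" for q
    using that holds_T holds_4 by blast
  have "holds ?C (Obj ?C) UNIV p" if "p \<in> Grz_2" for p
    by (rule normal_sound[OF ax that[unfolded Grz_2_def]])
  then show ?thesis using holds_form assms(2) by blast
qed

text \<open>The larger of two worlds maps onto one of the size of the smaller. This would not respect parameters,
  whence the restriction to sentences.\<close>

lemma Surj_dot3:
  assumes "set_universe \<U>" "world_class \<U> Surj (Sets \<U> Surj) K" "{} \<notin> K"
  shows "holds (Sets \<U> Surj) K {} ax_dot3"
proof -
  interpret world_class \<U> Surj "Sets \<U> Surj" K "{}" by fact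
  show ?thesis
  proof (rule holds_dot3, rule disjI2)
    fix A :: "nat set" and U U1 U2 and \<mu> :: "nat \<Rightarrow> 'a" and g1 g2 N
    assume *: "A \<subseteq> {}" "U \<in> K" "U1 \<in> Obj (Sets \<U> Surj)" "g1 \<in> hom_maps Surj U U1"
      "U2 \<in> Obj (Sets \<U> Surj)" "infinite U2 \<or> finite U1 \<and> finite U2 \<and> card U1 \<le> card U2"
    show "\<exists>V\<in>Obj (Sets \<U> Surj). \<exists>h\<in>hom_maps Surj U2 V. szeq N V U1 \<and> samepat A (h \<circ> (g2 \<circ> \<mu>)) (g1 \<circ> \<mu>)"
    proof (cases "finite U1")
      case True
      have "U1 \<noteq> {}" using *(2,4) assms(3) by auto
      then obtain s where "s ` U2 = U1"
        using surjection_exists[OF _ True, of U2] *(6) by (auto simp: large_def)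
      then have "restrict s U2 \<in> hom_maps Surj U2 U1" by auto
      moreover have "samepat A (h \<circ> (g2 \<circ> \<mu>)) (g1 \<circ> \<mu>)" for h :: "'a \<Rightarrow> 'a"
        using *(1) by (auto simp: samepat_def)
      ultimately show ?thesis using *(3) szeq_refl by blast
    next
      case False
      then have "szeq N U2 U1" using *(6) by (intro szeq_infinite) auto
      moreover have "samepat A (h \<circ> (g2 \<circ> \<mu>)) (g1 \<circ> \<mu>)" for h :: "'a \<Rightarrow> 'a"
        using *(1) by (auto simp: samepat_def)
      ultimately show ?thesis using *(5) id_hom by blast
    qed
  qed
qed

lemma Grz_3_Surj:
  assumes "set_universe \<U>" "W \<in> \<U>" "W \<noteq> {}"
  shows "Grz_3 \<subseteq> Val_sent (Sets \<U> Surj) W UNIV"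
proof -
  have wc: "world_class \<U> Surj (Sets \<U> Surj) (\<U> - {{}})"
    by (rule dot2_terminal(1)[OF assms(1)]) simp
  interpret world_class \<U> Surj "Sets \<U> Surj" "\<U> - {{}}" "{}" by (rule wc)
  have "holds (Sets \<U> Surj) (\<U> - {{}}) {} ax_dot3" by (rule Surj_dot3[OF assms(1) wc]) simp
  then have ax: "holds (Sets \<U> Surj) (\<U> - {{}}) {} q" if "q \<in> {ax_T, ax_4, ax_dot3, ax_Grz}" for q
    using that holds_T holds_4 holds_Grz_quotient by blast
  have "holds (Sets \<U> Surj) (\<U> - {{}}) {} p" if "p \<in> Grz_3" for p
    by (rule normal_sound[OF ax that[unfolded Grz_3_def]])
  moreover have "W \<in> \<U> - {{}}" using assms by blast
  ultimately show ?thesis using holds_sent[of W "\<U> - {{}}"] by blast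
qed

text \<open>Each stage of \<open>J\<close> contains a sentence whose truth value changes along a surjection, and this requires
  the size to drop.\<close>

lemma J_height:
  assumes "set_universe \<U>" "\<forall>i. fv (\<sigma> i) = {}"
  shows "U \<in> \<U> \<Longrightarrow> finite U \<Longrightarrow> \<not> sat (Sets \<U> Surj) U \<mu> (inst \<sigma> (ax_J (Suc n))) \<Longrightarrow> U \<noteq> {} \<Longrightarrow> Suc n < card U"
proof (induction n arbitrary: U \<mu>)
  case 0
  let ?C = "Sets \<U> Surj"
  interpret sets_category \<U> Surj ?C by standard (rule sets_cat_Sets[OF assms(1)])
  have d: "sat ?C U \<mu> (Dia (Box (\<sigma> 1)))" "\<not> sat ?C U \<mu> (\<sigma> 1)"
    using 0 by (auto simp del: sat.simps(6,7))
  then obtain U' g where g: "U' \<in> \<U>" "g \<in> hom_maps Surj U U'" "sat ?C U' (g \<circ> \<mu>) (Box (\<sigma> 1))"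
    unfolding sat_Dia[of _ _ "Box (\<sigma> 1)"] by auto
  then have p: "sat ?C U' (g \<circ> \<mu>) (\<sigma> 1)" using sat_Box_T[OF g(3)] assms(2) by simp
  have "g ` U = U'" using g by auto
  then have "finite U'" "card U' \<le> card U" "U' \<noteq> {}" using 0 card_image_le by auto
  moreover have "card U' \<noteq> card U"
  proof
    assume "card U' = card U"
    then have "sat ?C U' (g \<circ> \<mu>) (\<sigma> 1) \<longleftrightarrow> sat ?C U \<mu> (\<sigma> 1)"
      by (intro stable[OF C]) (use 0 g assms(2) \<open>finite U'\<close> in \<open>auto simp: szeq_def samepat_def\<close>)
    then show False using p d by simp
  qed
  ultimately show ?case using 0 by (cases "card U'") auto
next
  case (Suc n)
  let ?C = "Sets \<U> Surj" and ?i = "Suc (Suc n)"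
  interpret sets_category \<U> Surj ?C by standard (rule sets_cat_Sets[OF assms(1)])
  have d: "sat ?C U \<mu> (Dia (inst \<sigma> (PAnd (PBox (PVar ?i)) (PNeg (ax_J (Suc n))))))" "\<not> sat ?C U \<mu> (\<sigma> ?i)"
    using Suc.prems by (simp_all del: sat.simps(6,7))
  then obtain U' g where g: "U' \<in> \<U>" "g \<in> hom_maps Surj U U'" "sat ?C U' (g \<circ> \<mu>) (Box (\<sigma> ?i))"
    "\<not> sat ?C U' (g \<circ> \<mu>) (inst \<sigma> (ax_J (Suc n)))"
    unfolding sat_Dia by auto
  then have p: "sat ?C U' (g \<circ> \<mu>) (\<sigma> ?i)" using sat_Box_T[OF g(3)] assms(2) by simp
  have "g ` U = U'" using g by auto
  then have U': "finite U'" "card U' \<le> card U" "U' \<noteq> {}" using Suc card_image_le by auto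
  moreover have "card U' \<noteq> card U"
  proof
    assume "card U' = card U"
    then have "sat ?C U' (g \<circ> \<mu>) (\<sigma> ?i) \<longleftrightarrow> sat ?C U \<mu> (\<sigma> ?i)"
      by (intro stable[OF C]) (use Suc.prems g assms(2) U' in \<open>auto simp: szeq_def samepat_def\<close>)
    then show False using p d by simp
  qed
  moreover have "Suc n < card U'" by (rule Suc.IH[OF g(1) U'(1) g(4) U'(3)])
  ultimately show ?case by simp
qed

lemma Grz_3J_Surj:
  assumes "set_universe \<U>" "W \<in> \<U>" "finite W" "card W = n" "n > 0"
  shows "Grz_3J n \<subseteq> Val_sent (Sets \<U> Surj) W UNIV"
proof -
  let ?K = "{U \<in> \<U>. U \<noteq> {} \<and> finite U \<and> card U \<le> n}"
  have wc: "world_class \<U> Surj (Sets \<U> Surj) ?K"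
  proof
    show "U' \<in> ?K" if "U \<in> ?K" "U' \<in> Obj (Sets \<U> Surj)" "g \<in> hom_maps Surj U U'" for U U' g
      using that card_image_le[of U g] by auto
  qed (use sets_cat_Sets[OF assms(1)] in auto)
  interpret world_class \<U> Surj "Sets \<U> Surj" ?K "{}" by (rule wc)
  obtain m where m: "n = Suc m" using assms(5) by (cases n) auto
  have "holds (Sets \<U> Surj) ?K {} (ax_J n)"
    unfolding holds_def m using J_height[OF assms(1)] m by fastforce
  moreover have "holds (Sets \<U> Surj) ?K {} ax_dot3" by (rule Surj_dot3[OF assms(1) wc]) simp
  ultimately have ax: "holds (Sets \<U> Surj) ?K {} q" if "q \<in> {ax_T, ax_4, ax_dot3, ax_Grz, ax_J n}" for q
    using that holds_T holds_4 holds_Grz_quotient by blast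
  have "holds (Sets \<U> Surj) ?K {} p" if "p \<in> Grz_3J n" for p
    by (rule normal_sound[OF ax that[unfolded Grz_3J_def]])
  moreover have "W \<in> ?K" using assms by auto
  ultimately show ?thesis using holds_sent[of W ?K] by blast
qed

subsection \<open>Injections and inclusions\<close>

text \<open>Accessible worlds are extensions of a common one, and the smaller of two can be extended to one of the
  size of the larger with the same named elements.\<close>

lemma Grz_3_Inj:
  assumes "set_universe \<U>" "W \<in> \<U>" "k \<in> {Inj, Incl}"
  shows "Grz_3 \<subseteq> Val_form (Sets \<U> k) W UNIV"
proof -
  let ?C = "Sets \<U> k"
  interpret world_class \<U> k ?C \<U> UNIV
    by standard (use sets_cat_Sets[OF assms(1)] in auto)
  have "holds ?C \<U> UNIV ax_dot3"
  proof (rule holds_dot3, rule disjI1)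
    fix A :: "nat set" and U U1 U2 and \<mu> :: "nat \<Rightarrow> 'a" and g1 g2 N
    assume *: "\<mu> ` A \<subseteq> U" "U1 \<in> Obj ?C" "g1 \<in> hom_maps k U U1"
      "U2 \<in> Obj ?C" "g2 \<in> hom_maps k U U2" "infinite U2 \<or> finite U1 \<and> finite U2 \<and> card U1 \<le> card U2"
    have "inj_on g1 U" "inj_on g2 U" using inj_hom *(3,5) assms(3) by blast+
    then have pat: "samepat A ((\<lambda>x\<in>U1. x) \<circ> (g1 \<circ> \<mu>)) (g2 \<circ> \<mu>)"
      using *(1) hom_image[OF *(3)] by (simp add: samepat_def inj_on_eq_iff image_subset_iff)
    have "\<exists>V\<in>\<U>. U1 \<subseteq> V \<and> szeq N V U2"
    proof (cases "finite U1")
      case True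
      then show ?thesis using superset_of_size[OF assms(1) True, of U2] * by auto
    next
      case False
      then show ?thesis using * by (intro bexI[of _ U1]) (auto intro: szeq_infinite)
    qed
    then obtain V where V: "V \<in> \<U>" "U1 \<subseteq> V" "szeq N V U2" by blast
    then have "(\<lambda>x\<in>U1. x) \<in> hom_maps k U1 V" using assms(3) by (auto simp: inj_on_def)
    then show "\<exists>V\<in>Obj ?C. \<exists>h\<in>hom_maps k U1 V. szeq N V U2 \<and> samepat A (h \<circ> (g1 \<circ> \<mu>)) (g2 \<circ> \<mu>)"
      unfolding Obj_Sets using V pat by blast
  qed
  moreover have "holds ?C \<U> UNIV ax_Grz"
    by (rule holds_Grz_extension) (use assms(3) in auto)
  ultimately have ax: "holds ?C \<U> UNIV q" if "q \<in> {ax_T, ax_4, ax_dot3, ax_Grz}" for q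
    using that holds_T holds_4 by blast
  have "holds ?C \<U> UNIV p" if "p \<in> Grz_3" for p
    by (rule normal_sound[OF ax that[unfolded Grz_3_def]])
  then show ?thesis using holds_form assms(2) by blast
qed

subsection \<open>Finite sets among all sets\<close>

text \<open>A large finite part of an infinite target that contains the image of the morphism
  is as good as the whole target.\<close>

lemma finite_target:
  fixes W :: "'a set"
  assumes "set_universe \<U>" "finite W" "W \<in> \<U>" "\<mu> ` fv \<phi> \<subseteq> W" "U \<in> \<U>" "g \<in> hom_maps k W U"
  shows "\<exists>V\<in>\<U>. finite V \<and> g \<in> hom_maps k W V \<and> (sat (Sets \<U> k) V (g \<circ> \<mu>) \<phi> \<longleftrightarrow> sat (Sets \<U> k) U (g \<circ> \<mu>) \<phi>)"
proof (cases "finite U")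
  case True
  then show ?thesis using assms by blast
next
  case False
  then obtain B where B: "B \<subseteq> U" "finite B" "card B = bound \<phi>" using infinite_arbitrarily_large by metis
  let ?V = "g ` W \<union> B"
  have gU: "g ` W \<subseteq> U" using hom_image[OF assms(6)] by blast
  have V: "?V \<subseteq> U" "finite ?V" "?V \<in> \<U>"
    using B gU assms(2) universe_finite[OF assms(1), of ?V] by auto
  have "k \<in> {Func, Inj, Incl}"
    using assms(2,6) False by (cases k) (auto simp: bij_betw_finite)
  then have g: "g \<in> hom_maps k W ?V"
    using assms(6) by (auto simp: PiE_def)
  have "bound \<phi> \<le> card ?V" using B V(2) card_mono[of ?V B] by auto
  then have sz: "szeq (bound \<phi>) ?V U" using False by (auto simp: szeq_def large_def)
  have "sat (Sets \<U> k) ?V (g \<circ> \<mu>) \<phi> \<longleftrightarrow> sat (Sets \<U> k) U (g \<circ> \<mu>) \<phi>"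
    by (rule stable[OF sets_cat_Sets[OF assms(1)] _ _ sz])
      (use V assms(4,5) gU in \<open>auto simp: samepat_def\<close>)
  then show ?thesis using V g by blast
qed

lemma sat_FinSets:
  fixes W :: "'a set"
  assumes "set_universe \<U>"
  shows "finite W \<Longrightarrow> W \<in> \<U> \<Longrightarrow> \<mu> ` fv \<phi> \<subseteq> W \<Longrightarrow> sat (FinSets \<U> k) W \<mu> \<phi> \<longleftrightarrow> sat (Sets \<U> k) W \<mu> \<phi>"
proof (induction \<phi> arbitrary: W \<mu>)
  case (Ex x \<phi>)
  have "sat (FinSets \<U> k) W (\<mu>(x := a)) \<phi> \<longleftrightarrow> sat (Sets \<U> k) W (\<mu>(x := a)) \<phi>" if "a \<in> W" for a
    by (rule Ex.IH) (use Ex.prems that in auto)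
  then show ?case by simp
next
  case (All x \<phi>)
  have "sat (FinSets \<U> k) W (\<mu>(x := a)) \<phi> \<longleftrightarrow> sat (Sets \<U> k) W (\<mu>(x := a)) \<phi>" if "a \<in> W" for a
    by (rule All.IH) (use All.prems that in auto)
  then show ?case by simp
next
  case (And \<phi> \<psi>)
  have "sat (FinSets \<U> k) W \<mu> \<phi> \<longleftrightarrow> sat (Sets \<U> k) W \<mu> \<phi>" by (rule And.IH) (use And.prems in auto)
  moreover have "sat (FinSets \<U> k) W \<mu> \<psi> \<longleftrightarrow> sat (Sets \<U> k) W \<mu> \<psi>" by (rule And.IH) (use And.prems in auto)
  ultimately show ?case by simp
next
  case (Neg \<phi>)
  have "sat (FinSets \<U> k) W \<mu> \<phi> \<longleftrightarrow> sat (Sets \<U> k) W \<mu> \<phi>" by (rule Neg.IH) (use Neg.prems in auto)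
  then show ?case by simp
next
  case (Dia \<phi>)
  have IH: "sat (FinSets \<U> k) U (g \<circ> \<mu>) \<phi> \<longleftrightarrow> sat (Sets \<U> k) U (g \<circ> \<mu>) \<phi>"
    if "finite U" "U \<in> \<U>" "g \<in> hom_maps k W U" for U g
    by (rule Dia.IH) (use that Dia.prems hom_image[OF that(3)] in auto)
  have "\<exists>V\<in>\<U>. finite V \<and> g \<in> hom_maps k W V \<and> (sat (Sets \<U> k) V (g \<circ> \<mu>) \<phi> \<longleftrightarrow> sat (Sets \<U> k) U (g \<circ> \<mu>) \<phi>)"
    if "U \<in> \<U>" "g \<in> hom_maps k W U" for U g
    using finite_target[OF assms Dia.prems(1,2) _ that] Dia.prems(3) by auto
  then show ?case using IH by auto blast+
next
  case (Box \<phi>)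
  have IH: "sat (FinSets \<U> k) U (g \<circ> \<mu>) \<phi> \<longleftrightarrow> sat (Sets \<U> k) U (g \<circ> \<mu>) \<phi>"
    if "finite U" "U \<in> \<U>" "g \<in> hom_maps k W U" for U g
    by (rule Box.IH) (use that Box.prems hom_image[OF that(3)] in auto)
  have "\<exists>V\<in>\<U>. finite V \<and> g \<in> hom_maps k W V \<and> (sat (Sets \<U> k) V (g \<circ> \<mu>) \<phi> \<longleftrightarrow> sat (Sets \<U> k) U (g \<circ> \<mu>) \<phi>)"
    if "U \<in> \<U>" "g \<in> hom_maps k W U" for U g
    using finite_target[OF assms Box.prems(1,2) _ that] Box.prems(3) by auto
  then show ?case using IH by auto blast+
qed simp

section \<open>Definability in the language of equality\<close>

definition ker :: "nat \<Rightarrow> (nat \<Rightarrow> 'a) \<Rightarrow> nat rel" where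
  "ker n \<mu> = {(i, j). i < n \<and> j < n \<and> \<mu> i = \<mu> j}"

definition definable :: "nat \<Rightarrow> ('a set \<Rightarrow> (nat \<Rightarrow> 'a) \<Rightarrow> bool) \<Rightarrow> bool" where
  "definable n Q \<longleftrightarrow> (\<exists>\<phi>. modal_free \<phi> \<and> fv \<phi> \<subseteq> {..<n} \<and>
     (\<forall>C U \<mu>. sat C U \<mu> \<phi> \<longleftrightarrow> Q U \<mu>))"

abbreviation FTop :: fm where "FTop \<equiv> All 0 (Eq 0 0)"

lemma definable_const: "definable n (\<lambda>U \<mu>. b)"
proof (cases b)
  case True
  then show ?thesis unfolding definable_def by (intro exI[of _ FTop]) auto
next
  case False
  then show ?thesis unfolding definable_def by (intro exI[of _ "Neg FTop"]) auto
qed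

lemma definable_not: "definable n Q \<Longrightarrow> definable n (\<lambda>U \<mu>. \<not> Q U \<mu>)"
  unfolding definable_def by (elim exE) (rule exI[of _ "Neg _"], auto)

lemma definable_and: "definable n Q \<Longrightarrow> definable n R \<Longrightarrow> definable n (\<lambda>U \<mu>. Q U \<mu> \<and> R U \<mu>)"
proof -
  assume "definable n Q" "definable n R"
  then obtain \<phi> \<psi> where "modal_free \<phi>" "fv \<phi> \<subseteq> {..<n}" "\<forall>C U \<mu>. sat C U \<mu> \<phi> \<longleftrightarrow> Q U \<mu>"
    "modal_free \<psi>" "fv \<psi> \<subseteq> {..<n}" "\<forall>C U \<mu>. sat C U \<mu> \<psi> \<longleftrightarrow> R U \<mu>"
    unfolding definable_def by blast
  then show ?thesis unfolding definable_def by (intro exI[of _ "And \<phi> \<psi>"]) simp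
qed

lemma definable_or:
  assumes "definable n Q" "definable n R"
  shows "definable n (\<lambda>U \<mu>. Q U \<mu> \<or> R U \<mu>)"
  using definable_not[OF definable_and[OF assms[THEN definable_not]]] by simp

lemma definable_ex:
  "finite I \<Longrightarrow> (\<And>i. i \<in> I \<Longrightarrow> definable n (Q i)) \<Longrightarrow> definable n (\<lambda>U \<mu>. \<exists>i\<in>I. Q i U \<mu>)"
  by (induction I rule: finite_induct) (auto intro: definable_const definable_or)

lemma definable_all:
  assumes "finite I" "\<And>i. i \<in> I \<Longrightarrow> definable n (Q i)"
  shows "definable n (\<lambda>U \<mu>. \<forall>i\<in>I. Q i U \<mu>)"
  using definable_not[OF definable_ex[OF assms(1), of n "\<lambda>i U \<mu>. \<not> Q i U \<mu>"]] assms(2)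
  by (simp add: definable_not)

lemma definable_eq: "i < n \<Longrightarrow> j < n \<Longrightarrow> definable n (\<lambda>U \<mu>. \<mu> i = \<mu> j)"
  unfolding definable_def by (intro exI[of _ "Eq i j"]) auto

primrec differs :: "nat \<Rightarrow> nat \<Rightarrow> fm" where
  "differs k 0 = FTop"
| "differs k (Suc i) = And (Neg (Eq k i)) (differs k i)"

text \<open>At least \<open>m\<close> elements differ from the values of the first \<open>k\<close> variables.\<close>

primrec at_least :: "nat \<Rightarrow> nat \<Rightarrow> fm" where
  "at_least 0 k = FTop"
| "at_least (Suc m) k = Ex k (And (differs k k) (at_least m (Suc k)))"

lemma sat_differs: "sat C U \<mu> (differs k j) \<longleftrightarrow> (\<forall>i<j. \<mu> k \<noteq> \<mu> i)"
  by (induction j) (auto simp: less_Suc_eq)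

lemma fv_differs: "fv (differs k j) \<subseteq> insert k {..<j}"
  by (induction j) auto

lemma modal_free_differs: "modal_free (differs k j)"
  by (induction j) auto

lemma fv_at_least: "fv (at_least m k) \<subseteq> {..<k}"
proof (induction m arbitrary: k)
  case (Suc m)
  show ?case using Suc[of "Suc k"] fv_differs[of k k] by (auto simp: less_Suc_eq)
qed auto

lemma modal_free_at_least: "modal_free (at_least m k)"
  by (induction m arbitrary: k) (auto simp: modal_free_differs)

lemma large_Suc: "large (Suc m) S \<longleftrightarrow> (\<exists>a\<in>S. large m (S - {a}))"
proof
  assume L: "large (Suc m) S"
  then have "S \<noteq> {}" by (auto simp: large_def)
  then obtain a where a: "a \<in> S" by blast
  then have "large m (S - {a})" using L by (auto simp: large_def card_Diff_singleton)
  then show "\<exists>a\<in>S. large m (S - {a})" using a by blast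
next
  assume "\<exists>a\<in>S. large m (S - {a})"
  then obtain a where a: "a \<in> S" "large m (S - {a})" by blast
  show "large (Suc m) S"
  proof (cases "finite S")
    case True
    then show ?thesis using a card_Suc_Diff1[OF True a(1)] by (auto simp: large_def)
  qed (simp add: large_def)
qed

lemma sat_at_least: "sat C U \<mu> (at_least m k) \<longleftrightarrow> large m (U - \<mu> ` {..<k})"
proof (induction m arbitrary: k \<mu>)
  case 0
  then show ?case by (simp add: large_def)
next
  case (Suc m)
  have im: "(\<mu>(k := a)) ` {..<Suc k} = insert a (\<mu> ` {..<k})" for a
    by (auto simp: lessThan_Suc)
  have "sat C U \<mu> (at_least (Suc m) k) \<longleftrightarrow>
      (\<exists>a\<in>U. (\<forall>i<k. a \<noteq> \<mu> i) \<and> large m (U - insert a (\<mu> ` {..<k})))"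
    by (simp add: Suc sat_differs im del: fun_upd_apply) (simp add: im)
  also have "\<dots> \<longleftrightarrow> (\<exists>a\<in>U - \<mu> ` {..<k}. large m (U - \<mu> ` {..<k} - {a}))"
    by (auto simp: Diff_insert[symmetric])
  finally show ?case by (simp add: large_Suc)
qed

lemma definable_large: "definable n (\<lambda>U \<mu>. large m U)"
  unfolding definable_def
  using fv_at_least[of m 0] by (intro exI[of _ "at_least m 0"]) (auto simp: sat_at_least modal_free_at_least)

lemma trunc_iff: "t \<le> N \<Longrightarrow> trunc N U = t \<longleftrightarrow> large t U \<and> (t < N \<longrightarrow> \<not> large (Suc t) U)"
  by (auto simp: trunc_def large_def)

text \<open>There are only finitely many equality patterns of \<open>n\<close> variables and only finitely many truncated
  sizes, and each of them is definable.\<close>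

lemma definable_ker_trunc: "definable n (\<lambda>(U :: 'a set) \<mu>. P (ker n \<mu>) (trunc N U))"
proof -
  have k: "definable n (\<lambda>(U :: 'a set) \<mu>. ker n \<mu> = E)" for E
  proof -
    have "definable n (\<lambda>(U :: 'a set) \<mu>. E \<subseteq> {..<n} \<times> {..<n} \<and>
        (\<forall>i\<in>{..<n}. \<forall>j\<in>{..<n}. (\<mu> i = \<mu> j \<and> (i, j) \<in> E \<or> \<mu> i \<noteq> \<mu> j \<and> (i, j) \<notin> E)))"
      by (intro definable_and definable_const definable_all definable_or definable_not definable_eq) auto
    moreover have "ker n \<mu> = E \<longleftrightarrow> E \<subseteq> {..<n} \<times> {..<n} \<and>
        (\<forall>i\<in>{..<n}. \<forall>j\<in>{..<n}. (\<mu> i = \<mu> j \<and> (i, j) \<in> E \<or> \<mu> i \<noteq> \<mu> j \<and> (i, j) \<notin> E))" for \<mu> :: "nat \<Rightarrow> 'a"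
      by (auto simp: ker_def)
    ultimately show ?thesis by (simp only:)
  qed
  have t: "definable n (\<lambda>(U :: 'a set) \<mu>. trunc N U = t)" if "t \<le> N" for t
  proof (cases "t < N")
    case True
    then show ?thesis unfolding trunc_iff[OF that]
      by (simp add: definable_and definable_not definable_large)
  next
    case False
    then show ?thesis unfolding trunc_iff[OF that] by (simp add: definable_large)
  qed
  have "definable n (\<lambda>(U :: 'a set) \<mu>. \<exists>E\<in>Pow ({..<n} \<times> {..<n}). \<exists>t\<in>{..N}.
      ker n \<mu> = E \<and> trunc N U = t \<and> P E t)"
    by (intro definable_ex definable_and definable_const k t) auto
  moreover have "(\<exists>E\<in>Pow ({..<n} \<times> {..<n}). \<exists>t\<in>{..N}. ker n \<mu> = E \<and> trunc N U = t \<and> P E t) \<longleftrightarrow>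
      P (ker n \<mu>) (trunc N U)" for U :: "'a set" and \<mu> :: "nat \<Rightarrow> 'a"
    using trunc_le[of N U] by (auto simp: ker_def)
  ultimately show ?thesis by (simp only:)
qed

section \<open>Refuting formulas with substitution instances\<close>

definition alike :: "'w rel \<Rightarrow> (nat \<Rightarrow> 'w set) \<Rightarrow> pm \<Rightarrow> 'w \<Rightarrow> 'w \<Rightarrow> bool" where
  "alike r V p x y \<longleftrightarrow> (x, y) \<in> r \<and> (y, x) \<in> r \<and> (\<forall>i\<in>pvars p. x \<in> V i \<longleftrightarrow> y \<in> V i)"

text \<open>The valuation of the model becomes a substitution: the set of worlds that simulate a node in \<open>V i\<close> is defined by a
  formula, since the node depends only on the equality pattern and the truncated size. The parameters \<open>\<nu>\<close>
  must place \<open>W\<close> at the refuting node \<open>w\<close>.\<close>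

lemma not_valid_by_simulation:
  fixes C :: "'a setcat"
  assumes Hom: "Hom C = hom_maps k" and r: "trans r" "refl_on X r"
    and w: "\<not> ksat X r V w p" "w \<in> X"
    and start: "W \<in> K" "\<nu> ` {..<n} \<subseteq> W" "alike r V p (F (ker n \<nu>) (trunc N W)) w"
    and node: "\<And>U \<mu>. U \<in> K \<Longrightarrow> \<mu> ` {..<n} \<subseteq> U \<Longrightarrow> F (ker n \<mu>) (trunc N U) \<in> X"
    and zig: "\<And>U \<mu> U' g. U \<in> K \<Longrightarrow> \<mu> ` {..<n} \<subseteq> U \<Longrightarrow> U' \<in> Obj C \<Longrightarrow> g \<in> hom_maps k U U' \<Longrightarrow>
      U' \<in> K \<and> (F (ker n \<mu>) (trunc N U), F (ker n (g \<circ> \<mu>)) (trunc N U')) \<in> r"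
    and zag: "\<And>U \<mu> y. U \<in> K \<Longrightarrow> \<mu> ` {..<n} \<subseteq> U \<Longrightarrow> y \<in> X \<Longrightarrow> (F (ker n \<mu>) (trunc N U), y) \<in> r \<Longrightarrow>
      \<exists>U'\<in>Obj C. \<exists>g\<in>hom_maps k U U'. alike r V p (F (ker n (g \<circ> \<mu>)) (trunc N U')) y"
  shows "p \<notin> Val_form C W L_eq" "n = 0 \<Longrightarrow> p \<notin> Val_sent C W L_eq"
proof -
  have "\<forall>i. \<exists>\<phi>. modal_free \<phi> \<and> fv \<phi> \<subseteq> {..<n} \<and>
      (\<forall>C U \<mu>. sat C U \<mu> \<phi> \<longleftrightarrow> F (ker n \<mu>) (trunc N (U :: 'a set)) \<in> V i)"
    using definable_ker_trunc[of n "\<lambda>E t. F E t \<in> V _" N] unfolding definable_def by blast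
  then obtain \<sigma> where \<sigma>: "\<And>i. modal_free (\<sigma> i)" "\<And>i. fv (\<sigma> i) \<subseteq> {..<n}"
    "\<And>i C U \<mu>. sat C U \<mu> (\<sigma> i) \<longleftrightarrow> F (ker n \<mu>) (trunc N (U :: 'a set)) \<in> V i"
    by metis
  have img: "(g \<circ> \<mu>) ` {..<n} \<subseteq> U'" if "g \<in> hom_maps k U U'" "\<mu> ` {..<n} \<subseteq> U" for g \<mu> U U'
    using that(2) hom_image[OF that(1)] by auto
  have zagz: "\<exists>U'\<in>Obj C. \<exists>g\<in>hom_maps k U U'. sat C U' (g \<circ> \<mu>) (inst \<sigma> q) \<longleftrightarrow> ksat X r V y' q"
    if IH: "\<And>U \<mu> y. U \<in> K \<Longrightarrow> \<mu> ` {..<n} \<subseteq> U \<Longrightarrow> y \<in> X \<Longrightarrow>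
        alike r V p (F (ker n \<mu>) (trunc N U)) y \<Longrightarrow> sat C U \<mu> (inst \<sigma> q) \<longleftrightarrow> ksat X r V y q"
      and p: "U \<in> K" "\<mu> ` {..<n} \<subseteq> U" "y \<in> X" "alike r V p (F (ker n \<mu>) (trunc N U)) y"
      and y': "y' \<in> X" "(y, y') \<in> r" for q U \<mu> y y'
  proof -
    have "(F (ker n \<mu>) (trunc N U), y') \<in> r" using p(4) y'(2) r(1) by (auto simp: alike_def dest: transD)
    then obtain U' g where g: "U' \<in> Obj C" "g \<in> hom_maps k U U'"
      "alike r V p (F (ker n (g \<circ> \<mu>)) (trunc N U')) y'"
      using zag[OF p(1,2) y'(1)] by blast
    have "U' \<in> K" using zig[OF p(1,2) g(1,2)] by blast
    from IH[OF this img[OF g(2) p(2)] y'(1) g(3)] show ?thesis using g(1,2) by blast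
  qed
  have zigz: "\<exists>y'\<in>X. (y, y') \<in> r \<and> (sat C U' (g \<circ> \<mu>) (inst \<sigma> q) \<longleftrightarrow> ksat X r V y' q)"
    if IH: "\<And>U \<mu> y. U \<in> K \<Longrightarrow> \<mu> ` {..<n} \<subseteq> U \<Longrightarrow> y \<in> X \<Longrightarrow>
        alike r V p (F (ker n \<mu>) (trunc N U)) y \<Longrightarrow> sat C U \<mu> (inst \<sigma> q) \<longleftrightarrow> ksat X r V y q"
      and p: "U \<in> K" "\<mu> ` {..<n} \<subseteq> U" "y \<in> X" "alike r V p (F (ker n \<mu>) (trunc N U)) y"
      and g: "U' \<in> Obj C" "g \<in> hom_maps k U U'" for q U \<mu> y U' g
  proof -
    let ?f' = "F (ker n (g \<circ> \<mu>)) (trunc N U')"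
    have K: "U' \<in> K" "(F (ker n \<mu>) (trunc N U), ?f') \<in> r" using zig[OF p(1,2) g] by blast+
    have X: "?f' \<in> X" by (rule node[OF K(1) img[OF g(2) p(2)]])
    have "(y, ?f') \<in> r" using p(4) K(2) r(1) by (auto simp: alike_def dest: transD)
    moreover have "alike r V p ?f' ?f'" using X r(2) by (auto simp: alike_def refl_on_def)
    from IH[OF K(1) img[OF g(2) p(2)] X this] calculation X show ?thesis by blast
  qed
  have "sat C U \<mu> (inst \<sigma> q) \<longleftrightarrow> ksat X r V y q"
    if "pvars q \<subseteq> pvars p" "U \<in> K" "\<mu> ` {..<n} \<subseteq> U" "y \<in> X" "alike r V p (F (ker n \<mu>) (trunc N U)) y"
    for q U \<mu> y
    using that
  proof (induction q arbitrary: U \<mu> y)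
    case (PVar i)
    then show ?case by (auto simp: \<sigma>(3) alike_def)
  next
    case (PBox q)
    have sub: "pvars q \<subseteq> pvars p" using PBox.prems(1) by simp
    have "\<forall>y'\<in>X. (y, y') \<in> r \<longrightarrow>
        (\<exists>U'\<in>Obj C. \<exists>g\<in>hom_maps k U U'. sat C U' (g \<circ> \<mu>) (inst \<sigma> q) \<longleftrightarrow> ksat X r V y' q)"
      using zagz[OF PBox.IH[OF sub] PBox.prems(2-5)] by blast
    moreover have "\<forall>U'\<in>Obj C. \<forall>g\<in>hom_maps k U U'.
        \<exists>y'\<in>X. (y, y') \<in> r \<and> (sat C U' (g \<circ> \<mu>) (inst \<sigma> q) \<longleftrightarrow> ksat X r V y' q)"
      using zigz[OF PBox.IH[OF sub] PBox.prems(2-5)] by blast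
    ultimately show ?case unfolding inst.simps sat.simps ksat.simps Hom by meson
  next
    case (PDia q)
    have sub: "pvars q \<subseteq> pvars p" using PDia.prems(1) by simp
    have "\<forall>y'\<in>X. (y, y') \<in> r \<longrightarrow>
        (\<exists>U'\<in>Obj C. \<exists>g\<in>hom_maps k U U'. sat C U' (g \<circ> \<mu>) (inst \<sigma> q) \<longleftrightarrow> ksat X r V y' q)"
      using zagz[OF PDia.IH[OF sub] PDia.prems(2-5)] by blast
    moreover have "\<forall>U'\<in>Obj C. \<forall>g\<in>hom_maps k U U'.
        \<exists>y'\<in>X. (y, y') \<in> r \<and> (sat C U' (g \<circ> \<mu>) (inst \<sigma> q) \<longleftrightarrow> ksat X r V y' q)"
      using zigz[OF PDia.IH[OF sub] PDia.prems(2-5)] by blast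
    ultimately show ?case unfolding inst.simps sat.simps ksat.simps Hom by meson
  qed auto
  from this[OF subset_refl start(1,2) w(2) start(3)] have ns: "\<not> sat C W \<nu> (inst \<sigma> p)"
    using w(1) by blast
  have "\<forall>i. \<sigma> i \<in> L_eq \<and> \<nu> ` fv (\<sigma> i) \<subseteq> W"
    using \<sigma>(1,2) start(2) unfolding L_eq_def by blast
  then show "p \<notin> Val_form C W L_eq" using ns unfolding Val_form_def by blast
  show "p \<notin> Val_sent C W L_eq" if "n = 0"
    using ns \<sigma>(1,2) that unfolding Val_sent_def L_eq_def by auto
qed

lemma Val_sent_Triv:
  assumes "sets_cat \<U> k C" "W \<in> Obj C"
  shows "Val_sent C W L_eq \<subseteq> Triv"
proof
  fix p assume p: "p \<in> Val_sent C W L_eq"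
  show "p \<in> Triv"
  proof (rule ccontr)
    assume "p \<notin> Triv"
    then obtain V where V: "\<not> ksat {()} UNIV V () p" using complete_Triv by blast
    have "p \<notin> Val_sent C W L_eq"
      by (rule not_valid_by_simulation(2)[where F = "\<lambda>_ _. ()" and K = "Obj C" and n = 0 and N = 0, OF _ _ _ V])
        (use assms id_hom in \<open>auto simp: sets_cat_def alike_def trans_def refl_on_def\<close>)
    then show False using p by simp
  qed
qed

lemma trunc_less: "j < N \<Longrightarrow> finite U \<Longrightarrow> card U = j \<Longrightarrow> trunc N U = j"
  by (auto simp: trunc_def large_def)

lemma trunc_0: "N > 0 \<Longrightarrow> trunc N U = 0 \<longleftrightarrow> U = {}"
  by (auto simp: trunc_def large_def)

lemma finite_world_exists:
  fixes \<U> :: "'a set set"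
  assumes "set_universe \<U>"
  shows "\<exists>U\<in>\<U>. finite U \<and> card U = m"
  using infinite_arbitrarily_large[OF universe_type_infinite[OF assms], of m] universe_finite[OF assms] by blast

text \<open>The position in the chain is counted from its end by the size of the world.\<close>

lemma not_valid_Surj_chain:
  assumes "set_universe \<U>" "W \<in> \<U>" "0 < k" "large k W"
    and V: "\<not> ksat {..<k :: nat} {(i, j). i \<le> j} V 0 p"
  shows "p \<notin> Val_sent (Sets \<U> Surj) W L_eq"
proof (rule not_valid_by_simulation(2)[where F = "\<lambda>_ t. k - t" and K = "\<U> - {{}}" and n = 0 and N = k
      and k = Surj and \<nu> = undefined, OF _ _ _ V])
  have W: "W \<noteq> {}" using assms(3,4) by (auto simp: large_def)
  then show "W \<in> \<U> - {{}}" using assms(2) by simp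
  show "alike {(i, j). i \<le> j} V p (k - trunc k W) 0"
    using assms(4) by (simp add: trunc_def alike_def)
  fix U assume U: "U \<in> \<U> - {{}}"
  then have t: "trunc k U \<noteq> 0" using trunc_0[OF assms(3), of U] by blast
  then show "k - trunc k U \<in> {..<k}" using diff_less[of "trunc k U" k] assms(3) by blast
  show "U' \<in> \<U> - {{}} \<and> (k - trunc k U, k - trunc k U') \<in> {(i, j). i \<le> j}"
    if "U' \<in> Obj (Sets \<U> Surj)" "g \<in> hom_maps Surj U U'" for U' g
    using that U trunc_surj[of g U U' k] by auto
  fix y assume y: "y \<in> {..<k}" "(k - trunc k U, y) \<in> {(i, j). i \<le> j}"
  obtain U' where U': "U' \<in> \<U>" "finite U'" "card U' = k - y" using finite_world_exists[OF assms(1)] by blast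
  show "\<exists>U'\<in>Obj (Sets \<U> Surj). \<exists>g\<in>hom_maps Surj U U'. alike {(i, j). i \<le> j} V p (k - trunc k U') y"
  proof (cases "y = 0")
    case True
    then have "trunc k U = k" using y(2) trunc_le[of k U] by simp
    then show ?thesis
      using U True id_hom[of U Surj] unfolding Obj_Sets by (intro bexI[of _ U] bexI[of _ "\<lambda>x\<in>U. x"]) (auto simp: alike_def)
  next
    case False
    have "k - y \<le> trunc k U" using y by auto
    then have "large (card U') U" unfolding U'(3) by (auto simp: trunc_def large_def split: if_splits)
    moreover have "U' \<noteq> {}" using U' y(1) by auto
    ultimately obtain s where "s ` U = U'" using surjection_exists[of U' U] U'(2) by blast
    then have "restrict s U \<in> hom_maps Surj U U'" by auto
    moreover have "trunc k U' = k - y" by (rule trunc_less) (use U' y False in auto)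
    ultimately show ?thesis
      using U'(1) y(1) unfolding Obj_Sets by (intro bexI[of _ U'] bexI[of _ "restrict s U"]) (auto simp: alike_def)
  qed
qed (auto simp: trans_def refl_on_def assms)

text \<open>The position in the chain is the number of elements by which the world exceeds \<open>W\<close>.\<close>

lemma not_valid_Inj_chain:
  assumes "set_universe \<U>" "W \<in> \<U>" "finite W" "0 < m" "k \<in> {Inj, Incl}"
    and V: "\<not> ksat {..<m :: nat} {(i, j). i \<le> j} V 0 p"
  shows "p \<notin> Val_sent (Sets \<U> k) W L_eq"
proof (rule not_valid_by_simulation(2)[where F = "\<lambda>_ t. min (m - 1) (t - card W)" and K = \<U> and n = 0
      and N = "card W + m" and k = k and \<nu> = undefined, OF _ _ _ V])
  let ?N = "card W + m"
  have "trunc ?N W = card W" by (rule trunc_less) (use assms in auto)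
  then show "alike {(i, j). i \<le> j} V p (min (m - 1) (trunc ?N W - card W)) 0"
    by (simp add: alike_def)
  fix U assume U: "U \<in> \<U>"
  show "min (m - 1) (trunc ?N U - card W) \<in> {..<m}" using assms(4) by auto
  show "U' \<in> \<U> \<and> (min (m - 1) (trunc ?N U - card W), min (m - 1) (trunc ?N U' - card W)) \<in> {(i, j). i \<le> j}"
    if "U' \<in> Obj (Sets \<U> k)" "g \<in> hom_maps k U U'" for U' g
  proof -
    have "inj_on g U" by (rule inj_hom[OF that(2)]) (use assms(5) in auto)
    moreover have "g ` U \<subseteq> U'" using hom_image[OF that(2)] by blast
    ultimately have "trunc ?N U \<le> trunc ?N U'" by (rule trunc_inj)
    then have "min (m - 1) (trunc ?N U - card W) \<le> min (m - 1) (trunc ?N U' - card W)"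
      by (intro min.mono diff_le_mono) auto
    then show ?thesis using that by simp
  qed
  fix y assume y: "y \<in> {..<m}" "(min (m - 1) (trunc ?N U - card W), y) \<in> {(i, j). i \<le> j}"
  show "\<exists>U'\<in>Obj (Sets \<U> k). \<exists>g\<in>hom_maps k U U'.
      alike {(i, j). i \<le> j} V p (min (m - 1) (trunc ?N U' - card W)) y"
  proof (cases "y = min (m - 1) (trunc ?N U - card W)")
    case True
    then show ?thesis
      using U id_hom[of U k] unfolding Obj_Sets by (intro bexI[of _ U] bexI[of _ "\<lambda>x\<in>U. x"]) (auto simp: alike_def)
  next
    case False
    then have less: "trunc ?N U - card W < y" "trunc ?N U < ?N" using y by auto
    then have fin: "finite U" "card U \<le> card W + y"
      by (auto simp: trunc_def large_def split: if_splits)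
    obtain T where T: "T \<in> \<U>" "finite T" "card T = card W + y" using finite_world_exists[OF assms(1)] by blast
    obtain U' where U': "U' \<in> \<U>" "U \<subseteq> U'" "szeq (Suc (card W + y)) U' T"
      using superset_of_size[OF assms(1) fin(1) T(1)] fin(2) T(3) by auto
    then have "finite U'" "card U' = card W + y" using T by (auto simp: szeq_def large_def)
    then have "trunc ?N U' = card W + y" using y(1) by (intro trunc_less) auto
    moreover have "(\<lambda>x\<in>U. x) \<in> hom_maps k U U'" using U'(2) assms(5) by (auto simp: inj_on_def)
    ultimately show ?thesis
      using U'(1) y(1) unfolding Obj_Sets by (intro bexI[of _ U'] bexI[of _ "\<lambda>x\<in>U. x"]) (auto simp: alike_def)
  qed
qed (auto simp: trans_def refl_on_def assms)

section \<open>Equivalence relations and partitions\<close>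

abbreviation eqvs :: "nat \<Rightarrow> nat rel set" where
  "eqvs n \<equiv> {E. equiv {..<n} E}"

lemma ker_eqv: "equiv {..<n} (ker n \<mu>)"
  by (auto simp: equiv_def refl_on_def sym_def trans_def ker_def)

lemma ker_mono: "ker n \<mu> \<subseteq> ker n (g \<circ> \<mu>)"
  by (auto simp: ker_def)

lemma eqv_join:
  assumes "equiv A E" "equiv A D"
  shows "equiv A ((E \<union> D)\<^sup>+)"
proof (rule equivI)
  have "E \<union> D \<subseteq> A \<times> A" using assms by (auto simp: equiv_def)
  then show "(E \<union> D)\<^sup>+ \<subseteq> A \<times> A" by (rule trancl_subset_Sigma)
  show "refl_on A ((E \<union> D)\<^sup>+)" using assms by (auto simp: equiv_def refl_on_def)
  have "sym (E \<union> D)" using assms by (auto simp: equiv_def intro: sym_Un)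
  then show "sym ((E \<union> D)\<^sup>+)" by (rule sym_trancl)
  show "trans ((E \<union> D)\<^sup>+)" by (rule trans_trancl)
qed

lemma eqv_join_absorb:
  assumes "trans E" "D \<subseteq> E" shows "(E \<union> D)\<^sup>+ = E"
  using assms by (simp add: Un_absorb2 trancl_id)

definition part_rel :: "nat set set \<Rightarrow> nat rel" where
  "part_rel P = {(x, y). \<exists>p\<in>P. x \<in> p \<and> y \<in> p}"

lemma part_rel_quotient:
  assumes "equiv A E" shows "part_rel (A // E) = E"
proof
  show "part_rel (A // E) \<subseteq> E"
    using quotient_eq_iff[OF assms] by (fastforce simp: part_rel_def)
  show "E \<subseteq> part_rel (A // E)"
  proof (rule subrelI)
    fix x y assume "(x, y) \<in> E"
    then show "(x, y) \<in> part_rel (A // E)"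
      using assms equiv_class_self[OF assms, of x] unfolding part_rel_def
      by (auto intro!: bexI[of _ "E `` {x}"] quotientI simp: equiv_def)
  qed
qed

lemma part_rel_eqv: "P \<in> partitions n \<Longrightarrow> equiv {..<n} (part_rel P)"
  using equiv_partition_on[of "{..<n}" P] by (simp add: partitions_def part_rel_def)

lemma quotient_part_rel: "P \<in> partitions n \<Longrightarrow> {..<n} // part_rel P = P"
  using partition_on_eq_quotient[of "{..<n}" P] by (simp add: partitions_def part_rel_def)

lemma quotient_partitions: "equiv {..<n} E \<Longrightarrow> {..<n} // E \<in> partitions n"
  using partition_on_quotient by (auto simp: partitions_def)

lemma refinement_iff:
  assumes "P \<in> partitions n" "Q \<in> partitions n"
  shows "(P, Q) \<in> refinement n \<longleftrightarrow> part_rel P \<subseteq> part_rel Q"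
proof
  assume PQ: "(P, Q) \<in> refinement n"
  show "part_rel P \<subseteq> part_rel Q"
  proof (rule subrelI)
    fix x y assume "(x, y) \<in> part_rel P"
    then obtain X where X: "X \<in> P" "x \<in> X" "y \<in> X" by (auto simp: part_rel_def)
    moreover from this obtain Y where "Y \<in> Q" "X \<subseteq> Y"
      using PQ unfolding refinement_def refines_def by blast
    ultimately show "(x, y) \<in> part_rel Q" by (auto simp: part_rel_def)
  qed
next
  assume sub: "part_rel P \<subseteq> part_rel Q"
  have "\<exists>Y\<in>Q. X \<subseteq> Y" if X: "X \<in> P" for X
  proof -
    have "X \<noteq> {}" using assms(1) X by (auto simp: partitions_def partition_on_def)
    then obtain x where x: "x \<in> X" by blast
    have xy: "(x, y) \<in> part_rel Q" if "y \<in> X" for y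
      using that x X sub by (auto simp: part_rel_def)
    then obtain Y where Y: "Y \<in> Q" "x \<in> Y" using x by (auto simp: part_rel_def)
    have "y \<in> Y" if yX: "y \<in> X" for y
    proof -
      obtain Z where Z: "Z \<in> Q" "x \<in> Z" "y \<in> Z" using xy[OF yX] by (auto simp: part_rel_def)
      have "disjoint Q" using assms(2) by (simp add: partitions_def partition_on_def)
      then have "Z = Y" using Y Z unfolding disjoint_def by blast
      then show ?thesis using Z by simp
    qed
    then show ?thesis using Y by blast
  qed
  then show "(P, Q) \<in> refinement n"
    using assms by (auto simp: refinement_def refines_def partitions_def)
qed

lemma refinement_sub: "refinement n \<subseteq> partitions n \<times> partitions n"
  by (auto simp: refinement_def refines_def partitions_def)

lemma eqv_ext: "E \<in> eqvs n \<Longrightarrow> D \<in> eqvs n \<Longrightarrow> {..<n} // E = {..<n} // D \<Longrightarrow> E = D"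
  by (metis mem_Collect_eq part_rel_quotient)

text \<open>Sending a node to the equivalence relation of its cluster encodes a partition prelattice
  without mentioning clusters.\<close>

lemma prelattice_eqv:
  assumes "partition_prelattice n X r"
  obtains \<kappa> where "\<kappa> ` X = eqvs n" "\<And>x y. x \<in> X \<Longrightarrow> y \<in> X \<Longrightarrow> (x, y) \<in> r \<longleftrightarrow> \<kappa> x \<subseteq> \<kappa> y"
proof -
  have pre: "preorder_on X r" using assms by (simp add: partition_prelattice_def)
  obtain h where h: "bij_betw h (X // mutual X r) (partitions n)"
    "\<forall>A\<in>X // mutual X r. \<forall>B\<in>X // mutual X r. (\<exists>x\<in>A. \<exists>y\<in>B. (x, y) \<in> r) \<longleftrightarrow> (h A, h B) \<in> refinement n"
    using assms by (auto simp: partition_prelattice_def)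
  define m where "m = mutual X r"
  have m: "equiv X m"
  proof (rule equivI)
    show "m \<subseteq> X \<times> X" by (auto simp: m_def mutual_def)
    show "refl_on X m" using pre by (auto simp: m_def mutual_def preorder_on_def refl_on_def)
    show "sym m" by (auto simp: m_def mutual_def sym_def)
    show "trans m"
      using pre unfolding m_def mutual_def preorder_on_def by (intro transI) (blast dest: transD)
  qed
  have cls: "m `` {x} \<in> X // m" "x \<in> m `` {x}" if "x \<in> X" for x
    using that equiv_class_self[OF m] by (auto intro: quotientI)
  have hp: "h (m `` {x}) \<in> partitions n" if "x \<in> X" for x
    using bij_betwE[OF h(1)] cls[OF that] m_def by blast
  let ?\<kappa> = "\<lambda>x. part_rel (h (m `` {x}))"
  have "?\<kappa> ` X \<subseteq> eqvs n" using hp part_rel_eqv by blast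
  moreover have "E \<in> ?\<kappa> ` X" if E: "E \<in> eqvs n" for E
  proof -
    have "{..<n} // E \<in> h ` (X // m)"
      using quotient_partitions E h(1) unfolding m_def bij_betw_def by blast
    then obtain x where "x \<in> X" "h (m `` {x}) = {..<n} // E"
      by (auto simp: quotient_def)
    then show ?thesis using part_rel_quotient E by (intro image_eqI[of _ _ x]) auto
  qed
  ultimately have "?\<kappa> ` X = eqvs n" by blast
  moreover have "(x, y) \<in> r \<longleftrightarrow> ?\<kappa> x \<subseteq> ?\<kappa> y" if xy: "x \<in> X" "y \<in> X" for x y
  proof -
    have "(\<exists>x'\<in>m `` {x}. \<exists>y'\<in>m `` {y}. (x', y') \<in> r) \<longleftrightarrow> (x, y) \<in> r"
    proof
      assume "\<exists>x'\<in>m `` {x}. \<exists>y'\<in>m `` {y}. (x', y') \<in> r"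
      then obtain x' y' where "(x, x') \<in> r" "(x', y') \<in> r" "(y', y) \<in> r"
        by (auto simp: m_def mutual_def)
      then show "(x, y) \<in> r" using pre by (meson preorder_on_def transD)
    qed (use cls xy in blast)
    then have "(x, y) \<in> r \<longleftrightarrow> (h (m `` {x}), h (m `` {y})) \<in> refinement n"
      using h(2) cls xy m_def by blast
    then show ?thesis using refinement_iff hp xy by blast
  qed
  ultimately show ?thesis by (rule that)
qed

lemma prelatticeI:
  assumes "r \<subseteq> X \<times> X" "\<kappa> ` X = eqvs n" "\<And>x y. x \<in> X \<Longrightarrow> y \<in> X \<Longrightarrow> (x, y) \<in> r \<longleftrightarrow> \<kappa> x \<subseteq> \<kappa> y"
  shows "partition_prelattice n X r"
proof -
  have pre: "preorder_on X r"
    unfolding preorder_on_def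
  proof (intro conjI)
    show "refl_on X r" using assms(3) by (auto simp: refl_on_def)
    show "trans r"
    proof (rule transI)
      fix x y z assume "(x, y) \<in> r" "(y, z) \<in> r"
      moreover from this have "x \<in> X" "y \<in> X" "z \<in> X" using assms(1) by auto
      ultimately show "(x, z) \<in> r" using assms(3) by blast
    qed
  qed fact
  have m: "mutual X r = {(x, y). x \<in> X \<and> y \<in> X \<and> \<kappa> x = \<kappa> y}"
    using assms(3) by (auto simp: mutual_def)
  define cl where "cl E = {x \<in> X. \<kappa> x = E}" for E
  have Q: "X // mutual X r = cl ` eqvs n"
    unfolding assms(2)[symmetric] quotient_def m cl_def by auto
  have ne: "\<exists>x. x \<in> cl E \<and> x \<in> X \<and> \<kappa> x = E" if "E \<in> eqvs n" for E
    using that unfolding assms(2)[symmetric] cl_def by blast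
  define h where "h A = {..<n} // \<kappa> (SOME x. x \<in> A)" for A
  have hcl: "h (cl E) = {..<n} // E" if E: "E \<in> eqvs n" for E
  proof -
    have "(SOME x. x \<in> cl E) \<in> cl E" using ne[OF E] by (metis someI_ex)
    then show ?thesis by (auto simp: h_def cl_def)
  qed
  have "bij_betw h (X // mutual X r) (partitions n)"
  proof (rule bij_betwI')
    fix A B assume "A \<in> X // mutual X r" "B \<in> X // mutual X r"
    then obtain E D where "E \<in> eqvs n" "D \<in> eqvs n" "A = cl E" "B = cl D" unfolding Q by blast
    then show "h A = h B \<longleftrightarrow> A = B" using hcl eqv_ext by metis
  next
    fix A assume "A \<in> X // mutual X r"
    then show "h A \<in> partitions n" unfolding Q using hcl quotient_partitions by auto
  next
    fix P assume P: "P \<in> partitions n"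
    then have "part_rel P \<in> eqvs n" using part_rel_eqv by blast
    then show "\<exists>A\<in>X // mutual X r. P = h A"
      unfolding Q using hcl quotient_part_rel[OF P] by (intro bexI[of _ "cl (part_rel P)"]) auto
  qed
  moreover have "(\<exists>x\<in>A. \<exists>y\<in>B. (x, y) \<in> r) \<longleftrightarrow> (h A, h B) \<in> refinement n"
    if AB: "A \<in> X // mutual X r" "B \<in> X // mutual X r" for A B
  proof -
    obtain E D where ED: "E \<in> eqvs n" "D \<in> eqvs n" "A = cl E" "B = cl D" using AB unfolding Q by blast
    have "(\<exists>x\<in>A. \<exists>y\<in>B. (x, y) \<in> r) \<longleftrightarrow> E \<subseteq> D"
      using ne[OF ED(1)] ne[OF ED(2)] assms(3) unfolding ED(3,4) cl_def by blast
    also have "\<dots> \<longleftrightarrow> (h A, h B) \<in> refinement n"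
      using ED hcl refinement_iff[OF quotient_partitions quotient_partitions, of n E D] part_rel_quotient
      by auto
    finally show ?thesis .
  qed
  ultimately show ?thesis using pre by (auto simp: partition_prelattice_def)
qed

section \<open>Maps of the partition lattice onto finite frames\<close>

text \<open>A bounded morphism from the lattice of equivalence relations, up to mutual accessibility in the
  target.\<close>

definition eqv_map :: "nat \<Rightarrow> 'w set \<Rightarrow> 'w rel \<Rightarrow> (nat rel \<Rightarrow> 'w) \<Rightarrow> bool" where
  "eqv_map n X r G \<longleftrightarrow> (\<forall>E\<in>eqvs n. G E \<in> X) \<and>
     (\<forall>E\<in>eqvs n. \<forall>D\<in>eqvs n. E \<subseteq> D \<longrightarrow> (G E, G D) \<in> r) \<and>
     (\<forall>E\<in>eqvs n. \<forall>y\<in>X. (G E, y) \<in> r \<longrightarrow> (\<exists>D\<in>eqvs n. E \<subseteq> D \<and> (G D, y) \<in> r \<and> (y, G D) \<in> r))"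

text \<open>Joining with the relation \<open>\<kappa> w\<close> retracts the lattice onto the cone above \<open>w\<close>. So what is
  refuted at an arbitrary node can be refuted at the discrete pattern.\<close>

lemma eqv_map_cone:
  assumes \<kappa>: "\<kappa> ` X = eqvs n" "\<And>x y. x \<in> X \<Longrightarrow> y \<in> X \<Longrightarrow> (x, y) \<in> r \<longleftrightarrow> \<kappa> x \<subseteq> \<kappa> y" and w: "w \<in> X"
  shows "\<exists>G. eqv_map n X r G \<and> (G (Id_on {..<n}), w) \<in> r \<and> (w, G (Id_on {..<n})) \<in> r"
proof -
  define J where "J E = (E \<union> \<kappa> w)\<^sup>+" for E
  define G where "G E = (SOME x. x \<in> X \<and> \<kappa> x = J E)" for E
  have eqX: "\<kappa> x \<in> eqvs n" if "x \<in> X" for x using \<kappa>(1) that by blast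
  have J: "J E \<in> eqvs n" if "E \<in> eqvs n" for E
    using that eqX[OF w] eqv_join by (auto simp: J_def)
  have G: "G E \<in> X" "\<kappa> (G E) = J E" if "E \<in> eqvs n" for E
  proof -
    have "J E \<in> \<kappa> ` X" using J[OF that] \<kappa>(1) by simp
    then have "\<exists>x. x \<in> X \<and> \<kappa> x = J E" by blast
    from someI_ex[OF this] show "G E \<in> X" "\<kappa> (G E) = J E" unfolding G_def by auto
  qed
  have sub: "E \<subseteq> J E" "\<kappa> w \<subseteq> J E" for E by (auto simp: J_def)
  have absorb: "J E = E" if "E \<in> eqvs n" "\<kappa> w \<subseteq> E" for E
    using that eqv_join_absorb unfolding J_def equiv_def by blast
  have mono: "(G E, G D) \<in> r" if "E \<in> eqvs n" "D \<in> eqvs n" "E \<subseteq> D" for E D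
  proof -
    have "J E \<subseteq> J D" unfolding J_def by (rule trancl_mono_subset) (use that in auto)
    then show ?thesis using \<kappa>(2) G that by auto
  qed
  have "\<exists>D\<in>eqvs n. E \<subseteq> D \<and> (G D, y) \<in> r \<and> (y, G D) \<in> r" if E: "E \<in> eqvs n" "y \<in> X" "(G E, y) \<in> r" for E y
  proof -
    have le: "J E \<subseteq> \<kappa> y" using \<kappa>(2)[of "G E" y] G[OF E(1)] E by auto
    have ky: "\<kappa> y \<in> eqvs n" by (rule eqX[OF E(2)])
    have "J (\<kappa> y) = \<kappa> y" using absorb[OF ky] le sub by blast
    then have "(G (\<kappa> y), y) \<in> r" "(y, G (\<kappa> y)) \<in> r" using \<kappa>(2) G[OF ky] E(2) by auto
    then show ?thesis using ky le sub by blast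
  qed
  then have "eqv_map n X r G" using G mono by (auto simp: eqv_map_def)
  moreover have "Id_on {..<n} \<subseteq> \<kappa> w" using eqX[OF w] by (auto simp: equiv_def refl_on_def)
  then have "J (Id_on {..<n}) = \<kappa> w"
    using eqv_join_absorb[of "\<kappa> w" "Id_on {..<n}"] eqX[OF w] by (auto simp: J_def equiv_def Un_commute)
  moreover have "Id_on {..<n} \<in> eqvs n" by (auto simp: equiv_def refl_on_def sym_def trans_def)
  ultimately show ?thesis using \<kappa>(2) G w by auto
qed

text \<open>A button is a pair of parameters; it is pushed by identifying them. Buttons are independent only
  as long as no other parameters are identified, so that the patterns below \<open>pairing m {..<m}\<close> have to
  be singled out.\<close>

definition pairing :: "nat \<Rightarrow> nat set \<Rightarrow> nat rel" where
  "pairing m A = {(x, y). x < 2 * m \<and> y < 2 * m \<and> (x = y \<or> x div 2 = y div 2 \<and> x div 2 \<in> A)}"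

lemma pairing_eqv: "pairing m A \<in> eqvs (2 * m)"
  by (auto simp: pairing_def equiv_def refl_on_def sym_def trans_def)

definition pushed :: "nat \<Rightarrow> nat rel \<Rightarrow> nat set" where
  "pushed m E = {i. i < m \<and> (2 * i, 2 * i + 1) \<in> E}"

lemma pushed_pairing: "A \<subseteq> {..<m} \<Longrightarrow> pushed m (pairing m A) = A"
  by (auto simp: pushed_def pairing_def)

lemma below_pairing:
  assumes "E \<in> eqvs (2 * m)" "E \<subseteq> pairing m {..<m}" "pushed m E \<subseteq> A"
  shows "E \<subseteq> pairing m A"
proof (rule subrelI)
  fix x y assume xy: "(x, y) \<in> E"
  then have p: "x < 2 * m" "y < 2 * m" "x = y \<or> x div 2 = y div 2"
    using assms(2) by (auto simp: pairing_def)
  show "(x, y) \<in> pairing m A"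
  proof (cases "x = y")
    case True
    then show ?thesis using p by (simp add: pairing_def)
  next
    case False
    define i where "i = x div 2"
    have e: "x div 2 = y div 2" using p(3) False by simp
    have a: "x = 2 * i + x mod 2" unfolding i_def by simp
    have b: "y = 2 * i + y mod 2" unfolding i_def e by simp
    have i: "x = 2 * i \<and> y = 2 * i + 1 \<or> y = 2 * i \<and> x = 2 * i + 1"
    proof (cases "even x")
      case True
      then have "x = 2 * i" using a by (simp add: even_iff_mod_2_eq_zero)
      moreover from this have "y mod 2 \<noteq> 0" using b False by auto
      then have "y = 2 * i + 1" using b by (simp add: mod_2_eq_odd)
      ultimately show ?thesis by blast
    next
      case odd: False
      then have "x = 2 * i + 1" using a by (simp add: mod_2_eq_odd)
      moreover from this have "y mod 2 \<noteq> 1" using b False by auto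
      then have "even y" by presburger
      then have "y = 2 * i" using b by (simp add: even_iff_mod_2_eq_zero)
      ultimately show ?thesis by blast
    qed
    moreover have "(y, x) \<in> E" using assms(1) xy by (auto simp: equiv_def dest: symD)
    ultimately have "(2 * i, 2 * i + 1) \<in> E" using xy by metis
    moreover have "i < m" using p(1) by (simp add: i_def less_mult_imp_div_less mult.commute)
    ultimately have "i \<in> A" using assms(3) unfolding pushed_def by blast
    then have "x div 2 \<in> A" by (simp add: i_def)
    then show ?thesis using p False by (simp add: pairing_def)
  qed
qed

text \<open>There is one button for each node. If the pattern only pushes buttons, and the nodes of the pushed ones
  form a chain together with \<open>w\<close>, then it is sent to a greatest one of these; all other patterns are
  sent to the greatest node \<open>t\<close>. A chain of nodes below \<open>y\<close> can be extended by \<open>y\<close>, whence the map is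
  bounded.\<close>

lemma eqv_map_directed:
  assumes "finite X" "preorder_on X r" "w \<in> X" "t \<in> X" "\<forall>x\<in>X. (w, x) \<in> r \<and> (x, t) \<in> r"
  shows "\<exists>n G. eqv_map n X r G \<and> (G (Id_on {..<n}), w) \<in> r \<and> (w, G (Id_on {..<n})) \<in> r"
proof -
  have r: "trans r" "refl_on X r" using assms(2) by (auto simp: preorder_on_def)
  obtain b where b: "bij_betw b {..<card X} X" using assms(1) ex_bij_betw_nat_finite by (metis atLeast0LessThan)
  define m where "m = card X"
  define S where "S E = insert w (b ` pushed m E)" for E
  define chain where "chain T \<longleftrightarrow> (\<forall>x\<in>T. \<forall>y\<in>T. (x, y) \<in> r \<or> (y, x) \<in> r)" for T
  define good where "good E \<longleftrightarrow> E \<subseteq> pairing m {..<m} \<and> chain (S E)" for E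
  define G where "G E = (if good E then SOME x. x \<in> S E \<and> (\<forall>y\<in>S E. (y, x) \<in> r) else t)" for E
  have bX: "b i \<in> X" if "i < m" for i using b that by (auto simp: m_def bij_betw_def)
  have SX: "S E \<subseteq> X" for E using assms(3) bX by (auto simp: S_def pushed_def)
  have Gg: "G E \<in> S E" "\<And>y. y \<in> S E \<Longrightarrow> (y, G E) \<in> r" if g: "good E" for E
  proof -
    have "\<exists>x\<in>S E. \<forall>y\<in>S E. (y, x) \<in> r"
    proof (rule finite_directed_top[OF _ subset_refl _ r(1)])
      show "finite (S E)" using SX assms(1) finite_subset by blast
      show "S E \<noteq> {}" by (auto simp: S_def)
      show "refl_on (S E) r" using r(2) SX by (auto simp: refl_on_def)
      show "\<exists>z\<in>S E. (x, z) \<in> r \<and> (y, z) \<in> r" if "x \<in> S E" "y \<in> S E" for x y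
      proof -
        have "(x, x) \<in> r" "(y, y) \<in> r" using that SX r(2) by (auto simp: refl_on_def)
        moreover have "(x, y) \<in> r \<or> (y, x) \<in> r" using that g unfolding good_def chain_def by blast
        ultimately show ?thesis using that by blast
      qed
    qed
    then have ex: "\<exists>x. x \<in> S E \<and> (\<forall>y\<in>S E. (y, x) \<in> r)" by blast
    from someI_ex[OF ex] show "G E \<in> S E" "\<And>y. y \<in> S E \<Longrightarrow> (y, G E) \<in> r"
      using g unfolding G_def by auto
  qed
  have GX: "G E \<in> X" for E using Gg(1) SX assms(4) by (cases "good E") (auto simp: G_def)
  have mono: "(G E, G D) \<in> r" if "E \<subseteq> D" for E D
  proof (cases "good D")
    case True
    have SS: "S E \<subseteq> S D" using that by (auto simp: S_def pushed_def)
    then have "good E" using True that unfolding good_def chain_def by blast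
    then show ?thesis using Gg[of E] Gg(2)[OF True] SS by blast
  next
    case False
    then show ?thesis using assms(5) GX[of E] by (auto simp: G_def)
  qed
  have zag: "\<exists>D\<in>eqvs (2 * m). E \<subseteq> D \<and> (G D, y) \<in> r \<and> (y, G D) \<in> r"
    if E: "E \<in> eqvs (2 * m)" "y \<in> X" "(G E, y) \<in> r" for E y
  proof (cases "good E")
    case True
    obtain j where j: "j < m" "y = b j" using b E(2) by (auto simp: bij_betw_def m_def)
    let ?A = "insert j (pushed m E)"
    let ?D = "pairing m ?A"
    have A: "?A \<subseteq> {..<m}" using j by (auto simp: pushed_def)
    have SD: "S ?D = insert y (S E)" using pushed_pairing[OF A] j by (auto simp: S_def)
    have le: "(x, y) \<in> r" if "x \<in> S E" for x
      using Gg(2)[OF True that] E(3) r(1) by (blast dest: transD)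
    have yy: "(y, y) \<in> r" using E(2) r(2) by (auto simp: refl_on_def)
    have "chain (S ?D)" using True le yy unfolding SD good_def chain_def by blast
    moreover have "?D \<subseteq> pairing m {..<m}" using A by (auto simp: pairing_def)
    ultimately have gD: "good ?D" by (simp add: good_def)
    have "(y, G ?D) \<in> r" using Gg(2)[OF gD] SD by simp
    moreover have "(G ?D, y) \<in> r" using Gg(1)[OF gD] SD le yy by auto
    moreover have "E \<subseteq> ?D" by (rule below_pairing[OF E(1)]) (use True in \<open>auto simp: good_def\<close>)
    ultimately show ?thesis using pairing_eqv by blast
  next
    case False
    then have "G E = t" by (simp add: G_def)
    then show ?thesis using E assms(5) by auto
  qed
  have "S (Id_on {..<2 * m}) = {w}" by (auto simp: S_def pushed_def)
  moreover have "(w, w) \<in> r" using assms(3,5) by blast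
  ultimately have "good (Id_on {..<2 * m})" "S (Id_on {..<2 * m}) = {w}"
    by (auto simp: good_def chain_def pairing_def)
  then have "G (Id_on {..<2 * m}) = w" using Gg(1) by blast
  then show ?thesis
    using GX mono zag \<open>(w, w) \<in> r\<close> by (intro exI[of _ "2 * m"] exI[of _ G]) (auto simp: eqv_map_def)
qed

section \<open>Simulating frames by quotients and functions\<close>

lemma samepat_ker: "samepat {..<n} \<mu> \<psi> \<longleftrightarrow> ker n \<mu> = ker n \<psi>"
  by (fastforce simp: samepat_def ker_def set_eq_iff)

lemma ker_quotient_map:
  assumes "equiv {..<n} E" shows "ker n (\<lambda>i. E `` {i}) = E"
proof -
  have "E `` {i} = E `` {j} \<longleftrightarrow> (i, j) \<in> E" if "i < n" "j < n" for i j
    using eq_equiv_class_iff[OF assms] that by simp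
  moreover have "E \<subseteq> {..<n} \<times> {..<n}" using assms by (auto simp: equiv_def)
  ultimately show ?thesis by (auto simp: ker_def)
qed

lemma quotient_realised:
  assumes "\<mu> ` {..<n} \<subseteq> V" "E \<in> eqvs n" "ker n \<mu> \<subseteq> E"
  shows "\<exists>V' h. V' \<subseteq> V \<and> V - \<mu> ` {..<n} \<subseteq> V' \<and> h \<in> hom_maps Surj V V' \<and> ker n (h \<circ> \<mu>) = E"
proof -
  have E: "equiv {..<n} E" using assms(2) by simp
  have coarse: "E `` {x} = E `` {y}" if "x \<in> {..<n}" "y \<in> {..<n}" "\<mu> x = \<mu> y" for x y
  proof -
    have "(x, y) \<in> E" using that assms(3) by (auto simp: ker_def)
    then show ?thesis by (rule equiv_class_eq[OF E])
  qed
  have "\<exists>V' h. V' \<subseteq> V \<and> V - \<mu> ` {..<n} \<subseteq> V' \<and> h \<in> hom_maps Surj V V' \<and>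
      samepat {..<n} (h \<circ> \<mu>) (\<lambda>i. E `` {i})"
    by (rule collapse[OF assms(1)]) (rule coarse)
  then show ?thesis
    unfolding samepat_ker ker_quotient_map[OF E] .
qed

lemma ker_inj: "inj_on \<nu> {..<n} \<Longrightarrow> ker n \<nu> = Id_on {..<n}"
  by (auto simp: ker_def inj_on_def)

text \<open>Quotients of the world by its named elements realise every coarser pattern, so the lattice of
  equivalence relations is simulated without any regard to sizes.\<close>

lemma not_valid_quotients:
  assumes C: "sets_cat \<U> k C" and k: "k \<in> {Func, Surj}" "Obj C = \<U> \<Longrightarrow> k = Surj"
    and X: "trans r" "refl_on X r" "antisym r" and G: "eqv_map n X r G"
    and w: "\<not> ksat X r V w p" "w \<in> X" "(G (Id_on {..<n}), w) \<in> r" "(w, G (Id_on {..<n})) \<in> r"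
    and W: "W \<in> Obj C" "inj_on \<nu> {..<n}" "\<nu> ` {..<n} \<subseteq> W"
  shows "p \<notin> Val_form C W L_eq"
proof (rule not_valid_by_simulation(1)[where F = "\<lambda>E _. G E" and K = "Obj C" and n = n and N = 0
      and k = k and \<nu> = \<nu>, OF _ X(1,2) w(1,2) W(1,3)])
  show "Hom C = hom_maps k" using C by (simp add: sets_cat_def)
  show "alike r V p (G (ker n \<nu>)) w"
    using w(3,4) ker_inj[OF W(2)] antisymD[OF X(3) w(3,4)] by (auto simp: alike_def)
  fix U \<mu> assume U: "U \<in> Obj C" "\<mu> ` {..<n} \<subseteq> U"
  show "G (ker n \<mu>) \<in> X" using G ker_eqv by (auto simp: eqv_map_def)
  show "U' \<in> Obj C \<and> (G (ker n \<mu>), G (ker n (g \<circ> \<mu>))) \<in> r" if "U' \<in> Obj C" for U' and g :: "'a \<Rightarrow> 'a"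
  proof -
    have "ker n \<mu> \<in> eqvs n" "ker n (g \<circ> \<mu>) \<in> eqvs n" using ker_eqv by auto
    then show ?thesis using that G ker_mono[of n \<mu> g] by (simp add: eqv_map_def)
  qed
  fix y assume y: "y \<in> X" "(G (ker n \<mu>), y) \<in> r"
  have "ker n \<mu> \<in> eqvs n" using ker_eqv by auto
  then obtain D where D: "D \<in> eqvs n" "ker n \<mu> \<subseteq> D" "(G D, y) \<in> r" "(y, G D) \<in> r"
    using G y unfolding eqv_map_def by blast
  obtain U' h where h: "U' \<subseteq> U" "U - \<mu> ` {..<n} \<subseteq> U'" "h \<in> hom_maps Surj U U'" "ker n (h \<circ> \<mu>) = D"
    using quotient_realised[OF U(2) D(1,2)] by blast
  have "infinite U'" if "infinite U"
  proof -
    have "infinite (U - \<mu> ` {..<n})" using that by simp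
    then show ?thesis using h(2) finite_subset by blast
  qed
  then have "U' \<in> Obj C"
    using C U(1) h(1) universe_subset[of \<U> U U'] by (auto simp: sets_cat_def)
  moreover have "h \<in> hom_maps k U U'" using h(3) k(1) by auto
  moreover have "alike r V p (G D) y"
    using D antisymD[OF X(3) D(3,4)] by (auto simp: alike_def)
  ultimately show "\<exists>U'\<in>Obj C. \<exists>g\<in>hom_maps k U U'. alike r V p (G (ker n (g \<circ> \<mu>))) y"
    using h(4) by blast
qed

lemma function_realised:
  assumes "finite U'" "n \<le> card U'" "U' \<noteq> {}" "\<mu> ` {..<n} \<subseteq> U" "E \<in> eqvs n" "ker n \<mu> \<subseteq> E"
  shows "\<exists>g\<in>hom_maps Func U U'. ker n (g \<circ> \<mu>) = E"
proof -
  have E: "equiv {..<n} E" using assms(5) by simp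
  obtain V' h where h: "h \<in> hom_maps Surj U V'" "ker n (h \<circ> \<mu>) = E"
    using quotient_realised[OF assms(4-6)] by blast
  let ?S = "(h \<circ> \<mu>) ` {..<n}"
  have "card ?S \<le> card U'" using card_image_le[of "{..<n}" "h \<circ> \<mu>"] assms(2) by simp
  then obtain f where f: "inj_on f ?S" "f ` ?S \<subseteq> U'"
    using card_le_inj[of ?S U'] assms(1) by auto
  obtain u where u: "u \<in> U'" using assms(3) by blast
  define g where "g = (\<lambda>v\<in>U. if h v \<in> ?S then f (h v) else u)"
  have "f s \<in> U'" if "s \<in> ?S" for s using f(2) that by blast
  then have "g \<in> hom_maps Func U U'"
    unfolding hom_maps.simps g_def restrict_PiE_iff using u by simp
  moreover have "(g \<circ> \<mu>) i = f ((h \<circ> \<mu>) i)" if "i < n" for i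
    using that assms(4) by (auto simp: g_def)
  then have "ker n (g \<circ> \<mu>) = ker n (h \<circ> \<mu>)"
    using f(1) by (auto simp: ker_def inj_on_def)
  ultimately show ?thesis using h(2) by auto
qed

lemma pattern_enumeration:
  fixes p :: pm
  obtains pat :: "nat \<Rightarrow> nat set" and m where "pat ` {..<m} = Pow (pvars p)"
proof -
  have "finite (Pow (pvars p))" by simp
  then obtain f :: "nat \<Rightarrow> nat set" and m where "Pow (pvars p) = f ` {i. i < m}"
    using finite_imp_nat_seg_image_inj_on by metis
  then show ?thesis using that[of f m] by (simp add: lessThan_def)
qed

text \<open>The pattern \<open>E\<close> selects the cluster of \<open>G E\<close>, and the size of the world selects a node of the cluster by the
  set of variables that are true there. Nodes that agree in this respect satisfy the same formulas.\<close>

lemma not_valid_Func: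
  assumes U: "set_universe \<U>" and X: "trans r" "refl_on X r" and G: "eqv_map n X r G"
    and w: "\<not> ksat X r V w p" "w \<in> X" "(G (Id_on {..<n}), w) \<in> r" "(w, G (Id_on {..<n})) \<in> r"
    and W: "W \<in> \<U>" "W \<noteq> {}" "inj_on \<nu> {..<n}" "\<nu> ` {..<n} \<subseteq> W"
  shows "p \<notin> Val_form (Sets \<U> Func) W L_eq" "n = 0 \<Longrightarrow> p \<notin> Val_sent (Sets \<U> Func) W L_eq"
proof -
  obtain pat :: "nat \<Rightarrow> nat set" and m where pat: "pat ` {..<m} = Pow (pvars p)"
    by (rule pattern_enumeration)
  (* Sizes from K on leave room for n distinct parameters and are not the size of W, which must
     select the set of variables true at w. *)
  define K where "K = Suc (max n (card W))"
  define ty where "ty x = {i \<in> pvars p. x \<in> V i}" for x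
  have "ty w \<in> pat ` {..<m}" unfolding pat by (auto simp: ty_def)
  then obtain jw where jw: "jw < m" "pat jw = ty w" by auto
  define idx where "idx t = (if K \<le> t \<and> t < K + m then t - K else jw)" for t
  define mem where "mem x j = (if \<exists>y\<in>X. (x, y) \<in> r \<and> (y, x) \<in> r \<and> ty y = pat j
      then SOME y. y \<in> X \<and> (x, y) \<in> r \<and> (y, x) \<in> r \<and> ty y = pat j else x)" for x j
  define F where "F E t = mem (G E) (idx t)" for E t
  have mem: "mem x j \<in> X \<and> (x, mem x j) \<in> r \<and> (mem x j, x) \<in> r" if "x \<in> X" for x j
  proof (cases "\<exists>y\<in>X. (x, y) \<in> r \<and> (y, x) \<in> r \<and> ty y = pat j")
    case True
    then have "\<exists>y. y \<in> X \<and> (x, y) \<in> r \<and> (y, x) \<in> r \<and> ty y = pat j" by blast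
    from someI_ex[OF this] show ?thesis using True unfolding mem_def by auto
  next
    case False
    have "(x, x) \<in> r" using X(2) that by (auto simp: refl_on_def)
    then show ?thesis using False that unfolding mem_def by auto
  qed
  have mem_alike: "alike r V p (mem x j) y"
    if "x \<in> X" "y \<in> X" "(x, y) \<in> r" "(y, x) \<in> r" "ty y = pat j" for x y j
  proof -
    have ex: "\<exists>y. y \<in> X \<and> (x, y) \<in> r \<and> (y, x) \<in> r \<and> ty y = pat j" using that by blast
    from someI_ex[OF ex] have "ty (mem x j) = ty y"
      using that unfolding mem_def by auto
    then have "\<forall>i\<in>pvars p. mem x j \<in> V i \<longleftrightarrow> y \<in> V i" unfolding ty_def by blast
    moreover have "(mem x j, y) \<in> r" "(y, mem x j) \<in> r"
      using mem[OF that(1), of j] that(3,4) X(1) by (blast dest: transD)+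
    ultimately show ?thesis by (simp add: alike_def)
  qed
  have GX: "G (ker n \<mu>) \<in> X" for \<mu> :: "nat \<Rightarrow> 'a" using G ker_eqv by (auto simp: eqv_map_def)
  have start: "alike r V p (F (ker n \<nu>) (trunc (K + m) W)) w"
  proof -
    have "idx (trunc (K + m) W) = jw"
    proof (cases "finite W")
      case True
      have less: "card W < K" by (simp add: K_def less_Suc_eq_le)
      then have "trunc (K + m) W = card W" by (intro trunc_less True) auto
      then show ?thesis using less by (simp add: idx_def)
    next
      case False
      then show ?thesis by (simp add: idx_def trunc_def large_def)
    qed
    then show ?thesis
      unfolding F_def using mem_alike[OF GX w(2), of \<nu> jw] w(3,4) ker_inj[OF W(3)] jw by simp
  qed
  have node: "F (ker n \<mu>) t \<in> X" for \<mu> :: "nat \<Rightarrow> 'a" and t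
    unfolding F_def using mem[OF GX] by blast
  have zig: "(F (ker n \<mu>) t, F (ker n (g \<circ> \<mu>)) t') \<in> r" for \<mu> :: "nat \<Rightarrow> 'a" and g :: "'a \<Rightarrow> 'a" and t t'
  proof -
    have "ker n \<mu> \<in> eqvs n" "ker n (g \<circ> \<mu>) \<in> eqvs n" using ker_eqv by auto
    then have "(G (ker n \<mu>), G (ker n (g \<circ> \<mu>))) \<in> r"
      using G ker_mono[of n \<mu> g] by (simp add: eqv_map_def)
    then show ?thesis
      unfolding F_def using mem[OF GX, of \<mu> "idx t"] mem[OF GX, of "g \<circ> \<mu>" "idx t'"] X(1)
      by (blast dest: transD)
  qed
  have zag: "\<exists>U'\<in>\<U> - {{}}. \<exists>g\<in>hom_maps Func U U'. alike r V p (F (ker n (g \<circ> \<mu>)) (trunc (K + m) U')) y"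
    if a: "\<mu> ` {..<n} \<subseteq> U" "y \<in> X" "(F (ker n \<mu>) t, y) \<in> r" for U and \<mu> :: "nat \<Rightarrow> 'a" and y t
  proof -
    have "(G (ker n \<mu>), y) \<in> r"
      using mem[OF GX, of \<mu> "idx t"] a(3) X(1) unfolding F_def by (blast dest: transD)
    moreover have "ker n \<mu> \<in> eqvs n" using ker_eqv by auto
    ultimately obtain D where D: "D \<in> eqvs n" "ker n \<mu> \<subseteq> D" "(G D, y) \<in> r" "(y, G D) \<in> r"
      using G a(2) unfolding eqv_map_def by blast
    have "ty y \<in> pat ` {..<m}" unfolding pat by (auto simp: ty_def)
    then obtain j where j: "j < m" "pat j = ty y" by auto
    obtain U' where U': "U' \<in> \<U>" "finite U'" "card U' = K + j" using finite_world_exists[OF U] by blast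
    then have ne: "U' \<noteq> {}" and le: "n \<le> card U'" by (auto simp: K_def)
    obtain g where g: "g \<in> hom_maps Func U U'" "ker n (g \<circ> \<mu>) = D"
      using function_realised[OF U'(2) le ne a(1) D(1,2)] by blast
    have "trunc (K + m) U' = K + j" by (rule trunc_less) (use U' j in auto)
    then have "idx (trunc (K + m) U') = j" using j by (simp add: idx_def)
    moreover have "G D \<in> X" using G D(1) by (simp add: eqv_map_def)
    ultimately have "alike r V p (F D (trunc (K + m) U')) y"
      unfolding F_def using mem_alike[of "G D" y j] D(3,4) a(2) j by simp
    then show ?thesis using U'(1) ne g by blast
  qed
  have wK: "W \<in> \<U> - {{}}" using W by simp
  have ne: "U' \<noteq> {}" if "g \<in> hom_maps Func U U'" "U \<noteq> {}" for U U' :: "'a set" and g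
    using that hom_image by fastforce
  have Hom: "Hom (Sets \<U> Func) = hom_maps Func" by simp
  have zig': "U' \<in> \<U> - {{}} \<and> (F (ker n \<mu>) (trunc (K + m) U), F (ker n (g \<circ> \<mu>)) (trunc (K + m) U')) \<in> r"
    if "U \<in> \<U> - {{}}" "U' \<in> Obj (Sets \<U> Func)" "g \<in> hom_maps Func U U'"
    for U U' and \<mu> :: "nat \<Rightarrow> 'a" and g
    using that(1,2) ne[OF that(3)] zig by simp
  have zag': "\<exists>U'\<in>Obj (Sets \<U> Func). \<exists>g\<in>hom_maps Func U U'.
      alike r V p (F (ker n (g \<circ> \<mu>)) (trunc (K + m) U')) y"
    if "\<mu> ` {..<n} \<subseteq> U" "y \<in> X" "(F (ker n \<mu>) (trunc (K + m) U), y) \<in> r" for U and \<mu> :: "nat \<Rightarrow> 'a" and y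
    using zag[OF that] unfolding Obj_Sets by blast
  note sim = not_valid_by_simulation[where F = F and K = "\<U> - {{}}" and n = n and N = "K + m"
      and k = Func and \<nu> = \<nu> and C = "Sets \<U> Func", OF Hom X w(1,2) wK W(4) start node zig' zag']
  show "p \<notin> Val_form (Sets \<U> Func) W L_eq" by (rule sim(1); assumption)
  show "p \<notin> Val_sent (Sets \<U> Func) W L_eq" if "n = 0" by (rule sim(2); (rule that | assumption))
qed

section \<open>Finite worlds with parameters\<close>

text \<open>A world accessible from \<open>W\<close> accesses precisely those whose map from \<open>W\<close> has the same or a larger
  kernel. This is why kernels determine the accessibility relation.\<close>

lemma factor_hom:
  assumes f: "f \<in> hom_maps k W U" "f' \<in> hom_maps k W U'" and k: "k \<in> {Func, Surj}" and W: "W \<noteq> {}"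
    and eq: "\<And>x y. x \<in> W \<Longrightarrow> y \<in> W \<Longrightarrow> f x = f y \<Longrightarrow> f' x = f' y"
  shows "\<exists>g\<in>hom_maps k U U'. compose W g f = f'"
proof -
  obtain w where w: "w \<in> W" using W by blast
  define g where "g = (\<lambda>u\<in>U. if u \<in> f ` W then f' (inv_into W f u) else f' w)"
  have gf: "g (f x) = f' x" if x: "x \<in> W" for x
  proof -
    have "f' (inv_into W f (f x)) = f' x"
      by (rule eq[OF inv_into_into[OF imageI[OF x]] x f_inv_into_f[OF imageI[OF x]]])
    then show ?thesis using x hom_image[OF f(1) x] by (simp add: g_def)
  qed
  have "g u \<in> U'" if u: "u \<in> U" for u
  proof (cases "u \<in> f ` W")
    case True
    then show ?thesis using gf hom_image[OF f(2)] by auto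
  next
    case False
    then show ?thesis using u hom_image[OF f(2) w] by (simp add: g_def)
  qed
  then have E: "g \<in> U \<rightarrow>\<^sub>E U'" by (auto simp: g_def)
  have "g \<in> hom_maps k U U'"
  proof (cases "k = Surj")
    case True
    then have "f ` W = U" "f' ` W = U'" using f by auto
    moreover have "g ` f ` W = f' ` W" by (simp add: image_image gf)
    ultimately have "g ` U = U'" by simp
    then show ?thesis using E True by auto
  qed (use k E in auto)
  moreover have "compose W g f = f'"
  proof
    fix x show "compose W g f x = f' x"
    proof (cases "x \<in> W")
      case False
      then show ?thesis using PiE_arb[OF hom_PiE[OF f(2)] False] by (simp add: compose_def)
    qed (simp add: compose_def gf)
  qed
  ultimately show ?thesis by blast
qed

definition wtype :: "'a setcat \<Rightarrow> nat \<Rightarrow> (nat \<Rightarrow> 'a) \<Rightarrow> (nat \<Rightarrow> 'a) \<Rightarrow> (nat \<Rightarrow> fm) \<Rightarrow> pm \<Rightarrow>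
    'a set \<Rightarrow> ('a \<Rightarrow> 'a) \<Rightarrow> nat rel \<times> nat set" where
  "wtype C n a \<nu> \<sigma> p U f = (ker n (f \<circ> a), {i \<in> pvars p. sat C U (f \<circ> \<nu>) (\<sigma> i)})"

text \<open>The type of a map out of \<open>W\<close> consists of its kernel, transported to \<open>{..<n}\<close> by an enumeration of \<open>W\<close>,
  and of the substituted formulas that are true at its target. For functions, several types may share a
  kernel and form a cluster of a prelattice; for surjections, the kernel determines the type.\<close>

locale finite_world =
  fixes \<U> :: "'a set set" and k :: mor_class and W :: "'a set" and n :: nat and a \<nu> :: "nat \<Rightarrow> 'a"
    and \<sigma> :: "nat \<Rightarrow> fm" and p :: pm
  assumes U: "set_universe \<U>" and k: "k \<in> {Func, Surj}" and W: "W \<in> \<U>" "W \<noteq> {}"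
    and a: "bij_betw a {..<n} W" and \<sigma>: "\<And>i. \<nu> ` fv (\<sigma> i) \<subseteq> W"
begin

abbreviation "tp \<equiv> wtype (Sets \<U> k) n a \<nu> \<sigma> p"

definition types :: "(nat rel \<times> nat set) set" where
  "types = {tp U f | U f. U \<in> \<U> \<and> f \<in> hom_maps k W U}"

definition types_rel :: "(nat rel \<times> nat set \<Rightarrow> 'x) \<Rightarrow> 'x rel" where
  "types_rel node = {(node s, node s') | s s'. s \<in> types \<and> s' \<in> types \<and> fst s \<subseteq> fst s'}"

lemma finite_types: "finite types"
  by (rule finite_subset[of _ "Pow ({..<n} \<times> {..<n}) \<times> Pow (pvars p)"])
    (auto simp: types_def wtype_def ker_def)

lemma aW: "a ` {..<n} = W"
  using a by (simp add: bij_betw_def)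

lemma types_onto: "fst ` types = eqvs n"
proof
  show "fst ` types \<subseteq> eqvs n" using ker_eqv by (auto simp: types_def wtype_def)
  show "eqvs n \<subseteq> fst ` types"
  proof
    fix E assume E: "E \<in> eqvs n"
    have "ker n a = Id_on {..<n}" using a by (intro ker_inj) (simp add: bij_betw_def)
    then have "ker n a \<subseteq> E" using E by (auto simp: equiv_def refl_on_def)
    then obtain V h where h: "V \<subseteq> W" "h \<in> hom_maps Surj W V" "ker n (h \<circ> a) = E"
      using quotient_realised[of a n W E] E aW by blast
    have "h \<in> hom_maps k W V" using h(2) k by auto
    moreover have "V \<in> \<U>" using universe_subset[OF U W(1) h(1)] .
    ultimately have "tp V h \<in> types" by (auto simp: types_def)
    then show "E \<in> fst ` types" using h(3) by (intro image_eqI[of _ _ "tp V h"]) (auto simp: wtype_def)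
  qed
qed

lemma types_successors:
  assumes "V \<in> \<U>" "f \<in> hom_maps k W V"
  shows "{s \<in> types. fst (tp V f) \<subseteq> fst s} = {tp V' (compose W g f) | V' g. V' \<in> \<U> \<and> g \<in> hom_maps k V V'}"
proof (intro equalityI subsetI)
  fix s assume s: "s \<in> {s \<in> types. fst (tp V f) \<subseteq> fst s}"
  then obtain V' f' where f': "s = tp V' f'" "V' \<in> \<U>" "f' \<in> hom_maps k W V'" by (auto simp: types_def)
  have "f' x = f' y" if xy: "x \<in> W" "y \<in> W" "f x = f y" for x y
  proof -
    obtain i j where "i < n" "x = a i" "j < n" "y = a j" using xy(1,2) unfolding aW[symmetric] by auto
    then show ?thesis using s xy(3) f' by (auto simp: wtype_def ker_def)
  qed
  then obtain g where "g \<in> hom_maps k V V'" "compose W g f = f'"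
    using factor_hom[OF assms(2) f'(3) k W(2)] by blast
  then show "s \<in> {tp V' (compose W g f) | V' g. V' \<in> \<U> \<and> g \<in> hom_maps k V V'}" using f' by blast
next
  fix s assume "s \<in> {tp V' (compose W g f) | V' g. V' \<in> \<U> \<and> g \<in> hom_maps k V V'}"
  then obtain V' g where g: "s = tp V' (compose W g f)" "V' \<in> \<U>" "g \<in> hom_maps k V V'" by blast
  have "s \<in> types" using g comp_hom[OF assms(2) g(3)] by (auto simp: types_def)
  moreover have "fst (tp V f) \<subseteq> fst s" using aW unfolding g(1) by (auto simp: wtype_def ker_def compose_def)
  ultimately show "s \<in> {s \<in> types. fst (tp V f) \<subseteq> fst s}" by blast
qed

lemma types_truth:
  fixes node :: "nat rel \<times> nat set \<Rightarrow> 'x"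
  assumes node: "inj_on node types"
  shows "pvars q \<subseteq> pvars p \<Longrightarrow> V \<in> \<U> \<Longrightarrow> f \<in> hom_maps k W V \<Longrightarrow>
    ksat (node ` types) (types_rel node) (\<lambda>i. {node s | s. s \<in> types \<and> i \<in> snd s}) (node (tp V f)) q \<longleftrightarrow>
    sat (Sets \<U> k) V (f \<circ> \<nu>) (inst \<sigma> q)"
proof (induction q arbitrary: V f)
  case (PVar i)
  have t: "tp V f \<in> types" using PVar by (auto simp: types_def)
  have "node (tp V f) \<in> {node s | s. s \<in> types \<and> i \<in> snd s} \<longleftrightarrow> i \<in> snd (tp V f)"
    using t inj_onD[OF node _ t] by blast
  moreover have "i \<in> snd (tp V f) \<longleftrightarrow> sat (Sets \<U> k) V (f \<circ> \<nu>) (\<sigma> i)"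
    using PVar by (simp add: wtype_def)
  ultimately show ?case unfolding ksat.simps inst.simps by blast
next
  case (PBox q)
  have t: "tp V f \<in> types" using PBox.prems by (auto simp: types_def)
  have sub: "pvars q \<subseteq> pvars p" using PBox.prems(1) by simp
  let ?k = "\<lambda>x. ksat (node ` types) (types_rel node) (\<lambda>i. {node s | s. s \<in> types \<and> i \<in> snd s}) x q"
  have rel: "(node (tp V f), node s) \<in> types_rel node \<longleftrightarrow> fst (tp V f) \<subseteq> fst s" if "s \<in> types" for s
    using that t inj_onD[OF node] unfolding types_rel_def by blast
  have "ksat (node ` types) (types_rel node) (\<lambda>i. {node s | s. s \<in> types \<and> i \<in> snd s}) (node (tp V f)) (PBox q)
      \<longleftrightarrow> (\<forall>s\<in>{s \<in> types. fst (tp V f) \<subseteq> fst s}. ?k (node s))"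
    using rel by auto
  also have "\<dots> \<longleftrightarrow> (\<forall>V'\<in>\<U>. \<forall>g\<in>hom_maps k V V'. ?k (node (tp V' (compose W g f))))"
    unfolding types_successors[OF PBox.prems(2,3)] by blast
  also have "\<dots> \<longleftrightarrow> (\<forall>V'\<in>\<U>. \<forall>g\<in>hom_maps k V V'. sat (Sets \<U> k) V' (compose W g f \<circ> \<nu>) (inst \<sigma> q))"
    using PBox.IH[OF sub _ comp_hom[OF PBox.prems(3)]] by blast
  also have "\<dots> \<longleftrightarrow> (\<forall>V'\<in>\<U>. \<forall>g\<in>hom_maps k V V'. sat (Sets \<U> k) V' (g \<circ> (f \<circ> \<nu>)) (inst \<sigma> q))"
  proof -
    have "\<nu> ` fv (inst \<sigma> q) \<subseteq> W" using \<sigma> unfolding fv_inst by blast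
    then have "sat (Sets \<U> k) V' (compose W g f \<circ> \<nu>) (inst \<sigma> q) \<longleftrightarrow> sat (Sets \<U> k) V' (g \<circ> (f \<circ> \<nu>)) (inst \<sigma> q)"
      for V' g by (intro sat_cong) (auto simp: compose_def)
    then show ?thesis by simp
  qed
  finally show ?case unfolding inst.simps sat.simps Obj_Sets Hom_Sets .
next
  case (PDia q)
  have t: "tp V f \<in> types" using PDia.prems by (auto simp: types_def)
  have sub: "pvars q \<subseteq> pvars p" using PDia.prems(1) by simp
  let ?k = "\<lambda>x. ksat (node ` types) (types_rel node) (\<lambda>i. {node s | s. s \<in> types \<and> i \<in> snd s}) x q"
  have rel: "(node (tp V f), node s) \<in> types_rel node \<longleftrightarrow> fst (tp V f) \<subseteq> fst s" if "s \<in> types" for s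
    using that t inj_onD[OF node] unfolding types_rel_def by blast
  have "ksat (node ` types) (types_rel node) (\<lambda>i. {node s | s. s \<in> types \<and> i \<in> snd s}) (node (tp V f)) (PDia q)
      \<longleftrightarrow> (\<exists>s\<in>{s \<in> types. fst (tp V f) \<subseteq> fst s}. ?k (node s))"
    unfolding ksat.simps using rel by blast
  also have "\<dots> \<longleftrightarrow> (\<exists>V'\<in>\<U>. \<exists>g\<in>hom_maps k V V'. ?k (node (tp V' (compose W g f))))"
    unfolding types_successors[OF PDia.prems(2,3)] by blast
  also have "\<dots> \<longleftrightarrow> (\<exists>V'\<in>\<U>. \<exists>g\<in>hom_maps k V V'. sat (Sets \<U> k) V' (compose W g f \<circ> \<nu>) (inst \<sigma> q))"
    using PDia.IH[OF sub _ comp_hom[OF PDia.prems(3)]] by blast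
  also have "\<dots> \<longleftrightarrow> (\<exists>V'\<in>\<U>. \<exists>g\<in>hom_maps k V V'. sat (Sets \<U> k) V' (g \<circ> (f \<circ> \<nu>)) (inst \<sigma> q))"
  proof -
    have "\<nu> ` fv (inst \<sigma> q) \<subseteq> W" using \<sigma> unfolding fv_inst by blast
    then have "sat (Sets \<U> k) V' (compose W g f \<circ> \<nu>) (inst \<sigma> q) \<longleftrightarrow> sat (Sets \<U> k) V' (g \<circ> (f \<circ> \<nu>)) (inst \<sigma> q)"
      for V' g by (intro sat_cong) (auto simp: compose_def)
    then show ?thesis by simp
  qed
  finally show ?case unfolding inst.simps sat.simps Obj_Sets Hom_Sets .
qed auto

lemma types_valid:
  fixes node :: "nat rel \<times> nat set \<Rightarrow> 'x"
  assumes node: "inj_on node types" and p: "p \<in> frame_valid (node ` types) (types_rel node)"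
  shows "sat (Sets \<U> k) W \<nu> (inst \<sigma> p)"
proof -
  have id: "(\<lambda>x\<in>W. x) \<in> hom_maps k W W" by (rule id_hom)
  have "node (tp W (\<lambda>x\<in>W. x)) \<in> node ` types" using W(1) id unfolding types_def by blast
  then have "sat (Sets \<U> k) W ((\<lambda>x\<in>W. x) \<circ> \<nu>) (inst \<sigma> p)"
    using p types_truth[OF node subset_refl W(1) id] unfolding frame_valid_def by blast
  moreover have "\<nu> ` fv (inst \<sigma> p) \<subseteq> W" using \<sigma> unfolding fv_inst by blast
  then have "sat (Sets \<U> k) W ((\<lambda>x\<in>W. x) \<circ> \<nu>) (inst \<sigma> p) \<longleftrightarrow> sat (Sets \<U> k) W \<nu> (inst \<sigma> p)"
    by (intro sat_cong) auto
  ultimately show ?thesis by blast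
qed

end

lemma finite_enumeration:
  assumes "finite W" "card W = n" obtains a where "bij_betw a {..<n} W"
  using ex_bij_betw_nat_finite[OF assms(1)] assms(2) by (auto simp: atLeast0LessThan)

lemma Prepartition_sound:
  assumes "set_universe \<U>" "infinite (UNIV :: 'w set)" "W \<in> \<U>" "finite W" "card W = n" "n > 0"
  shows "Prepartition TYPE('w) n \<subseteq> Val_form (Sets \<U> Func) W UNIV"
proof
  fix p assume p: "p \<in> Prepartition TYPE('w) n"
  show "p \<in> Val_form (Sets \<U> Func) W UNIV"
    unfolding Val_form_def
  proof (intro CollectI allI impI)
    fix \<sigma> :: "nat \<Rightarrow> fm" and \<nu> assume \<sigma>: "\<forall>i. \<sigma> i \<in> UNIV \<and> \<nu> ` fv (\<sigma> i) \<subseteq> W"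
    obtain a where a: "bij_betw a {..<n} W" by (rule finite_enumeration[OF assms(4,5)])
    interpret finite_world \<U> Func W n a \<nu> \<sigma> p
      by standard (use assms a \<sigma> in auto)
    obtain B :: "'w set" where B: "finite B" "card B = card types"
      using infinite_arbitrarily_large[OF assms(2)] by blast
    then obtain node where node: "bij_betw node types B" using finite_same_card_bij finite_types by metis
    then have inj: "inj_on node types" by (simp add: bij_betw_def)
    let ?\<kappa> = "\<lambda>x. fst (inv_into types node x)"
    have "partition_prelattice n (node ` types) (types_rel node)"
    proof (rule prelatticeI)
      show "types_rel node \<subseteq> node ` types \<times> node ` types" by (auto simp: types_rel_def)
      show "?\<kappa> ` node ` types = eqvs n"
        unfolding types_onto[symmetric] using inj by (force simp: image_image)
      show "(x, y) \<in> types_rel node \<longleftrightarrow> ?\<kappa> x \<subseteq> ?\<kappa> y" if xy: "x \<in> node ` types" "y \<in> node ` types" for x y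
      proof -
        obtain s s' where s: "s \<in> types" "x = node s" "s' \<in> types" "y = node s'" using xy by blast
        then have "(x, y) \<in> types_rel node \<longleftrightarrow> fst s \<subseteq> fst s'"
          using inj_onD[OF inj] unfolding types_rel_def by blast
        then show ?thesis using s inj by simp
      qed
    qed
    then show "sat (Sets \<U> Func) W \<nu> (inst \<sigma> p)"
      using types_valid[OF inj] p unfolding Prepartition_def by blast
  qed
qed

lemma Partition_sound:
  assumes "set_universe \<U>" "W \<in> \<U>" "finite W" "card W = n" "n > 0"
  shows "Partition n \<subseteq> Val_form (Sets \<U> Surj) W UNIV"
proof
  fix p assume p: "p \<in> Partition n"
  show "p \<in> Val_form (Sets \<U> Surj) W UNIV"
    unfolding Val_form_def
  proof (intro CollectI allI impI)
    fix \<sigma> :: "nat \<Rightarrow> fm" and \<nu> assume \<sigma>: "\<forall>i. \<sigma> i \<in> UNIV \<and> \<nu> ` fv (\<sigma> i) \<subseteq> W"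
    obtain a where a: "bij_betw a {..<n} W" by (rule finite_enumeration[OF assms(3,4)])
    interpret finite_world \<U> Surj W n a \<nu> \<sigma> p
      by standard (use assms a \<sigma> in auto)
    (* Surjections with the same kernel have targets of the same size. *)
    have det: "tp V f = tp V' f'"
      if V: "V \<in> \<U>" "f \<in> hom_maps Surj W V" "V' \<in> \<U>" "f' \<in> hom_maps Surj W V'"
        "ker n (f \<circ> a) = ker n (f' \<circ> a)" for V V' f f'
    proof -
      have fW: "(f \<circ> a) ` {..<n} = V" "(f' \<circ> a) ` {..<n} = V'"
        using V(2,4) aW by (auto simp: image_comp[symmetric])
      have pat: "samepat {..<n} (f \<circ> a) (f' \<circ> a)" using V(5) by (simp add: samepat_ker)
      have "card V = card V'" using bij_betw_same_card[OF samepat_card(1)[OF pat]] unfolding fW .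
      moreover have "finite V" "finite V'" using fW by auto
      ultimately have sz: "szeq N V V'" for N by (simp add: szeq_def)
      have feq: "f x = f y \<longleftrightarrow> f' x = f' y" if xy: "x \<in> W" "y \<in> W" for x y
      proof -
        obtain i j where "i < n" "x = a i" "j < n" "y = a j" using xy unfolding aW[symmetric] by auto
        then show ?thesis using pat by (auto simp: samepat_def)
      qed
      have "sat (Sets \<U> Surj) V (f \<circ> \<nu>) (\<sigma> i) \<longleftrightarrow> sat (Sets \<U> Surj) V' (f' \<circ> \<nu>) (\<sigma> i)" for i
      proof (rule stable[OF sets_cat_Sets[OF assms(1)] _ _ sz])
        show "samepat (fv (\<sigma> i)) (f \<circ> \<nu>) (f' \<circ> \<nu>)"
          unfolding samepat_def
        proof (intro ballI)
          fix x y assume "x \<in> fv (\<sigma> i)" "y \<in> fv (\<sigma> i)"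
          then have "\<nu> x \<in> W" "\<nu> y \<in> W" using \<sigma> by blast+
          then show "(f \<circ> \<nu>) x = (f \<circ> \<nu>) y \<longleftrightarrow> (f' \<circ> \<nu>) x = (f' \<circ> \<nu>) y" using feq by simp
        qed
        show "(f \<circ> \<nu>) ` fv (\<sigma> i) \<subseteq> V" "(f' \<circ> \<nu>) ` fv (\<sigma> i) \<subseteq> V'"
          using \<sigma> hom_image[OF V(2)] hom_image[OF V(4)] by fastforce+
      qed (use V in auto)
      then show ?thesis using V(5) by (simp add: wtype_def)
    qed
    let ?node = "\<lambda>s :: nat rel \<times> nat set. {..<n} // fst s"
    have inj: "inj_on ?node types"
    proof (rule inj_onI)
      fix s s' assume s: "s \<in> types" "s' \<in> types" "?node s = ?node s'"
      then have "fst s \<in> eqvs n" "fst s' \<in> eqvs n" using types_onto by blast+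
      then have "fst s = fst s'" using eqv_ext s(3) by blast
      moreover obtain V f V' f' where V: "s = tp V f" "V \<in> \<U>" "f \<in> hom_maps Surj W V"
        "s' = tp V' f'" "V' \<in> \<U>" "f' \<in> hom_maps Surj W V'"
        using s(1,2) unfolding types_def by blast
      ultimately have "ker n (f \<circ> a) = ker n (f' \<circ> a)" by (simp add: wtype_def)
      from det[OF V(2,3,5,6) this] show "s = s'" unfolding V(1,4) .
    qed
    have X: "?node ` types = partitions n"
    proof -
      have "?node ` types = (\<lambda>E. {..<n} // E) ` fst ` types" by (simp add: image_image)
      also have "\<dots> = partitions n"
        unfolding types_onto using quotient_partitions quotient_part_rel part_rel_eqv
        by (auto simp: image_iff) metis
      finally show ?thesis .
    qed
    have "types_rel ?node = refinement n"
    proof -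
      have iff: "fst s \<subseteq> fst s' \<longleftrightarrow> (?node s, ?node s') \<in> refinement n" if "s \<in> types" "s' \<in> types" for s s'
      proof -
        have "equiv {..<n} (fst s)" "equiv {..<n} (fst s')" using that types_onto by blast+
        then show ?thesis
          using refinement_iff[OF quotient_partitions quotient_partitions] part_rel_quotient by metis
      qed
      have "refinement n \<subseteq> ?node ` types \<times> ?node ` types" unfolding X by (rule refinement_sub)
      then show ?thesis unfolding types_rel_def using iff by (intro equalityI subrelI) blast+
    qed
    then show "sat (Sets \<U> Surj) W \<nu> (inst \<sigma> p)"
      using types_valid[OF inj] p X unfolding Partition_def by simp
  qed
qed

lemma Prepartition_complete:
  assumes "set_universe \<U>" "W \<in> \<U>" "finite W" "card W = n" "n > 0"
  shows "Val_form (Sets \<U> Func) W L_eq \<subseteq> Prepartition TYPE('w) n"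
proof
  fix p assume p: "p \<in> Val_form (Sets \<U> Func) W L_eq"
  obtain a where a: "bij_betw a {..<n} W" by (rule finite_enumeration[OF assms(3,4)])
  show "p \<in> Prepartition TYPE('w) n"
    unfolding Prepartition_def frame_valid_def
  proof (intro CollectI allI impI ballI, rule ccontr)
    fix X :: "'w set" and r V w
    assume pre: "partition_prelattice n X r" and w: "w \<in> X" "\<not> ksat X r V w p"
    then have r: "trans r" "refl_on X r" by (auto simp: partition_prelattice_def preorder_on_def)
    obtain \<kappa> where "\<kappa> ` X = eqvs n" "\<And>x y. x \<in> X \<Longrightarrow> y \<in> X \<Longrightarrow> (x, y) \<in> r \<longleftrightarrow> \<kappa> x \<subseteq> \<kappa> y"
      using prelattice_eqv[OF pre] by metis
    then obtain G where G: "eqv_map n X r G" "(G (Id_on {..<n}), w) \<in> r" "(w, G (Id_on {..<n})) \<in> r"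
      using eqv_map_cone[of \<kappa> X n r w] w(1) by blast
    have "W \<noteq> {}" using assms by auto
    from not_valid_Func(1)[OF assms(1) r G(1) w(2,1) G(2,3) assms(2) this, of a] a p
    show False by (simp add: bij_betw_def)
  qed
qed

lemma Partition_complete:
  assumes "set_universe \<U>" "W \<in> \<U>" "finite W" "card W = n" "n > 0"
  shows "Val_form (Sets \<U> Surj) W L_eq \<subseteq> Partition n"
proof
  fix p assume p: "p \<in> Val_form (Sets \<U> Surj) W L_eq"
  obtain a where a: "bij_betw a {..<n} W" by (rule finite_enumeration[OF assms(3,4)])
  let ?X = "partitions n" and ?r = "refinement n"
  have \<kappa>: "part_rel ` ?X = eqvs n"
    using part_rel_eqv quotient_partitions part_rel_quotient by (auto simp: image_iff) metis
  have tr: "trans ?r" "refl_on ?X ?r" "antisym ?r"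
  proof -
    have mem: "P \<in> ?X \<and> Q \<in> ?X" if "(P, Q) \<in> ?r" for P Q using that refinement_sub by blast
    show "refl_on ?X ?r" using refinement_iff by (auto simp: refl_on_def)
    show "trans ?r"
      using refinement_iff mem by (intro transI) (metis subset_trans)
    show "antisym ?r"
      using refinement_iff mem quotient_part_rel by (intro antisymI) (metis subset_antisym)
  qed
  show "p \<in> Partition n"
    unfolding Partition_def frame_valid_def
  proof (intro CollectI allI ballI, rule ccontr)
    fix V w assume w: "w \<in> ?X" "\<not> ksat ?X ?r V w p"
    obtain G where G: "eqv_map n ?X ?r G" "(G (Id_on {..<n}), w) \<in> ?r" "(w, G (Id_on {..<n})) \<in> ?r"
      using eqv_map_cone[OF \<kappa> refinement_iff w(1)] by blast
    from not_valid_quotients[OF sets_cat_Sets[OF assms(1)] _ _ tr G(1) w(2,1) G(2,3), where W = W and \<nu> = a] a assms(2) p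
    show False by (simp add: bij_betw_def)
  qed
qed

section \<open>The empty world\<close>

text \<open>For sentences, only the world matters and not the morphism into it. The nonempty worlds access each other,
  and the empty world accesses all of them. Nonempty worlds with the same true substituted
  sentences are identified to fit the frame into the type of nodes.\<close>

lemma Lollipop_sound:
  assumes "set_universe \<U>" "infinite (UNIV :: 'w set)"
  shows "Lollipop TYPE('w) \<subseteq> Val_sent (Sets \<U> Func) {} UNIV"
proof
  fix p assume p: "p \<in> Lollipop TYPE('w)"
  let ?C = "Sets \<U> Func"
  show "p \<in> Val_sent ?C {} UNIV"
    unfolding Val_sent_def
  proof (intro CollectI allI impI)
    fix \<sigma> :: "nat \<Rightarrow> fm" and \<nu> assume "\<forall>i. \<sigma> i \<in> UNIV \<and> fv (\<sigma> i) = {}"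
    then have fv: "fv (inst \<sigma> q) = {}" for q by (simp add: fv_inst)
    have eq: "sat ?C U \<mu> (inst \<sigma> q) \<longleftrightarrow> sat ?C U \<nu> (inst \<sigma> q)" for U \<mu> q
      by (rule sat_cong) (simp add: fv)
    define tp where "tp U = (U = {}, {i \<in> pvars p. sat ?C U \<nu> (\<sigma> i)})" for U
    define R where "R = tp ` \<U>"
    have "finite R" by (rule finite_subset[of _ "UNIV \<times> Pow (pvars p)"]) (auto simp: R_def tp_def)
    moreover obtain B :: "'w set" where "finite B" "card B = card R"
      using infinite_arbitrarily_large[OF assms(2)] by blast
    ultimately obtain node where "bij_betw node R B" using finite_same_card_bij by metis
    then have inj: "inj_on node R" by (simp add: bij_betw_def)
    define X where "X = node ` R"
    define r where "r = {(node s, node s') | s s'. s \<in> R \<and> s' \<in> R \<and> (fst s \<or> \<not> fst s')}"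
    define V where "V i = {node s | s. s \<in> R \<and> i \<in> snd s}" for i
    have rel: "(node s, node s') \<in> r \<longleftrightarrow> fst s \<or> \<not> fst s'" if "s \<in> R" "s' \<in> R" for s s'
      using that inj_onD[OF inj] unfolding r_def by blast
    have acc: "(\<exists>g. g \<in> hom_maps Func U U') \<longleftrightarrow> U = {} \<or> U' \<noteq> {}" for U U' :: "'a set"
      by (auto simp: PiE_eq_empty_iff ex_in_conv)
    have truth: "ksat X r V (node (tp U)) q \<longleftrightarrow> sat ?C U \<nu> (inst \<sigma> q)"
      if "pvars q \<subseteq> pvars p" "U \<in> \<U>" for U q
      using that
    proof (induction q arbitrary: U)
      case (PVar i)
      have t: "tp U \<in> R" using PVar by (simp add: R_def)
      have "node (tp U) \<in> V i \<longleftrightarrow> i \<in> snd (tp U)"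
        using t inj_onD[OF inj _ t] unfolding V_def by blast
      then show ?case using PVar by (simp add: tp_def)
    next
      case (PBox q)
      then have IH: "ksat X r V (node (tp U')) q \<longleftrightarrow> sat ?C U' \<nu> (inst \<sigma> q)" if "U' \<in> \<U>" for U'
        using that by simp
      have t: "tp U \<in> R" using PBox.prems by (simp add: R_def)
      have "ksat X r V (node (tp U)) (PBox q) \<longleftrightarrow>
          (\<forall>s\<in>R. fst (tp U) \<or> \<not> fst s \<longrightarrow> ksat X r V (node s) q)"
        unfolding ksat.simps X_def using rel[OF t] by blast
      also have "\<dots> \<longleftrightarrow> (\<forall>U'\<in>\<U>. fst (tp U) \<or> \<not> fst (tp U') \<longrightarrow> sat ?C U' \<nu> (inst \<sigma> q))"
        unfolding R_def using IH by blast
      also have "\<dots> \<longleftrightarrow> (\<forall>U'\<in>\<U>. U = {} \<or> U' \<noteq> {} \<longrightarrow> sat ?C U' \<nu> (inst \<sigma> q))"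
        by (simp add: tp_def)
      also have "\<dots> \<longleftrightarrow> (\<forall>U'\<in>\<U>. \<forall>g\<in>hom_maps Func U U'. sat ?C U' (g \<circ> \<nu>) (inst \<sigma> q))"
        unfolding acc[symmetric] eq[of _ "_ \<circ> \<nu>"] by blast
      finally show ?case unfolding inst.simps sat.simps Obj_Sets Hom_Sets .
    next
      case (PDia q)
      then have IH: "ksat X r V (node (tp U')) q \<longleftrightarrow> sat ?C U' \<nu> (inst \<sigma> q)" if "U' \<in> \<U>" for U'
        using that by simp
      have t: "tp U \<in> R" using PDia.prems by (simp add: R_def)
      have "ksat X r V (node (tp U)) (PDia q) \<longleftrightarrow>
          (\<exists>s\<in>R. (fst (tp U) \<or> \<not> fst s) \<and> ksat X r V (node s) q)"
        unfolding ksat.simps X_def using rel[OF t] by blast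
      also have "\<dots> \<longleftrightarrow> (\<exists>U'\<in>\<U>. (fst (tp U) \<or> \<not> fst (tp U')) \<and> sat ?C U' \<nu> (inst \<sigma> q))"
        unfolding R_def using IH by blast
      also have "\<dots> \<longleftrightarrow> (\<exists>U'\<in>\<U>. (U = {} \<or> U' \<noteq> {}) \<and> sat ?C U' \<nu> (inst \<sigma> q))"
        by (simp add: tp_def)
      also have "\<dots> \<longleftrightarrow> (\<exists>U'\<in>\<U>. \<exists>g\<in>hom_maps Func U U'. sat ?C U' (g \<circ> \<nu>) (inst \<sigma> q))"
        unfolding acc[symmetric] eq[of _ "_ \<circ> \<nu>"] by blast
      finally show ?case unfolding inst.simps sat.simps Obj_Sets Hom_Sets .
    qed auto
    have e: "{} \<in> \<U>" using universe_finite[OF assms(1)] by simp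
    obtain U1 where U1: "U1 \<in> \<U>" "U1 \<noteq> {}" using assms(1) unfolding set_universe_def by auto
    have eR: "tp {} \<in> R" and uR: "tp U1 \<in> R" using e U1 by (auto simp: R_def)
    have bottom: "s = tp {}" if "s \<in> R" "fst s" for s using that by (auto simp: R_def tp_def)
    have XR: "x \<in> X - {node (tp {})} \<longleftrightarrow> (\<exists>s\<in>R. x = node s \<and> \<not> fst s)" for x
    proof
      assume "x \<in> X - {node (tp {})}"
      then show "\<exists>s\<in>R. x = node s \<and> \<not> fst s" using bottom by (auto simp: X_def)
    next
      assume "\<exists>s\<in>R. x = node s \<and> \<not> fst s"
      then obtain s where s: "s \<in> R" "x = node s" "\<not> fst s" by blast
      then have "node s \<noteq> node (tp {})" using inj_onD[OF inj _ s(1) eR] by (auto simp: tp_def)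
      then show "x \<in> X - {node (tp {})}" using s by (simp add: X_def)
    qed
    have "lollipop_frame X r (node (tp {}))"
      unfolding lollipop_frame_def
    proof (intro conjI ballI)
      show "preorder_on X r"
        unfolding preorder_on_def
      proof (intro conjI)
        show "r \<subseteq> X \<times> X" by (auto simp: r_def X_def)
        show "refl_on X r" using rel by (auto simp: refl_on_def X_def)
        show "trans r"
        proof (rule transI)
          fix x y z assume "(x, y) \<in> r" "(y, z) \<in> r"
          moreover from this obtain s t u where "s \<in> R" "t \<in> R" "u \<in> R" "x = node s" "y = node t" "z = node u"
            unfolding r_def by blast
          ultimately show "(x, z) \<in> r" using rel by auto
        qed
      qed
      show "node (tp {}) \<in> X" using eR by (simp add: X_def)
      have "node (tp U1) \<in> X - {node (tp {})}" unfolding XR using uR U1 by (auto simp: tp_def)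
      then show "X - {node (tp {})} \<noteq> {}" by blast
      show "(node (tp {}), x) \<in> r" "(x, node (tp {})) \<notin> r" if "x \<in> X - {node (tp {})}" for x
        using that rel eR unfolding XR by (auto simp: tp_def)
      show "(x, y) \<in> r" if "x \<in> X - {node (tp {})}" "y \<in> X - {node (tp {})}" for x y
        using that rel unfolding XR by auto
    qed
    then have "ksat X r V (node (tp {})) p" using p unfolding Lollipop_def by blast
    then show "sat ?C {} \<nu> (inst \<sigma> p)" using truth[OF subset_refl e] by blast
  qed
qed

text \<open>The empty world simulates the initial node, and a nonempty world simulates a node of the cluster that its
  size selects.\<close>

lemma Lollipop_complete:
  assumes "set_universe \<U>"
  shows "Val_sent (Sets \<U> Func) {} L_eq \<subseteq> Lollipop TYPE('w)"
proof
  fix p assume p: "p \<in> Val_sent (Sets \<U> Func) {} L_eq"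
  show "p \<in> Lollipop TYPE('w)"
    unfolding Lollipop_def
  proof (intro CollectI allI impI, rule ccontr)
    fix X :: "'w set" and r c V
    assume L: "lollipop_frame X r c" and nk: "\<not> ksat X r V c p"
    have r: "trans r" "refl_on X r" and c: "c \<in> X"
      using L by (auto simp: lollipop_frame_def preorder_on_def)
    obtain x0 where x0: "x0 \<in> X - {c}" using L by (auto simp: lollipop_frame_def)
    have cx: "(c, x) \<in> r" "(x, c) \<notin> r" if "x \<in> X - {c}" for x using L that by (auto simp: lollipop_frame_def)
    have xy: "(x, y) \<in> r" if "x \<in> X - {c}" "y \<in> X - {c}" for x y using L that by (auto simp: lollipop_frame_def)
    obtain pat :: "nat \<Rightarrow> nat set" and m where pat: "pat ` {..<m} = Pow (pvars p)"
      by (rule pattern_enumeration)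
    define ty where "ty x = {i \<in> pvars p. x \<in> V i}" for x
    define mem where "mem j = (if \<exists>y\<in>X - {c}. ty y = pat j then SOME y. y \<in> X - {c} \<and> ty y = pat j else x0)" for j
    have mem: "mem j \<in> X - {c}" for j
    proof (cases "\<exists>y\<in>X - {c}. ty y = pat j")
      case True
      then have "\<exists>y. y \<in> X - {c} \<and> ty y = pat j" by blast
      from someI_ex[OF this] show ?thesis using True unfolding mem_def by auto
    next
      case False
      then show ?thesis using x0 by (simp add: mem_def)
    qed
    have mem_alike: "alike r V p (mem j) y" if "y \<in> X - {c}" "ty y = pat j" for y j
    proof -
      have ex: "\<exists>y. y \<in> X - {c} \<and> ty y = pat j" using that by blast
      from someI_ex[OF ex] have "ty (mem j) = ty y" using that unfolding mem_def by auto
      then have "\<forall>i\<in>pvars p. mem j \<in> V i \<longleftrightarrow> y \<in> V i" unfolding ty_def by blast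
      then show ?thesis using xy mem that(1) by (auto simp: alike_def)
    qed
    define F where "F t = (if t = 0 then c else mem (t - 1))" for t
    let ?N = "Suc m"
    have F0: "F (trunc ?N U) = c \<longleftrightarrow> U = {}" for U :: "'a set"
      using mem[of "trunc ?N U - 1"] trunc_0[of ?N U] by (auto simp: F_def)
    have e: "{} \<in> \<U>" using universe_finite[OF assms] by simp
    have rr: "(F t, F t') \<in> r" if "t \<noteq> 0 \<Longrightarrow> t' \<noteq> 0" for t t'
      using that mem cx xy r(2) c by (auto simp: F_def refl_on_def)
    have "p \<notin> Val_sent (Sets \<U> Func) {} L_eq"
    proof (rule not_valid_by_simulation(2)[where F = "\<lambda>_. F" and K = \<U> and n = 0 and N = ?N and k = Func
          and \<nu> = undefined, OF _ r nk c e])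
      show "alike r V p (F (trunc ?N ({} :: 'a set))) c"
      proof -
        have "F (trunc ?N ({} :: 'a set)) = c" using F0 by blast
        then show ?thesis using r(2) c by (simp add: alike_def refl_on_def)
      qed
      fix U :: "'a set" assume U: "U \<in> \<U>"
      show "F (trunc ?N U) \<in> X" using mem c by (auto simp: F_def)
      show "U' \<in> \<U> \<and> (F (trunc ?N U), F (trunc ?N U')) \<in> r"
        if "U' \<in> Obj (Sets \<U> Func)" "g \<in> hom_maps Func U U'" for U' g
      proof -
        have "U \<noteq> {} \<Longrightarrow> U' \<noteq> {}" using hom_image[OF that(2)] by blast
        then have "(F (trunc ?N U), F (trunc ?N U')) \<in> r"
          using trunc_0[of ?N U] trunc_0[of ?N U'] by (intro rr) simp
        then show ?thesis using that(1) by simp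
      qed
      fix y assume y: "y \<in> X" "(F (trunc ?N U), y) \<in> r"
      show "\<exists>U'\<in>Obj (Sets \<U> Func). \<exists>g\<in>hom_maps Func U U'. alike r V p (F (trunc ?N U')) y"
      proof (cases "y = c")
        case True
        have "U = {}"
        proof (rule ccontr)
          assume "U \<noteq> {}"
          then have "F (trunc ?N U) \<in> X - {c}" using F0[of U] mem c by (auto simp: F_def)
          then show False using cx(2) y(2) True by blast
        qed
        then have "alike r V p (F (trunc ?N U)) y"
          using True r(2) c F0[of U] by (auto simp: alike_def refl_on_def)
        then show ?thesis using U id_hom unfolding Obj_Sets by blast
      next
        case False
        have "ty y \<in> pat ` {..<m}" unfolding pat by (auto simp: ty_def)
        then obtain j where j: "j < m" "pat j = ty y" by auto
        obtain U' where U': "U' \<in> \<U>" "finite U'" "card U' = Suc j" using finite_world_exists[OF assms] by blast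
        then obtain u where "u \<in> U'" by fastforce
        then have g: "(\<lambda>x\<in>U. u) \<in> hom_maps Func U U'" by auto
        have "trunc ?N U' = Suc j" by (rule trunc_less) (use U' j in auto)
        then have "alike r V p (F (trunc ?N U')) y"
          using mem_alike[of y j] y(1) False j by (simp add: F_def)
        then show ?thesis using U'(1) g unfolding Obj_Sets by blast
      qed
    qed simp_all
    then show False using p by simp
  qed
qed

section \<open>Completeness in the categories of sets\<close>

lemma infinite_parameters:
  assumes "infinite W"
  obtains \<nu> :: "nat \<Rightarrow> 'a" where "inj_on \<nu> {..<n}" "\<nu> ` {..<n} \<subseteq> (W :: 'a set)"
proof -
  obtain f :: "nat \<Rightarrow> 'a" where "inj f" "range f \<subseteq> W" using infinite_countable_subset[OF assms] by blast
  then have "f ` {..<n} \<subseteq> W" "inj_on f {..<n}" by (auto intro: inj_on_subset)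
  then show ?thesis using that[of f] by blast
qed

lemma S5_complete:
  assumes "set_universe \<U>" "W \<in> \<U>" "W \<noteq> {}"
  shows "Val_sent (Sets \<U> Func) W L_eq \<subseteq> S5"
proof
  fix p assume p: "p \<in> Val_sent (Sets \<U> Func) W L_eq"
  show "p \<in> S5"
  proof (rule ccontr)
    assume "p \<notin> S5"
    then obtain X :: "pm set set" and V w where w: "w \<in> X" "\<not> ksat X (X \<times> X) V w p"
      using complete_S5 by blast
    have G: "eqv_map 0 X (X \<times> X) (\<lambda>_. w)" using w by (auto simp: eqv_map_def)
    have "p \<notin> Val_sent (Sets \<U> Func) W L_eq"
      by (rule not_valid_Func(2)[OF assms(1) _ _ G w(2,1) _ _ assms(2,3)])
        (use w(1) in \<open>auto simp: trans_def refl_on_def\<close>)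
    then show False using p by simp
  qed
qed

lemma S4_2_complete:
  assumes "set_universe \<U>" "W \<in> \<U>" "infinite W"
  shows "Val_form (Sets \<U> Func) W L_eq \<subseteq> S4_2"
proof
  fix p assume p: "p \<in> Val_form (Sets \<U> Func) W L_eq"
  show "p \<in> S4_2"
  proof (rule ccontr)
    assume "p \<notin> S4_2"
    obtain X :: "pm set set" and r V w t where X: "finite X" "preorder_on X r" "w \<in> X" "t \<in> X"
      "\<forall>x\<in>X. (w, x) \<in> r \<and> (x, t) \<in> r" "\<not> ksat X r V w p"
      using complete_S4_2[OF \<open>p \<notin> S4_2\<close>] by (elim exE conjE) (rule that)
    obtain n G where G: "eqv_map n X r G" "(G (Id_on {..<n}), w) \<in> r" "(w, G (Id_on {..<n})) \<in> r"
      using eqv_map_directed[OF X(1-5)] by blast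
    obtain \<nu> where \<nu>: "inj_on \<nu> {..<n}" "\<nu> ` {..<n} \<subseteq> W" by (rule infinite_parameters[OF assms(3)])
    have r: "trans r" "refl_on X r" using X(2) by (auto simp: preorder_on_def)
    have "W \<noteq> {}" using assms(3) by auto
    from not_valid_Func(1)[OF assms(1) r G(1) X(6,3) G(2,3) assms(2) this \<nu>] show False using p by simp
  qed
qed

lemma Grz_2_complete:
  assumes C: "sets_cat \<U> k C" "k \<in> {Func, Surj}" "Obj C = \<U> \<Longrightarrow> k = Surj" and W: "W \<in> Obj C" "infinite W"
  shows "Val_form C W L_eq \<subseteq> Grz_2"
proof
  fix p assume p: "p \<in> Val_form C W L_eq"
  show "p \<in> Grz_2"
  proof (rule ccontr)
    assume "p \<notin> Grz_2"
    obtain X :: "(pm set \<times> pm set set) set" and r V w t where X: "finite X" "partial_order_on X r"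
      "w \<in> X" "t \<in> X" "\<forall>x\<in>X. (w, x) \<in> r \<and> (x, t) \<in> r" "\<not> ksat X r V w p"
      using complete_Grz_2[OF \<open>p \<notin> Grz_2\<close>] by (elim exE conjE) (rule that)
    then have pre: "preorder_on X r" and r: "trans r" "refl_on X r" "antisym r"
      by (auto simp: partial_order_on_def preorder_on_def)
    obtain n G where G: "eqv_map n X r G" "(G (Id_on {..<n}), w) \<in> r" "(w, G (Id_on {..<n})) \<in> r"
      using eqv_map_directed[OF X(1) pre X(3-5)] by blast
    obtain \<nu> where \<nu>: "inj_on \<nu> {..<n}" "\<nu> ` {..<n} \<subseteq> W" by (rule infinite_parameters[OF W(2)])
    from not_valid_quotients[OF C r G(1) X(6,3) G(2,3) W(1) \<nu>] show False using p by simp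
  qed
qed

lemma Grz_3_Surj_complete:
  assumes "set_universe \<U>" "W \<in> \<U>" "infinite W"
  shows "Val_sent (Sets \<U> Surj) W L_eq \<subseteq> Grz_3"
proof
  fix p assume p: "p \<in> Val_sent (Sets \<U> Surj) W L_eq"
  show "p \<in> Grz_3"
  proof (rule ccontr)
    assume "p \<notin> Grz_3"
    then obtain m V where m: "m > 0" "\<not> ksat {..<m :: nat} {(i, j). i \<le> j} V 0 p" using complete_Grz_3 by blast
    have "large m W" using assms(3) by (simp add: large_def)
    from not_valid_Surj_chain[OF assms(1,2) m(1) this m(2)] show False using p by simp
  qed
qed

lemma Grz_3J_complete:
  assumes "set_universe \<U>" "W \<in> \<U>" "finite W" "card W = n" "n > 0"
  shows "Val_sent (Sets \<U> Surj) W L_eq \<subseteq> Grz_3J n"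
proof
  fix p assume p: "p \<in> Val_sent (Sets \<U> Surj) W L_eq"
  show "p \<in> Grz_3J n"
  proof (rule ccontr)
    assume "p \<notin> Grz_3J n"
    then obtain m V where m: "m > 0" "m \<le> n" "\<not> ksat {..<m :: nat} {(i, j). i \<le> j} V 0 p"
      using complete_Grz_3J assms(5) by blast
    have "large m W" using assms(4) m(2) by (simp add: large_def)
    from not_valid_Surj_chain[OF assms(1,2) m(1) this m(3)] show False using p by simp
  qed
qed

lemma Grz_3_Inj_complete:
  assumes "set_universe \<U>" "W \<in> \<U>" "finite W" "k \<in> {Inj, Incl}"
  shows "Val_sent (Sets \<U> k) W L_eq \<subseteq> Grz_3"
proof
  fix p assume p: "p \<in> Val_sent (Sets \<U> k) W L_eq"
  show "p \<in> Grz_3"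
  proof (rule ccontr)
    assume "p \<notin> Grz_3"
    then obtain m V where m: "m > 0" "\<not> ksat {..<m :: nat} {(i, j). i \<le> j} V 0 p" using complete_Grz_3 by blast
    from not_valid_Inj_chain[OF assms(1-3) m(1) assms(4) m(2)] show False using p by simp
  qed
qed

lemma Val_FinSets:
  assumes "set_universe \<U>" "W \<in> Obj (FinSets \<U> k)"
  shows "Val_sent (FinSets \<U> k) W L = Val_sent (Sets \<U> k) W L"
    "Val_form (FinSets \<U> k) W L = Val_form (Sets \<U> k) W L"
proof -
  have eq: "sat (FinSets \<U> k) W \<nu> (inst \<sigma> p) \<longleftrightarrow> sat (Sets \<U> k) W \<nu> (inst \<sigma> p)"
    if "\<forall>i. \<nu> ` fv (\<sigma> i) \<subseteq> W" for \<nu> \<sigma> p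
    by (rule sat_FinSets[OF assms(1)]) (use assms(2) that in \<open>auto simp: fv_inst\<close>)
  show "Val_form (FinSets \<U> k) W L = Val_form (Sets \<U> k) W L"
    unfolding Val_form_def by (rule Collect_cong) (simp add: eq)
  have "sat (FinSets \<U> k) W \<nu> (inst \<sigma> p) \<longleftrightarrow> sat (Sets \<U> k) W \<nu> (inst \<sigma> p)"
    if "\<forall>i. \<sigma> i \<in> L \<and> fv (\<sigma> i) = {}" for \<nu> \<sigma> p
    by (rule eq) (use that in auto)
  then show "Val_sent (FinSets \<U> k) W L = Val_sent (Sets \<U> k) W L"
    unfolding Val_sent_def by blast
qed

section \<open>The exact validities\<close>

lemma Val_form_empty: "Val_form C {} L = Val_sent C {} L"
proof -
  have "(\<forall>i. \<sigma> i \<in> L \<and> \<nu> ` fv (\<sigma> i) \<subseteq> {}) \<longleftrightarrow> (\<forall>i. \<sigma> i \<in> L \<and> fv (\<sigma> i) = {})" for \<sigma> :: "nat \<Rightarrow> fm" and \<nu> :: "nat \<Rightarrow> 'a"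
    by simp
  then show ?thesis unfolding Val_form_def Val_sent_def by blast
qed

lemma both_validities:
  assumes "T \<subseteq> Val_form C W UNIV" "Val_sent C W L_eq \<subseteq> T"
  shows "sentential_validities C W T" "formulaic_validities C W T"
  using assms Val_form_subset_sent[of C W UNIV] Val_form_subset_sent[of C W L_eq]
  by (auto intro!: sentential_validitiesI formulaic_validitiesI)

theorem mainTheorem1:
  fixes \<U> :: "'a set set"
  assumes "set_universe \<U>"
    and "infinite (UNIV :: 'w set)"
  shows
    "(\<comment> \<open>functions\<close>
      sentential_validities (Sets \<U> Func) {} (Lollipop TYPE('w)) \<and>
      formulaic_validities (Sets \<U> Func) {} (Lollipop TYPE('w)) \<and>
      (\<forall>n>0. \<forall>W\<in>Obj (Sets \<U> Func). finite W \<and> card W = n \<longrightarrow>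
         sentential_validities (Sets \<U> Func) W S5 \<and>
         formulaic_validities (Sets \<U> Func) W (Prepartition TYPE('w) n)) \<and>
      (\<forall>W\<in>Obj (Sets \<U> Func). infinite W \<longrightarrow>
         sentential_validities (Sets \<U> Func) W S5 \<and>
         formulaic_validities (Sets \<U> Func) W S4_2))
     \<and>
     (\<comment> \<open>surjections\<close>
      sentential_validities (Sets \<U> Surj) {} Triv \<and>
      formulaic_validities (Sets \<U> Surj) {} Triv \<and>
      (\<forall>n>0. \<forall>W\<in>Obj (Sets \<U> Surj). finite W \<and> card W = n \<longrightarrow>
         sentential_validities (Sets \<U> Surj) W (Grz_3J n) \<and>
         formulaic_validities (Sets \<U> Surj) W (Partition n)) \<and>
      (\<forall>W\<in>Obj (Sets \<U> Surj). infinite W \<longrightarrow>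
         sentential_validities (Sets \<U> Surj) W Grz_3 \<and>
         formulaic_validities (Sets \<U> Surj) W Grz_2))
     \<and>
     (\<comment> \<open>injections and inclusions\<close>
      \<forall>k\<in>{Inj, Incl}. \<forall>W\<in>Obj (Sets \<U> k).
        (finite W \<longrightarrow>
           sentential_validities (Sets \<U> k) W Grz_3 \<and>
           formulaic_validities (Sets \<U> k) W Grz_3) \<and>
        (infinite W \<longrightarrow>
           sentential_validities (Sets \<U> k) W Triv \<and>
           formulaic_validities (Sets \<U> k) W Triv))
     \<and>
     (\<comment> \<open>bijections and identities\<close>
      \<forall>k\<in>{Bij, Ident}. \<forall>W\<in>Obj (Sets \<U> k).
        sentential_validities (Sets \<U> k) W Triv \<and>
        formulaic_validities (Sets \<U> k) W Triv)
     \<and>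
     (\<comment> \<open>finite sets\<close>
      \<forall>k. \<forall>W\<in>Obj (FinSets \<U> k). \<forall>L. L_eq \<subseteq> L \<and> L \<subseteq> L_eq_dia \<longrightarrow>
        Val_sent (FinSets \<U> k) W L = Val_sent (Sets \<U> k) W L \<and>
        Val_form (FinSets \<U> k) W L = Val_form (Sets \<U> k) W L)
     \<and>
     (\<comment> \<open>infinite sets\<close>
      (\<forall>k. \<forall>W\<in>Obj (InfSets \<U> k). sentential_validities (InfSets \<U> k) W Triv) \<and>
      (\<forall>k\<in>{Func, Surj}. \<forall>W\<in>Obj (InfSets \<U> k).
         formulaic_validities (InfSets \<U> k) W Grz_2) \<and>
      (\<forall>k\<in>{Inj, Incl, Bij, Ident}. \<forall>W\<in>Obj (InfSets \<U> k).
         formulaic_validities (InfSets \<U> k) W Triv))"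
proof (intro conjI)
  note U = assms(1)
  have e: "{} \<in> \<U>" using universe_finite[OF U] by simp
  have S: "sets_cat \<U> k (Sets \<U> k)" for k by (rule sets_cat_Sets[OF U])
  have I: "sets_cat \<U> k (InfSets \<U> k)" for k by (rule sets_cat_InfSets[OF U])
  have L: "Lollipop TYPE('w) \<subseteq> Val_sent (Sets \<U> Func) {} UNIV"
    "Val_sent (Sets \<U> Func) {} L_eq \<subseteq> Lollipop TYPE('w)"
    by (rule Lollipop_sound[OF assms], rule Lollipop_complete[OF U])
  show "sentential_validities (Sets \<U> Func) {} (Lollipop TYPE('w))"
    by (rule sentential_validitiesI[OF L])
  show "formulaic_validities (Sets \<U> Func) {} (Lollipop TYPE('w))"
    by (rule formulaic_validitiesI) (use L in \<open>simp_all add: Val_form_empty\<close>)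
  show "\<forall>n>0. \<forall>W\<in>Obj (Sets \<U> Func). finite W \<and> card W = n \<longrightarrow>
      sentential_validities (Sets \<U> Func) W S5 \<and>
      formulaic_validities (Sets \<U> Func) W (Prepartition TYPE('w) n)"
  proof (intro allI ballI impI conjI)
    fix n :: nat and W assume "n > 0" "W \<in> Obj (Sets \<U> Func)" and f: "finite W \<and> card W = n"
    then have W: "W \<in> \<U>" "finite W" "card W = n" "n > 0" and ne: "W \<noteq> {}" by auto
    show "sentential_validities (Sets \<U> Func) W S5"
      by (rule sentential_validitiesI[OF S5_sound[OF U W(1) ne] S5_complete[OF U W(1) ne]])
    show "formulaic_validities (Sets \<U> Func) W (Prepartition TYPE('w) n)"
      by (rule formulaic_validitiesI[OF Prepartition_sound[OF assms W] Prepartition_complete[OF U W]])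
  qed
  show "\<forall>W\<in>Obj (Sets \<U> Func). infinite W \<longrightarrow> sentential_validities (Sets \<U> Func) W S5 \<and>
      formulaic_validities (Sets \<U> Func) W S4_2"
  proof (intro ballI impI conjI)
    fix W assume "W \<in> Obj (Sets \<U> Func)" and inf: "infinite W"
    then have W: "W \<in> \<U>" and ne: "W \<noteq> {}" by auto
    show "sentential_validities (Sets \<U> Func) W S5"
      by (rule sentential_validitiesI[OF S5_sound[OF U W ne] S5_complete[OF U W ne]])
    show "formulaic_validities (Sets \<U> Func) W S4_2"
      by (rule formulaic_validitiesI[OF S4_2_sound[OF U W ne] S4_2_complete[OF U W inf]])
  qed
  have T: "Triv \<subseteq> Val_form (Sets \<U> Surj) {} UNIV" "Val_sent (Sets \<U> Surj) {} L_eq \<subseteq> Triv"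
    by (rule Triv_Surj_empty[OF U], rule Val_sent_Triv[OF S]) (simp add: e)
  show "sentential_validities (Sets \<U> Surj) {} Triv" "formulaic_validities (Sets \<U> Surj) {} Triv"
    by (rule both_validities[OF T])+
  show "\<forall>n>0. \<forall>W\<in>Obj (Sets \<U> Surj). finite W \<and> card W = n \<longrightarrow>
      sentential_validities (Sets \<U> Surj) W (Grz_3J n) \<and>
      formulaic_validities (Sets \<U> Surj) W (Partition n)"
  proof (intro allI ballI impI conjI)
    fix n :: nat and W assume "n > 0" "W \<in> Obj (Sets \<U> Surj)" and f: "finite W \<and> card W = n"
    then have W: "W \<in> \<U>" "finite W" "card W = n" "n > 0" by auto
    show "sentential_validities (Sets \<U> Surj) W (Grz_3J n)"
      by (rule sentential_validitiesI[OF Grz_3J_Surj[OF U W] Grz_3J_complete[OF U W]])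
    show "formulaic_validities (Sets \<U> Surj) W (Partition n)"
      by (rule formulaic_validitiesI[OF Partition_sound[OF U W] Partition_complete[OF U W]])
  qed
  show "\<forall>W\<in>Obj (Sets \<U> Surj). infinite W \<longrightarrow> sentential_validities (Sets \<U> Surj) W Grz_3 \<and>
      formulaic_validities (Sets \<U> Surj) W Grz_2"
  proof (intro ballI impI conjI)
    fix W assume W': "W \<in> Obj (Sets \<U> Surj)" and inf: "infinite W"
    then have W: "W \<in> \<U>" and ne: "W \<noteq> {}" by auto
    show "sentential_validities (Sets \<U> Surj) W Grz_3"
      by (rule sentential_validitiesI[OF Grz_3_Surj[OF U W ne] Grz_3_Surj_complete[OF U W inf]])
    have "Val_form (Sets \<U> Surj) W L_eq \<subseteq> Grz_2"
      by (rule Grz_2_complete[OF S _ _ W' inf]) simp_all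
    then show "formulaic_validities (Sets \<U> Surj) W Grz_2"
      by (rule formulaic_validitiesI[OF Grz_2_Surj[OF U W ne]])
  qed
  show "\<forall>k\<in>{Inj, Incl}. \<forall>W\<in>Obj (Sets \<U> k).
      (finite W \<longrightarrow> sentential_validities (Sets \<U> k) W Grz_3 \<and> formulaic_validities (Sets \<U> k) W Grz_3) \<and>
      (infinite W \<longrightarrow> sentential_validities (Sets \<U> k) W Triv \<and> formulaic_validities (Sets \<U> k) W Triv)"
  proof (intro ballI)
    fix k W assume k: "k \<in> {Inj, Incl}" and W': "W \<in> Obj (Sets \<U> k)"
    then have W: "W \<in> \<U>" by simp
    have "sentential_validities (Sets \<U> k) W Grz_3 \<and> formulaic_validities (Sets \<U> k) W Grz_3" if "finite W"
      using both_validities[OF Grz_3_Inj[OF U W k] Grz_3_Inj_complete[OF U W that k]] by blast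
    moreover have "sentential_validities (Sets \<U> k) W Triv \<and> formulaic_validities (Sets \<U> k) W Triv"
      if "infinite W"
    proof -
      have "Triv \<subseteq> Val_form (Sets \<U> k) W UNIV"
        by (rule Triv_rigid[OF S W']) (use k that in blast)
      from both_validities[OF this Val_sent_Triv[OF S W']] show ?thesis by blast
    qed
    ultimately show "(finite W \<longrightarrow> sentential_validities (Sets \<U> k) W Grz_3 \<and>
        formulaic_validities (Sets \<U> k) W Grz_3) \<and>
      (infinite W \<longrightarrow> sentential_validities (Sets \<U> k) W Triv \<and> formulaic_validities (Sets \<U> k) W Triv)"
      by blast
  qed
  show "\<forall>k\<in>{Bij, Ident}. \<forall>W\<in>Obj (Sets \<U> k).
      sentential_validities (Sets \<U> k) W Triv \<and> formulaic_validities (Sets \<U> k) W Triv"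
  proof (intro ballI)
    fix k W assume k: "k \<in> {Bij, Ident}" and W: "W \<in> Obj (Sets \<U> k)"
    have "Triv \<subseteq> Val_form (Sets \<U> k) W UNIV"
      by (rule Triv_rigid[OF S W]) (use k in blast)
    from both_validities[OF this Val_sent_Triv[OF S W]]
    show "sentential_validities (Sets \<U> k) W Triv \<and> formulaic_validities (Sets \<U> k) W Triv" by blast
  qed
  show "\<forall>k. \<forall>W\<in>Obj (FinSets \<U> k). \<forall>L. L_eq \<subseteq> L \<and> L \<subseteq> L_eq_dia \<longrightarrow>
      Val_sent (FinSets \<U> k) W L = Val_sent (Sets \<U> k) W L \<and>
      Val_form (FinSets \<U> k) W L = Val_form (Sets \<U> k) W L"
    using Val_FinSets[OF U] by blast
  show "\<forall>k. \<forall>W\<in>Obj (InfSets \<U> k). sentential_validities (InfSets \<U> k) W Triv"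
    using sentential_validitiesI[OF Triv_InfSets[OF U] Val_sent_Triv[OF I]] by blast
  show "\<forall>k\<in>{Func, Surj}. \<forall>W\<in>Obj (InfSets \<U> k). formulaic_validities (InfSets \<U> k) W Grz_2"
  proof (intro ballI)
    fix k W assume k: "k \<in> {Func, Surj}" and W: "W \<in> Obj (InfSets \<U> k)"
    have "Obj (InfSets \<U> k) \<noteq> \<U>" using e by auto
    then have "Val_form (InfSets \<U> k) W L_eq \<subseteq> Grz_2"
      by (intro Grz_2_complete[OF I k _ W]) (use W in auto)
    then show "formulaic_validities (InfSets \<U> k) W Grz_2"
      by (rule formulaic_validitiesI[OF Grz_2_InfSets[OF U W k]])
  qed
  show "\<forall>k\<in>{Inj, Incl, Bij, Ident}. \<forall>W\<in>Obj (InfSets \<U> k). formulaic_validities (InfSets \<U> k) W Triv"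
  proof (intro ballI)
    fix k W assume k: "k \<in> {Inj, Incl, Bij, Ident}" and W: "W \<in> Obj (InfSets \<U> k)"
    have "infinite W" using W by simp
    then have "Triv \<subseteq> Val_form (InfSets \<U> k) W UNIV"
      by (intro Triv_rigid[OF I W]) (use k in blast)
    then show "formulaic_validities (InfSets \<U> k) W Triv"
      by (rule both_validities(2)[OF _ Val_sent_Triv[OF I W]])
  qed
qed

end
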